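(* Let $d\ge 1$ be an integer and let $K_d\subset\mathbb{R}^d$ be a $d$-dimensional convex body. For $\bm{\eta}=(\eta_1,\ldots,\eta_d)^\top\in\mathbb{R}^d\setminus\{0\}$ let $\bm{\sigma}=\bm{\sigma}(\bm{\eta})$ be the hyperplane $\{\mathbf{x}\in\mathbb{R}^d : \bm{\eta}^\top\mathbf{x}=1\}$. Then for every real $k>-1$, $$v_d^{(k)}(K_d)=\frac{(d-1)!}{d^k}\int_{\mathbb{R}^d\setminus K_d^\circ} v_{d-1}^{(k+1)}(\bm{\sigma}\cap K_d)\,\zeta_d^{\,d+k+1}(\bm{\sigma})\,\iota_d^{(k)}(\bm{\sigma})\,\lambda_d(\mathrm{d}\bm{\eta}),$$ where $$\zeta_d(\bm{\sigma})=\frac{\operatorname{vol}_{d-1}(\bm{\sigma}\cap K_d)}{\|\bm{\eta}\|\operatorname{vol}_d K_d},\qquad \iota_d^{(k)}(\bm{\sigma})=\int_{K_d}|\bm{\eta}^\top\mathbf{x}-1|^k\,\lambda_d(\mathrm{d}\mathbf{x}).$$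
   Context: A $d$-dimensional convex body is a compact convex set $K_d\subset\mathbb{R}^d$ with $\dim K_d=d$. $\lambda_d$ is Lebesgue measure on $\mathbb{R}^d$, $\operatorname{vol}_m$ is $m$-dimensional volume (with $\operatorname{vol}_0$ of a point equal to $1$), $\|\cdot\|$ is the Euclidean norm. For an $m$-dimensional convex body $K$ (lying in an $m$-dimensional affine space, which is identified isometrically with $\mathbb{R}^m$) and real $k$, the volumetric moment is $v_m^{(k)}(K)=\mathbb{E}[\Delta_m^k]/(\operatorname{vol}_m K)^k$, where $\Delta_m=\operatorname{vol}_m\operatorname{conv}(\mathbf{X}_0,\ldots,\mathbf{X}_m)$ and $\mathbf{X}_0,\ldots,\mathbf{X}_m$ are independent uniformly distributed random points in $K$. In particular $v_0^{(k)}=1$ for a point. The polar body is $K_d^\circ=\{\mathbf{x}\in\mathbb{R}^d : \mathbf{x}^\top\mathbf{y}\le 1 \text{ for all } \mathbf{y}\in K_d\}$. The integrand is understood to be $0$ for those $\bm{\eta}$ for which $\operatorname{vol}_{d-1}(\bm{\sigma}\cap K_d)=0$. *)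

theory Defs
  imports "HOL-Probability.Probability"
begin

definition polar :: "'a::euclidean_space set \<Rightarrow> 'a set" where
  "polar K = {x. \<forall>y\<in>K. x \<bullet> y \<le> 1}"

definition hyperplane :: "'a::euclidean_space \<Rightarrow> 'a set" where
  "hyperplane \<eta> = {x. \<eta> \<bullet> x = 1}"

text \<open>
  The space \<open>\<real>\<^sup>m\<close> is represented by the product measure \<open>\<Pi>\<^sub>M i\<in>{..<m}. lborel\<close>, so that \<open>m\<close> can be
  an arbitrary natural number; for \<open>m = 0\<close> this is a point of mass 1.  An \<open>m\<close>-dimensional affine
  subspace is identified with it isometrically by Cartesian coordinates: an origin \<open>p\<close> and an
  orthonormal system \<open>b 0, \<dots>, b (m - 1)\<close>.
\<close>

definition frame_map :: "nat \<Rightarrow> 'a::euclidean_space \<Rightarrow> (nat \<Rightarrow> 'a) \<Rightarrow> (nat \<Rightarrow> real) \<Rightarrow> 'a" where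
  "frame_map m p b c = p + (\<Sum>i<m. c i *\<^sub>R b i)"

definition is_frame :: "'a::euclidean_space set \<Rightarrow> nat \<Rightarrow> 'a \<Rightarrow> (nat \<Rightarrow> 'a) \<Rightarrow> bool" where
  "is_frame A m p b \<longleftrightarrow>
     (\<forall>i<m. \<forall>j<m. b i \<bullet> b j = (if i = j then 1 else 0)) \<and> range (frame_map m p b) = A"

lemma is_frame_exists:
  fixes A :: "'a::euclidean_space set"
  assumes "affine A" "A \<noteq> {}"
  shows "\<exists>p b. is_frame A (nat (aff_dim A)) p b"
proof -
  obtain p where p: "p \<in> A" using assms by blast
  define S where "S = (+) (- p) ` A"
  have S: "subspace S"
    unfolding S_def using affine_diffs_subspace[OF assms(1) p] by (simp add: image_def)
  have A: "A = (+) p ` S" by (auto simp: S_def image_image)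
  have ad: "nat (aff_dim A) = dim S"
    by (metis A S aff_dim_subspace aff_dim_translation_eq nat_int)
  obtain B where B: "B \<subseteq> S" "pairwise orthogonal B" "\<And>x. x \<in> B \<Longrightarrow> norm x = 1"
      "independent B" "card B = dim S" "span B = S"
    using orthonormal_basis_subspace[OF S] by metis
  have fin: "finite B" using B(4) independent_imp_finite by blast
  obtain b where b: "bij_betw b {..<dim S} B"
    using ex_bij_betw_nat_finite[OF fin] B(5) by (auto simp: atLeast0LessThan)
  have orth: "b i \<bullet> b j = (if i = j then 1 else 0)" if "i < dim S" "j < dim S" for i j
  proof (cases "i = j")
    case True
    have "b i \<in> B" using b that by (auto simp: bij_betw_def)
    then show ?thesis using B(3)[of "b i"] True by (simp add: norm_eq_1)
  next
    case False
    have "b i \<in> B" "b j \<in> B" "b i \<noteq> b j"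
      using b that False by (auto simp: bij_betw_def inj_on_def)
    then show ?thesis using B(2) False by (auto simp: pairwise_def orthogonal_def)
  qed
  have "range (\<lambda>c. \<Sum>i<dim S. c i *\<^sub>R b i) = S"
  proof (intro equalityI subsetI)
    fix x assume "x \<in> range (\<lambda>c. \<Sum>i<dim S. c i *\<^sub>R b i)"
    then show "x \<in> S"
      using b B(1) by (auto simp: bij_betw_def intro!: subspace_sum[OF S] subspace_scale[OF S])
  next
    fix x assume "x \<in> S"
    then have "x \<in> range (\<lambda>u. \<Sum>v\<in>B. u v *\<^sub>R v)"
      using B(6) span_finite[OF fin] by metis
    then obtain u where "x = (\<Sum>v\<in>B. u v *\<^sub>R v)" by blast
    also have "\<dots> = (\<Sum>i<dim S. u (b i) *\<^sub>R b i)"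
      by (rule sum.reindex_bij_betw[OF b, symmetric])
    finally show "x \<in> range (\<lambda>c. \<Sum>i<dim S. c i *\<^sub>R b i)"
      by (auto intro: range_eqI[where x = "\<lambda>i. u (b i)"])
  qed
  moreover have "range (frame_map (dim S) p b) = (+) p ` range (\<lambda>c. \<Sum>i<dim S. c i *\<^sub>R b i)"
    by (auto simp: frame_map_def)
  ultimately have "is_frame A (dim S) p b"
    using orth A by (simp add: is_frame_def)
  then show ?thesis using ad by auto
qed

text \<open>
  The measure does not depend on the frame chosen, as two frames of the same affine subspace
  differ by a Euclidean motion of \<open>\<real>\<^sup>m\<close>.
\<close>

definition flat_lborel :: "'a::euclidean_space set \<Rightarrow> 'a measure" where
  "flat_lborel A =
     (let m = nat (aff_dim A); (p, b) = (SOME (p, b). is_frame A m p b)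
      in distr (\<Pi>\<^sub>M i\<in>{..<m}. (lborel :: real measure)) borel (frame_map m p b))"

text \<open>
  The dimension \<open>m\<close> of the body and the affine space carrying it are read off from \<open>K\<close>.
  Real powers are written with \<open>powr\<close>, where \<open>0 powr k = 0\<close> for every \<open>k\<close>; for \<open>m \<ge> 1\<close> a random
  simplex has volume 0 only on a null set, and for \<open>m = 0\<close> it always has volume 1.
\<close>

definition volumetric_moment :: "real \<Rightarrow> 'a::euclidean_space set \<Rightarrow> real" where
  "volumetric_moment k K =
     (let m = nat (aff_dim K); M = flat_lborel (affine hull K)
      in (\<integral>X. measure M (convex hull (X ` {..m})) powr k \<partial>(\<Pi>\<^sub>M i\<in>{..m}. uniform_measure M K))
         / measure M K powr k)"

definition section_vol :: "'a::euclidean_space set \<Rightarrow> 'a \<Rightarrow> real" where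
  "section_vol K \<eta> = measure (flat_lborel (hyperplane \<eta>)) (hyperplane \<eta> \<inter> K)"

definition zeta :: "'a::euclidean_space set \<Rightarrow> 'a \<Rightarrow> real" where
  "zeta K \<eta> = section_vol K \<eta> / (norm \<eta> * measure lborel K)"

definition iota :: "real \<Rightarrow> 'a::euclidean_space set \<Rightarrow> 'a \<Rightarrow> real" where
  "iota k K \<eta> = (LINT x:K|lborel. \<bar>\<eta> \<bullet> x - 1\<bar> powr k)"

definition section_integrand :: "real \<Rightarrow> 'a::euclidean_space set \<Rightarrow> 'a \<Rightarrow> real" where
  "section_integrand k K \<eta> =
     (if section_vol K \<eta> = 0 then 0
      else volumetric_moment (k + 1) (hyperplane \<eta> \<inter> K)
           * zeta K \<eta> powr (real DIM('a) + k + 1) * iota k K \<eta>)"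

end

theory Submission
  imports Defs
begin

text \<open>
  The formula is an affine Blaschke--Petkantschin formula. Almost every \<open>d\<close>-tuple of points spans a
  hyperplane \<open>\<eta> \<bullet> x = 1\<close>; writing the hyperplane as a graph over the coordinates different from \<open>j\<close>,
  the heights of the points depend linearly on the coefficients of the graph, and the latter depend
  on \<open>\<eta>\<close> by a projective map with Jacobian \<open>1 / \<bar>\<eta> $ j\<bar> ^ (d + 1)\<close>. The volume of the simplex spanned by
  the \<open>d\<close> points and one further point is base times height over \<open>d\<close>, so the integral over all
  simplices splits for each \<open>\<eta>\<close> into a moment of the section and an integral of distances. The
  hyperplanes with \<open>\<eta> \<in> polar K\<close> that meet \<open>K\<close> support \<open>K\<close>, and their \<open>\<eta>\<close> lie on the frontier of \<open>polar K\<close>,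
  a null set.
\<close>

section \<open>Linear changes of variables\<close>

text \<open>The frame of each hyperplane is an arbitrary choice, so nothing about the dependence on
  \<eta> can be read off the definition of the section moment. Hence sections are integrated through
  their oblique projection along a fixed coordinate direction \<open>j\<close>, and all identities
  are proved for integrals in \<open>ennreal\<close>, where Fubini is free; \<open>k > -1\<close>
  enters through finiteness. The choice of \<open>j\<close> leaves no trace: Jacobian and height
  contribute \<bar>\<eta> $ j\<bar> to the power -(d + k + 1), and the same power remains of the
  section moment times \<open>zeta\<close> once \<open>norm \<eta>\<close> and the section volume
  have cancelled. The constant arises as (1 / d!)^k from the simplices in \<open>K\<close> times (d
  - 1)!^(k + 1) from those in the section, which is (d - 1)! / d^k. Integrability cannot be had with
  a fixed \<open>j\<close>, because the bounds blow up at \<eta> $ j = 0. There \<open>j\<close> is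
  the index of the largest coordinate of \<eta>, and the integrand is at most a constant times the
  Jacobian of the projective map.\<close>

lemma measurable_vec_lambda [measurable (raw)]:
  fixes f :: "'i::finite \<Rightarrow> 'b \<Rightarrow> 'a::euclidean_space"
  assumes "\<And>i. f i \<in> borel_measurable M"
  shows "(\<lambda>x. \<chi> i. f i x) \<in> borel_measurable M"
proof (subst borel_measurable_euclidean_space, intro ballI)
  fix b :: "'a^'i" assume "b \<in> Basis"
  then obtain i u where "b = axis i u" by (auto simp: Basis_vec_def)
  then show "(\<lambda>x. (\<chi> i. f i x) \<bullet> b) \<in> borel_measurable M"
    using assms by (simp add: inner_axis)
qed

lemma borel_measurable_vec_nth [measurable (raw)]:
  fixes f :: "'b \<Rightarrow> ('a::euclidean_space) ^ 'i::finite"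
  assumes "f \<in> borel_measurable M"
  shows "(\<lambda>x. f x $ i) \<in> borel_measurable M"
  using assms by (rule borel_measurable_continuous_on[rotated]) (intro continuous_intros)

lemma borel_measurable_det [measurable (raw)]:
  fixes A :: "'b \<Rightarrow> real^'n^'n"
  assumes "\<And>i j. (\<lambda>x. A x $ i $ j) \<in> borel_measurable M"
  shows "(\<lambda>x. det (A x)) \<in> borel_measurable M"
  unfolding det_def using assms by measurable

lemma nn_integral_lborel_translate:
  fixes f :: "'a::euclidean_space \<Rightarrow> ennreal"
  assumes [measurable]: "f \<in> borel_measurable borel"
  shows "(\<integral>\<^sup>+x. f (c + x) \<partial>lborel) = (\<integral>\<^sup>+x. f x \<partial>lborel)"
proof -
  have "(\<integral>\<^sup>+x. f x \<partial>lborel) = (\<integral>\<^sup>+x. f x \<partial>distr lborel borel ((+) c))"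
    by (simp add: lborel_distr_plus)
  also have "\<dots> = (\<integral>\<^sup>+x. f (c + x) \<partial>lborel)"
    by (subst nn_integral_distr) auto
  finally show ?thesis ..
qed

section \<open>Fubini along one coordinate direction\<close>

definition slab :: "'n \<Rightarrow> (real^'n) set" where
  "slab j = {x. 0 \<le> x $ j \<and> x $ j \<le> 1}"

lemma slab_borel [measurable]: "slab j \<in> sets borel"
  unfolding slab_def by measurable

text \<open>
  Integrals over hyperplanes transversal to \<open>axis j 1\<close> are written as integrals over \<open>slab j\<close> of
  functions that do not depend on the \<open>j\<close>-th coordinate; so no space of dimension \<open>CARD('n) - 1\<close>
  is needed.
\<close>

lemma nn_integral_slices:
  fixes h :: "real^'n \<Rightarrow> ennreal"
  assumes [measurable]: "h \<in> borel_measurable borel"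
  shows "(\<integral>\<^sup>+x. indicator (slab j) x * (\<integral>\<^sup>+t. h (x + (t - x $ j) *\<^sub>R axis j 1) \<partial>lborel) \<partial>lborel)
       = (\<integral>\<^sup>+x. h x \<partial>lborel)"
proof -
  have "(\<integral>\<^sup>+t. h (x + (t - x $ j) *\<^sub>R axis j 1) \<partial>lborel) = (\<integral>\<^sup>+t. h (x + t *\<^sub>R axis j 1) \<partial>lborel)" for x :: "real^'n"
    using nn_integral_lborel_translate[of "\<lambda>t. h (x + t *\<^sub>R axis j 1)" "- x $ j"] by simp
  then have "(\<integral>\<^sup>+x. indicator (slab j) x * (\<integral>\<^sup>+t. h (x + (t - x $ j) *\<^sub>R axis j 1) \<partial>lborel) \<partial>lborel)
      = (\<integral>\<^sup>+x. (\<integral>\<^sup>+t. indicator (slab j) x * h (x + t *\<^sub>R axis j 1) \<partial>lborel) \<partial>lborel)"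
    by (simp add: nn_integral_cmult)
  also have "\<dots> = (\<integral>\<^sup>+t. (\<integral>\<^sup>+x. indicator (slab j) x * h (x + t *\<^sub>R axis j 1) \<partial>lborel) \<partial>lborel)"
    by (rule lborel_pair.Fubini') measurable
  also have "\<dots> = (\<integral>\<^sup>+t. (\<integral>\<^sup>+x. indicator (slab j) (x - t *\<^sub>R axis j 1) * h x \<partial>lborel) \<partial>lborel)"
  proof (rule nn_integral_cong)
    fix t :: real
    show "(\<integral>\<^sup>+x. indicator (slab j) x * h (x + t *\<^sub>R axis j 1) \<partial>lborel)
        = (\<integral>\<^sup>+x. indicator (slab j) (x - t *\<^sub>R axis j 1) * h x \<partial>lborel)"
      using nn_integral_lborel_translate
        [of "\<lambda>x. indicator (slab j) (x - t *\<^sub>R axis j 1) * h x" "t *\<^sub>R axis j 1", symmetric]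
      by (simp add: add.commute)
  qed
  also have "\<dots> = (\<integral>\<^sup>+x. (\<integral>\<^sup>+t. indicator (slab j) (x - t *\<^sub>R axis j 1) * h x \<partial>lborel) \<partial>lborel)"
    by (rule lborel_pair.Fubini') measurable
  also have "\<dots> = (\<integral>\<^sup>+x. h x \<partial>lborel)"
  proof (rule nn_integral_cong)
    fix x :: "real^'n"
    \<comment> \<open>The slab has width 1: for each \<open>x\<close> the admissible shifts
      \<open>t\<close> form an interval of length 1, so averaging over them returns
      \<open>h x\<close>.\<close>
    have "indicator (slab j) (x - t *\<^sub>R axis j 1) = (indicator {x $ j - 1..x $ j} t :: ennreal)" for t
      by (auto simp: slab_def axis_def indicator_def)
    then show "(\<integral>\<^sup>+t. indicator (slab j) (x - t *\<^sub>R axis j 1) * h x \<partial>lborel) = h x"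
      by (simp add: nn_integral_multc)
  qed
  finally show ?thesis .
qed

text \<open>Cavalieri's principle: the inner integral is that of \<open>h\<close> over the
  hyperplane at height \<open>t\<close>. This order of integration serves when the slices at
  different heights are rescaled differently.\<close>

lemma nn_integral_slices_swap:
  fixes h :: "real^'n \<Rightarrow> ennreal"
  assumes [measurable]: "h \<in> borel_measurable borel"
  shows "(\<integral>\<^sup>+t. (\<integral>\<^sup>+x. indicator (slab j) x * h (x + (t - x $ j) *\<^sub>R axis j 1) \<partial>lborel) \<partial>lborel)
       = (\<integral>\<^sup>+x. h x \<partial>lborel)"
proof -
  have "(\<integral>\<^sup>+t. (\<integral>\<^sup>+x. indicator (slab j) x * h (x + (t - x $ j) *\<^sub>R axis j 1) \<partial>lborel) \<partial>lborel)
    = (\<integral>\<^sup>+x. (\<integral>\<^sup>+t. indicator (slab j) x * h (x + (t - x $ j) *\<^sub>R axis j 1) \<partial>lborel) \<partial>lborel)"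
    by (rule lborel_pair.Fubini') measurable
  then show ?thesis using nn_integral_slices[OF assms, of j] by (simp add: nn_integral_cmult)
qed

section \<open>Change of variables by an invertible matrix\<close>

lemma nn_integral_lborel_diagonal:
  fixes f :: "real^'n \<Rightarrow> ennreal" and c :: "'n \<Rightarrow> real"
  assumes [measurable]: "f \<in> borel_measurable borel" and c: "\<And>i. c i \<noteq> 0"
  shows "(\<integral>\<^sup>+x. f x \<partial>lborel) = ennreal (\<Prod>i\<in>UNIV. \<bar>c i\<bar>) * (\<integral>\<^sup>+x. f (\<chi> i. c i * x $ i) \<partial>lborel)"
proof -
  \<comment> \<open>\<open>lborel_affine_euclidean\<close> indexes the scaling factors by basis
    vectors instead of coordinates; distinct indices have distinct basis vectors, so the description
    is unique.\<close>
  define c' :: "real^'n \<Rightarrow> real" where "c' b = (THE r. \<exists>i. b = axis i 1 \<and> r = c i)" for b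
  have c': "c' (axis i 1) = c i" for i
    unfolding c'_def by (rule the_equality) (auto simp: axis_eq_axis)
  have bas: "(Basis :: (real^'n) set) = range (\<lambda>i. axis i 1)"
    by (auto simp: Basis_vec_def)
  have inj: "inj (\<lambda>i. axis i (1::real) :: real^'n)" by (auto simp: inj_on_def axis_eq_axis)
  have nz: "b \<in> Basis \<Longrightarrow> c' b \<noteq> 0" for b using c by (auto simp: bas c')
  have T: "0 + (\<Sum>j\<in>Basis. (c' j * (x \<bullet> j)) *\<^sub>R j) = (\<chi> i. c i * x $ i)" for x :: "real^'n"
  proof -
    have "0 + (\<Sum>j\<in>Basis. (c' j * (x \<bullet> j)) *\<^sub>R j) = (\<Sum>i\<in>UNIV. (c i * x $ i) *\<^sub>R axis i 1)"
      by (simp add: bas sum.reindex[OF inj] c' inner_axis)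
    then show ?thesis by (simp add: vec_eq_iff axis_def if_distrib cong: if_cong)
  qed
  have P: "(\<Prod>j\<in>(Basis :: (real^'n) set). \<bar>c' j\<bar>) = (\<Prod>i\<in>UNIV. \<bar>c i\<bar>)"
    by (simp add: bas prod.reindex[OF inj] c')
  show ?thesis
    by (subst lborel_affine_euclidean[OF nz, of _ 0])
       (simp_all add: nn_integral_density nn_integral_distr nn_integral_cmult T P del: add_0_left, simp add: T[unfolded add_0_left] P)
qed

text \<open>Lebesgue measure is determined by its values on boxes, and a transposition, being an
  involution, pulls a box back to the box with permuted edges, of the same volume.\<close>

lemma nn_integral_lborel_transpose:
  fixes f :: "real^'n \<Rightarrow> ennreal"
  assumes [measurable]: "f \<in> borel_measurable borel"
  shows "(\<integral>\<^sup>+x. f (\<chi> i. x $ Transposition.transpose m n i) \<partial>lborel) = (\<integral>\<^sup>+x. f x \<partial>lborel)"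
proof -
  let ?\<tau> = "Transposition.transpose m n"
  let ?g = "\<lambda>x::real^'n. \<chi> i. x $ ?\<tau> i"
  have "lborel = distr lborel borel ?g"
  proof (rule lborel_eqI)
    fix l u :: "real^'n" assume le: "\<And>b. b \<in> Basis \<Longrightarrow> l \<bullet> b \<le> u \<bullet> b"
    have lu: "l $ i \<le> u $ i" for i using le[of "axis i 1"] by (simp add: inner_axis)
    have "?g -` box l u = box (?g l) (?g u)"
    proof (intro set_eqI iffI)
      fix x assume "x \<in> ?g -` box l u"
      then have *: "l $ i < x $ ?\<tau> i \<and> x $ ?\<tau> i < u $ i" for i by (simp add: mem_box_cart)
      show "x \<in> box (?g l) (?g u)" using *[of "?\<tau> i" for i] by (simp add: mem_box_cart)
    next
      fix x assume "x \<in> box (?g l) (?g u)"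
      then have *: "l $ ?\<tau> i < x $ i \<and> x $ i < u $ ?\<tau> i" for i by (simp add: mem_box_cart)
      show "x \<in> ?g -` box l u" using *[of "?\<tau> i" for i] by (simp add: mem_box_cart)
    qed
    then have "emeasure (distr lborel borel ?g) (box l u) = emeasure lborel (box (?g l) (?g u))"
      by (simp add: emeasure_distr)
    also have "\<dots> = (\<Prod>b\<in>Basis. (?g u - ?g l) \<bullet> b)"
      by (rule emeasure_lborel_box) (auto simp: Basis_vec_def inner_axis lu)
    also have "(\<Prod>b\<in>Basis. (?g u - ?g l) \<bullet> b) = (\<Prod>i\<in>UNIV. (u - l) $ ?\<tau> i)"
    proof -
      have "(\<Prod>b\<in>Basis. (?g u - ?g l) \<bullet> b) = (\<Prod>b\<in>range (\<lambda>i. axis i (1::real) :: real^'n). (?g u - ?g l) \<bullet> b)"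
        by (rule prod.cong) (auto simp: Basis_vec_def)
      also have "\<dots> = (\<Prod>i\<in>UNIV. (u - l) $ ?\<tau> i)"
        by (subst prod.reindex) (auto simp: inj_on_def axis_eq_axis inner_axis)
      finally show ?thesis .
    qed
    also have "(\<Prod>i\<in>UNIV. (u - l) $ ?\<tau> i) = (\<Prod>i\<in>UNIV. (u - l) $ i)"
      by (rule prod.reindex_bij_betw) simp
    also have "(\<Prod>i\<in>UNIV. (u - l) $ i) = (\<Prod>b\<in>Basis. (u - l) \<bullet> b)"
    proof -
      have "(\<Prod>b\<in>Basis. (u - l) \<bullet> b) = (\<Prod>b\<in>range (\<lambda>i. axis i (1::real) :: real^'n). (u - l) \<bullet> b)"
        by (rule prod.cong) (auto simp: Basis_vec_def)
      also have "\<dots> = (\<Prod>i\<in>UNIV. (u - l) $ i)"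
        by (subst prod.reindex) (auto simp: inj_on_def axis_eq_axis inner_axis)
      finally show ?thesis ..
    qed
    finally show "emeasure (distr lborel borel ?g) (box l u) = (\<Prod>b\<in>Basis. (u - l) \<bullet> b)" .
  qed simp
  then have "(\<integral>\<^sup>+x. f x \<partial>lborel) = (\<integral>\<^sup>+x. f x \<partial>distr lborel borel ?g)" by simp
  also have "\<dots> = (\<integral>\<^sup>+x. f (?g x) \<partial>lborel)" by (subst nn_integral_distr) auto
  finally show ?thesis ..
qed

text \<open>On each line parallel to \<open>axis m 1\<close> the shear is a translation by
  \<open>x $ n\<close>, which is constant along the line because \<open>m \<noteq> n\<close>.
  Slicing in direction \<open>m\<close> reduces the claim to translation invariance on the real
  line.\<close>

lemma nn_integral_lborel_shear:
  fixes f :: "real^'n \<Rightarrow> ennreal"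
  assumes [measurable]: "f \<in> borel_measurable borel" and "m \<noteq> n"
  shows "(\<integral>\<^sup>+x. f (x + (x $ n) *\<^sub>R axis m 1) \<partial>lborel) = (\<integral>\<^sup>+x. f x \<partial>lborel)"
proof -
  have "(\<integral>\<^sup>+t. f (x + (t - x $ m) *\<^sub>R axis m 1 + ((x + (t - x $ m) *\<^sub>R axis m 1) $ n) *\<^sub>R axis m 1) \<partial>lborel)
      = (\<integral>\<^sup>+t. f (x + (t - x $ m) *\<^sub>R axis m 1) \<partial>lborel)" for x :: "real^'n"
    using nn_integral_lborel_translate[of "\<lambda>t. f (x + (t - x $ m) *\<^sub>R axis m 1)" "x $ n"] \<open>m \<noteq> n\<close>
    by (simp add: axis_def algebra_simps)
  then show ?thesis
    using nn_integral_slices[of "\<lambda>x. f (x + (x $ n) *\<^sub>R axis m 1)" m] nn_integral_slices[of f m] by simp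
qed

text \<open>Induction over elementary matrices: both sides are multiplicative in \<open>A\<close>, a
  zero row contradicts the nonzero determinant, and diagonal matrices, transpositions and shears are
  the cases treated above.\<close>

proposition nn_integral_lborel_matrix:
  fixes A :: "real^'n^'n" and f :: "real^'n \<Rightarrow> ennreal"
  assumes "f \<in> borel_measurable borel" and "det A \<noteq> 0"
  shows "(\<integral>\<^sup>+x. f x \<partial>lborel) = ennreal \<bar>det A\<bar> * (\<integral>\<^sup>+x. f (A *v x) \<partial>lborel)"
proof -
  \<comment> \<open>The integrand is quantified inside the induction predicate, since a product
    \<open>A ** B\<close> requires the claim for \<open>B\<close> at \<open>f\<close> composed with
    \<open>A\<close>.\<close>
  let ?P = "\<lambda>A :: real^'n^'n. det A \<noteq> 0 \<longrightarrow> (\<forall>f\<in>borel_measurable borel.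
    (\<integral>\<^sup>+x. f x \<partial>lborel) = ennreal \<bar>det A\<bar> * (\<integral>\<^sup>+x. f (A *v x) \<partial>lborel))"
  have "?P A"
  proof (rule induct_matrix_elementary_alt, goal_cases)
    case (1 A B)
    show ?case
    proof (intro impI ballI)
      fix f :: "real^'n \<Rightarrow> ennreal" assume f[measurable]: "f \<in> borel_measurable borel" and "det (A ** B) \<noteq> 0"
      then have nz: "det A \<noteq> 0" "det B \<noteq> 0" by (auto simp: det_mul)
      have [measurable]: "(*v) A \<in> borel_measurable borel"
        by (intro borel_measurable_continuous_onI continuous_intros)
      have "(\<integral>\<^sup>+x. f x \<partial>lborel) = ennreal \<bar>det A\<bar> * (\<integral>\<^sup>+x. f (A *v x) \<partial>lborel)"
        by (rule 1(1)[rule_format, OF nz(1) f])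
      also have "(\<integral>\<^sup>+x. f (A *v x) \<partial>lborel) = ennreal \<bar>det B\<bar> * (\<integral>\<^sup>+x. f (A *v (B *v x)) \<partial>lborel)"
        by (rule 1(2)[rule_format, OF nz(2)]) measurable
      finally show "(\<integral>\<^sup>+x. f x \<partial>lborel) = ennreal \<bar>det (A ** B)\<bar> * (\<integral>\<^sup>+x. f ((A ** B) *v x) \<partial>lborel)"
        by (simp add: det_mul abs_mult ennreal_mult matrix_vector_mul_assoc mult.assoc)
    qed
  next
    case (2 A i)
    then show ?case by (simp add: det_zero_row)
  next
    case (3 A)
    have d: "det A = (\<Prod>i\<in>UNIV. A $ i $ i)" using 3 by (rule det_diagonal)
    have mv: "A *v x = (\<chi> i. A $ i $ i * x $ i)" for x
    proof -
      have "(\<Sum>j\<in>UNIV. A $ i $ j * x $ j) = (\<Sum>j\<in>UNIV. if j = i then A $ i $ j * x $ j else 0)" for i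
        using 3 by (intro sum.cong) auto
      then show ?thesis by (simp add: matrix_vector_mult_def vec_eq_iff)
    qed
    show ?case
      unfolding d mv abs_prod
      by (intro impI ballI nn_integral_lborel_diagonal) auto
  next
    case (4 m n)
    let ?A = "(\<chi> i j. mat 1 $ i $ Transposition.transpose m n j) :: real^'n^'n"
    have mv: "?A *v x = (\<chi> i. x $ Transposition.transpose m n i)" for x
    proof -
      have "(\<Sum>j\<in>UNIV. mat 1 $ i $ Transposition.transpose m n j * x $ j) = x $ Transposition.transpose m n i" for i
      proof -
        have "(\<Sum>j\<in>UNIV. mat 1 $ i $ Transposition.transpose m n j * x $ j)
            = (\<Sum>j\<in>UNIV. if j = Transposition.transpose m n i then x $ j else 0)"
          by (rule sum.cong) (auto simp: mat_def)
        then show ?thesis by simp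
      qed
      then show ?thesis by (simp add: matrix_vector_mult_def vec_eq_iff)
    qed
    \<comment> \<open>The matrix is its own inverse, so its determinant is 1 or -1, and only the
      absolute value matters.\<close>
    have "?A ** ?A = mat 1"
      unfolding matrix_eq matrix_vector_mul_assoc[symmetric] mv by (simp add: vec_eq_iff)
    then have "det ?A * det ?A = 1" by (metis det_I det_mul)
    then have "\<bar>det ?A\<bar> = 1" by (auto simp: square_eq_1_iff)
    then show ?case unfolding mv by (simp add: nn_integral_lborel_transpose)
  next
    case (5 m n)
    let ?A = "(\<chi> i j. of_bool (i = m \<and> j = n \<or> i = j)) :: real^'n^'n"
    have mv: "?A *v x = x + (x $ n) *\<^sub>R axis m 1" for x
    proof -
      have "(\<Sum>j\<in>UNIV. of_bool (i = m \<and> j = n \<or> i = j) * x $ j) = x $ i + (if i = m then x $ n else 0)" for i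
      proof -
        have "(\<Sum>j\<in>UNIV. of_bool (i = m \<and> j = n \<or> i = j) * x $ j)
            = (\<Sum>j\<in>UNIV. (if j = i then x $ j else 0) + (if i = m then (if j = n then x $ j else 0) else 0))"
          using 5 by (intro sum.cong) auto
        then show ?thesis by (auto simp: sum.distrib)
      qed
      then show ?thesis by (simp add: matrix_vector_mult_def vec_eq_iff axis_def)
    qed
    have "?A = (\<chi> k. if k = m then row m (mat 1) + 1 *s row n (mat 1) else row k (mat 1))"
      using 5 by (auto simp: vec_eq_iff row_def mat_def)
    then have "det ?A = 1" using det_row_operation[OF 5, of "mat 1 :: real^'n^'n" 1] by simp
    then show ?case unfolding mv by (simp add: nn_integral_lborel_shear[OF _ 5])
  qed
  with assms show ?thesis by blast
qed

text \<open>The simplex is the image of the standard simplex, of volume 1 / d!, under the affine map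
  \<open>x0 + M *v x\<close> whose columns are the edges at \<open>x0\<close>.\<close>

lemma measure_simplex:
  fixes X :: "real^'n^'n" and x0 :: "real^'n"
  shows "measure lborel (convex hull (insert x0 (range (($) X)))) = \<bar>det (\<chi> i. X $ i - x0)\<bar> / fact CARD('n)"
proof -
  define M where "M = Finite_Cartesian_Product.transpose (\<chi> i. X $ i - x0)"
  let ?std = "convex hull (insert 0 Basis) :: (real^'n) set"
  let ?S = "convex hull (insert x0 (range (($) X)))"
  have im: "insert x0 (range (($) X)) = (\<lambda>x. x0 + M *v x) ` insert 0 Basis"
  proof -
    have ax: "x0 + M *v axis i 1 = X $ i" for i
      by (simp add: M_def matrix_vector_mult_basis column_def Finite_Cartesian_Product.transpose_def vec_eq_iff)
    have bas: "(Basis :: (real^'n) set) = range (\<lambda>i. axis i 1)" by (auto simp: Basis_vec_def)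
    show ?thesis unfolding bas image_insert image_image ax by simp
  qed
  have lin: "linear ((*v) M)" by (rule matrix_vector_mul_linear)
  have S: "?S = (\<lambda>x. x0 + M *v x) ` ?std"
  proof -
    have "(\<lambda>x. x0 + M *v x) ` insert 0 Basis = (+) x0 ` ((*v) M ` insert 0 Basis)" by (simp add: image_image)
    then have "?S = (+) x0 ` ((*v) M ` ?std)"
      unfolding im by (simp only: convex_hull_translation convex_hull_linear_image[OF lin])
    then show ?thesis by (simp only: image_image)
  qed
  have "compact ?S" by (intro finite_imp_compact_convex_hull) simp
  then have Sb[measurable]: "?S \<in> sets borel" by (intro borel_closed compact_imp_closed)
  have "compact ?std" by (intro finite_imp_compact_convex_hull) simp
  then have stdb[measurable]: "?std \<in> sets borel" by (intro borel_closed compact_imp_closed)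
  have dM: "det M = det (\<chi> i. X $ i - x0)" by (simp add: M_def det_transpose)
  show ?thesis
  proof (cases "det M = 0")
    case False
    then have inj: "inj ((*v) M)" using det_nz_iff_inj[OF lin] by simp
    have mem: "x0 + M *v x \<in> ?S \<longleftrightarrow> x \<in> ?std" for x
      unfolding S by (auto dest: injD[OF inj])
    have "emeasure lborel ?S = (\<integral>\<^sup>+x. indicator ?S (x0 + x) \<partial>lborel)"
      by (subst nn_integral_lborel_translate) auto
    also have "\<dots> = ennreal \<bar>det M\<bar> * (\<integral>\<^sup>+x. indicator ?S (x0 + M *v x) \<partial>lborel)"
      using False by (intro nn_integral_lborel_matrix) auto
    also have "(\<integral>\<^sup>+x. indicator ?S (x0 + M *v x) \<partial>lborel) = (\<integral>\<^sup>+x. indicator ?std x \<partial>lborel)"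
      by (intro nn_integral_cong) (simp only: indicator_def mem)
    also have "\<dots> = emeasure lborel ?std" using stdb by simp
    finally show ?thesis
      by (simp add: measure_def enn2real_mult dM emeasure_std_simplex)
  next
    \<comment> \<open>Here the change of variables does not apply; instead the simplex lies in a
      translate of the range of a singular map and is negligible.\<close>
    case True
    then have "\<not> inj ((*v) M)" using det_nz_iff_inj[OF lin] by simp
    then have "negligible ((*v) M ` ?std)"
      using lin by (intro negligible_linear_singular_image)
    then have "negligible ?S"
      using negligible_translation[of "(*v) M ` ?std" x0] unfolding S by (simp add: image_image)
    then have "measure lebesgue ?S = 0" by (rule negligible_imp_measure0)
    then show ?thesis using True Sb by (simp add: dM)
  qed
qed

text \<open>
  \<open>dt / \<bar>t\<bar>\<close> is a Haar measure on the multiplicative group of nonzero reals, hence invariant under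
  inversion: average over \<open>s\<close> in [1, 2] and substitute \<open>s = t s'\<close> in both orders of integration.
\<close>

lemma nn_integral_lborel_inverse:
  fixes H :: "real \<Rightarrow> ennreal"
  assumes [measurable]: "H \<in> borel_measurable borel"
  shows "(\<integral>\<^sup>+t. ennreal (1 / t\<^sup>2) * H (1 / t) \<partial>lborel) = (\<integral>\<^sup>+t. H t \<partial>lborel)"
proof -
  define w :: "real \<Rightarrow> ennreal" where "w t = ennreal (1 / \<bar>t\<bar>)" for t
  have [measurable]: "w \<in> borel_measurable borel" unfolding w_def by measurable
  \<comment> \<open>The factor \<bar>t\<bar> cancels the density \<open>w\<close>, so that \<psi>
    has total mass 1 against \<open>w\<close> and can be inserted as a factor 1.\<close>
  define \<psi> :: "real \<Rightarrow> ennreal" where "\<psi> t = ennreal \<bar>t\<bar> * indicator {1..2} t" for t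
  have [measurable]: "\<psi> \<in> borel_measurable borel" unfolding \<psi>_def by measurable
  have AE0: "AE t in lborel. t \<noteq> (0::real)" by (rule AE_lborel_singleton)
  have scale: "(\<integral>\<^sup>+s. w s * g s \<partial>lborel) = (\<integral>\<^sup>+s. w s * g (c * s) \<partial>lborel)"
    if "c \<noteq> 0" and [measurable]: "g \<in> borel_measurable borel" for c and g :: "real \<Rightarrow> ennreal"
  proof -
    have "(\<integral>\<^sup>+s. w s * g s \<partial>lborel) = ennreal \<bar>c\<bar> * (\<integral>\<^sup>+s. w (c * s) * g (c * s) \<partial>lborel)"
      using nn_integral_real_affine[of "\<lambda>s. w s * g s" c 0] that(1) by simp
    also have "\<dots> = (\<integral>\<^sup>+s. (ennreal \<bar>c\<bar> * w (c * s)) * g (c * s) \<partial>lborel)"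
      by (subst nn_integral_cmult[symmetric]) (auto simp: mult.assoc)
    also have "(\<lambda>s. ennreal \<bar>c\<bar> * w (c * s)) = w"
      using that(1) by (auto simp: w_def fun_eq_iff ennreal_mult[symmetric] abs_mult)
    finally show ?thesis .
  qed
  have psi: "(\<integral>\<^sup>+s. w s * \<psi> s \<partial>lborel) = 1"
  proof -
    have "w s * \<psi> s = indicator {1..2} s" for s
      by (auto simp: w_def \<psi>_def indicator_def ennreal_mult[symmetric])
    then show ?thesis by simp
  qed
  \<comment> \<open>In terms of \<open>G\<close> both sides become integrals against
    \<open>w\<close>: for nonzero \<open>t\<close>,
    \<open>1 / t\<^sup>2 * H (1 / t) = w t * G (1 / t)\<close> and
    \<open>H t = w t * G t\<close>.\<close>
  define G where "G t = ennreal \<bar>t\<bar> * H t" for t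
  have [measurable]: "G \<in> borel_measurable borel" unfolding G_def by measurable
  have "(\<integral>\<^sup>+t. ennreal (1 / t\<^sup>2) * H (1 / t) \<partial>lborel) = (\<integral>\<^sup>+t. w t * G (1 / t) \<partial>lborel)"
    using AE0 by (intro nn_integral_cong_AE, eventually_elim)
      (simp add: w_def G_def power2_eq_square ennreal_mult[symmetric] mult.assoc[symmetric] abs_mult[symmetric])
  also have "\<dots> = (\<integral>\<^sup>+t. w t * G (1 / t) * (\<integral>\<^sup>+s. w s * \<psi> s \<partial>lborel) \<partial>lborel)"
    by (simp add: psi)
  also have "\<dots> = (\<integral>\<^sup>+t. w t * G (1 / t) * (\<integral>\<^sup>+s. w s * \<psi> (t * s) \<partial>lborel) \<partial>lborel)"
    using AE0 by (intro nn_integral_cong_AE, eventually_elim) (simp add: scale[of _ \<psi>])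
  also have "\<dots> = (\<integral>\<^sup>+t. (\<integral>\<^sup>+s. w t * G (1 / t) * (w s * \<psi> (t * s)) \<partial>lborel) \<partial>lborel)"
    by (intro nn_integral_cong nn_integral_cmult[symmetric]) measurable
  also have "\<dots> = (\<integral>\<^sup>+s. (\<integral>\<^sup>+t. w t * G (1 / t) * (w s * \<psi> (t * s)) \<partial>lborel) \<partial>lborel)"
    by (rule lborel_pair.Fubini') measurable
  also have "\<dots> = (\<integral>\<^sup>+s. (\<integral>\<^sup>+t. w s * (w t * (G (s / t) * \<psi> t)) \<partial>lborel) \<partial>lborel)"
  proof (rule nn_integral_cong_AE, use AE0 in eventually_elim)
    fix s :: real assume "s \<noteq> 0"
    have "(\<integral>\<^sup>+t. w t * G (1 / t) * (w s * \<psi> (t * s)) \<partial>lborel) = w s * (\<integral>\<^sup>+t. w t * (G (s / (s * t)) * \<psi> (s * t)) \<partial>lborel)"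
      using \<open>s \<noteq> 0\<close> by (subst nn_integral_cmult[symmetric]) (auto simp: ac_simps)
    also have "\<dots> = w s * (\<integral>\<^sup>+t. w t * (G (s / t) * \<psi> t) \<partial>lborel)"
      using \<open>s \<noteq> 0\<close> by (subst scale[of s "\<lambda>t. G (s / t) * \<psi> t"]) auto
    finally show "(\<integral>\<^sup>+t. w t * G (1 / t) * (w s * \<psi> (t * s)) \<partial>lborel) = (\<integral>\<^sup>+t. w s * (w t * (G (s / t) * \<psi> t)) \<partial>lborel)"
      by (simp add: nn_integral_cmult)
  qed
  also have "\<dots> = (\<integral>\<^sup>+t. (\<integral>\<^sup>+s. w s * (w t * (G (s / t) * \<psi> t)) \<partial>lborel) \<partial>lborel)"
    by (rule lborel_pair.Fubini') measurable
  also have "\<dots> = (\<integral>\<^sup>+t. w t * \<psi> t * (\<integral>\<^sup>+s. w s * G s \<partial>lborel) \<partial>lborel)"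
  proof (rule nn_integral_cong_AE, use AE0 in eventually_elim)
    fix t :: real assume "t \<noteq> 0"
    have "(\<integral>\<^sup>+s. w s * (w t * (G (s / t) * \<psi> t)) \<partial>lborel) = w t * \<psi> t * (\<integral>\<^sup>+s. w s * G (1 / t * s) \<partial>lborel)"
      by (subst nn_integral_cmult[symmetric]) (auto simp: ac_simps)
    also have "(\<integral>\<^sup>+s. w s * G (1 / t * s) \<partial>lborel) = (\<integral>\<^sup>+s. w s * G s \<partial>lborel)"
      using \<open>t \<noteq> 0\<close> by (intro scale[symmetric]) auto
    finally show "(\<integral>\<^sup>+s. w s * (w t * (G (s / t) * \<psi> t)) \<partial>lborel) = w t * \<psi> t * (\<integral>\<^sup>+s. w s * G s \<partial>lborel)" .
  qed
  also have "\<dots> = (\<integral>\<^sup>+s. w s * G s \<partial>lborel)"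
    by (simp add: nn_integral_multc psi)
  also have "\<dots> = (\<integral>\<^sup>+s. H s \<partial>lborel)"
    using AE0 by (intro nn_integral_cong_AE, eventually_elim)
      (simp add: w_def G_def ennreal_mult[symmetric] mult.assoc[symmetric])
  finally show ?thesis .
qed

text \<open>The vector \<open>x - x $ j *\<^sub>R axis j 1\<close> ranges over a space of dimension
  d - 1, hence the exponent. Scaling every coordinate except the \<open>j\<close>-th leaves the slab
  as it is.\<close>

lemma nn_integral_slab_scale:
  fixes h :: "real^'n \<Rightarrow> ennreal"
  assumes [measurable]: "h \<in> borel_measurable borel" and "s \<noteq> 0"
  shows "(\<integral>\<^sup>+x. indicator (slab j) x * h (x - x $ j *\<^sub>R axis j 1) \<partial>lborel)
    = ennreal (\<bar>s\<bar> ^ (CARD('n) - 1)) * (\<integral>\<^sup>+x. indicator (slab j) x * h (s *\<^sub>R (x - x $ j *\<^sub>R axis j 1)) \<partial>lborel)"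
proof -
  let ?c = "\<lambda>i. if i = j then 1 else s"
  have eq: "(\<chi> i. ?c i * x $ i) - (\<chi> i. ?c i * x $ i) $ j *\<^sub>R axis j 1 = s *\<^sub>R (x - x $ j *\<^sub>R axis j 1)" for x :: "real^'n"
    by (simp add: vec_eq_iff axis_def)
  have sl: "indicator (slab j) (\<chi> i. ?c i * x $ i) = (indicator (slab j) x :: ennreal)" for x :: "real^'n"
    by (simp add: slab_def indicator_def)
  have "(\<Prod>i\<in>UNIV. \<bar>?c i\<bar>) = (\<Prod>i\<in>UNIV - {j}. \<bar>s\<bar>)"
    by (subst prod.remove[of _ j]) auto
  also have "\<dots> = \<bar>s\<bar> ^ (CARD('n) - 1)" by (simp add: card_Diff_singleton)
  finally have P: "(\<Prod>i\<in>UNIV. \<bar>?c i\<bar>) = \<bar>s\<bar> ^ (CARD('n) - 1)" .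
  show ?thesis
    using nn_integral_lborel_diagonal[of "\<lambda>x. indicator (slab j) x * h (x - x $ j *\<^sub>R axis j 1)" ?c] \<open>s \<noteq> 0\<close>
    unfolding eq sl P by simp
qed

text \<open>The image of \<eta> has \<open>j\<close>-th coordinate 1 / \<eta> $ j and other
  coordinates - \<eta> $ l / \<eta> $ j. On the slice \<eta> $ j = t this is a scaling in d - 1
  coordinates, with factor 1 / \<bar>t\<bar>^(d - 1), and the inversion of \<open>t\<close>
  contributes 1 / t^2; together they make the exponent d + 1.\<close>

lemma nn_integral_lborel_projective:
  fixes h :: "real^'n \<Rightarrow> ennreal"
  assumes [measurable]: "h \<in> borel_measurable borel"
  shows "(\<integral>\<^sup>+\<eta>. ennreal (1 / \<bar>\<eta> $ j\<bar> ^ (CARD('n) + 1)) * h ((1 / \<eta> $ j) *\<^sub>R ((1 + \<eta> $ j) *\<^sub>R axis j 1 - \<eta>)) \<partial>lborel)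
    = (\<integral>\<^sup>+a. h a \<partial>lborel)"
proof -
  let ?e = "axis j 1 :: real^'n"
  have *: "0 < CARD('n)" by simp
  define H where "H t = (\<integral>\<^sup>+x. indicator (slab j) x * h (x + (t - x $ j) *\<^sub>R ?e) \<partial>lborel)" for t
  have [measurable]: "H \<in> borel_measurable borel" unfolding H_def by measurable
  let ?f = "\<lambda>\<eta>::real^'n. ennreal (1 / \<bar>\<eta> $ j\<bar> ^ (CARD('n) + 1)) * h ((1 / \<eta> $ j) *\<^sub>R ((1 + \<eta> $ j) *\<^sub>R ?e - \<eta>))"
  have "(\<integral>\<^sup>+\<eta>. ?f \<eta> \<partial>lborel) = (\<integral>\<^sup>+t. (\<integral>\<^sup>+x. indicator (slab j) x * ?f (x + (t - x $ j) *\<^sub>R ?e) \<partial>lborel) \<partial>lborel)"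
    by (rule nn_integral_slices_swap[symmetric]) measurable
  also have "\<dots> = (\<integral>\<^sup>+t. ennreal (1 / t\<^sup>2) * H (1 / t) \<partial>lborel)"
  proof (rule nn_integral_cong_AE, use AE_lborel_singleton[of "0::real"] in eventually_elim)
    fix t :: real assume "t \<noteq> 0"
    have j: "(x + (t - x $ j) *\<^sub>R ?e) $ j = t" for x :: "real^'n" by (simp add: axis_def)
    have arg: "(1 / t) *\<^sub>R ((1 + t) *\<^sub>R ?e - (x + (t - x $ j) *\<^sub>R ?e))
       = (- 1 / t) *\<^sub>R (x - x $ j *\<^sub>R ?e) + (1 / t) *\<^sub>R ?e" for x :: "real^'n"
      by (simp add: algebra_simps)
    have "(\<integral>\<^sup>+x. indicator (slab j) x * ?f (x + (t - x $ j) *\<^sub>R ?e) \<partial>lborel)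
      = ennreal (1 / \<bar>t\<bar> ^ (CARD('n) + 1)) *
        (\<integral>\<^sup>+x. indicator (slab j) x * h ((- 1 / t) *\<^sub>R (x - x $ j *\<^sub>R ?e) + (1 / t) *\<^sub>R ?e) \<partial>lborel)"
      unfolding j arg by (subst nn_integral_cmult[symmetric]) (auto simp: ac_simps)
    also have "1 / \<bar>t\<bar> ^ (CARD('n) + 1) = 1 / t\<^sup>2 * \<bar>- 1 / t\<bar> ^ (CARD('n) - 1)"
    proof -
      have "CARD('n) + 1 = 2 + (CARD('n) - 1)" using * by linarith
      then show ?thesis by (simp only: power_add) (simp add: power_one_over divide_inverse power_inverse)
    qed
    also have "ennreal \<dots> * (\<integral>\<^sup>+x. indicator (slab j) x * h ((- 1 / t) *\<^sub>R (x - x $ j *\<^sub>R ?e) + (1 / t) *\<^sub>R ?e) \<partial>lborel)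
       = ennreal (1 / t\<^sup>2) * (ennreal (\<bar>- 1 / t\<bar> ^ (CARD('n) - 1)) *
       (\<integral>\<^sup>+x. indicator (slab j) x * h ((- 1 / t) *\<^sub>R (x - x $ j *\<^sub>R ?e) + (1 / t) *\<^sub>R ?e) \<partial>lborel))"
      by (subst ennreal_mult) (auto simp: mult.assoc)
    also have "ennreal (\<bar>- 1 / t\<bar> ^ (CARD('n) - 1)) *
       (\<integral>\<^sup>+x. indicator (slab j) x * h ((- 1 / t) *\<^sub>R (x - x $ j *\<^sub>R ?e) + (1 / t) *\<^sub>R ?e) \<partial>lborel)
       = (\<integral>\<^sup>+x. indicator (slab j) x * h (x - x $ j *\<^sub>R ?e + (1 / t) *\<^sub>R ?e) \<partial>lborel)"
      using \<open>t \<noteq> 0\<close> by (intro nn_integral_slab_scale[of "\<lambda>x. h (x + (1 / t) *\<^sub>R ?e)", symmetric]) auto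
    also have "\<dots> = H (1 / t)"
      unfolding H_def by (simp add: algebra_simps)
    finally show "(\<integral>\<^sup>+x. indicator (slab j) x * ?f (x + (t - x $ j) *\<^sub>R ?e) \<partial>lborel) = ennreal (1 / t\<^sup>2) * H (1 / t)" .
  qed
  also have "\<dots> = (\<integral>\<^sup>+t. H t \<partial>lborel)" by (rule nn_integral_lborel_inverse) measurable
  also have "\<dots> = (\<integral>\<^sup>+a. h a \<partial>lborel)" unfolding H_def by (rule nn_integral_slices_swap) measurable
  finally show ?thesis .
qed

section \<open>Points spanning a hyperplane\<close>

text \<open>Oblique projection onto \<open>hyperplane \<eta>\<close> parallel to
  \<open>axis j 1\<close>; for \<eta> $ j = 0 division by zero turns it into the identity.\<close>

definition proj_along :: "'n \<Rightarrow> real^'n \<Rightarrow> real^'n \<Rightarrow> real^'n" where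
  "proj_along j \<eta> x = x + ((1 - \<eta> \<bullet> x) / \<eta> $ j) *\<^sub>R axis j 1"

text \<open>Up to sign, (d - 1)! times the (d - 1)-dimensional volume of the simplex spanned by the
  rows of \<open>X\<close> after the \<open>j\<close>-th coordinate has been dropped.\<close>

definition base_det :: "'n \<Rightarrow> real^'n^'n \<Rightarrow> real" where
  "base_det j X = det (\<chi> i l. if l = j then 1 else X $ i $ l)"

lemma proj_along_measurable [measurable (raw)]:
  assumes [measurable]: "f \<in> borel_measurable M" "g \<in> borel_measurable M"
  shows "(\<lambda>x. proj_along j (f x) (g x)) \<in> borel_measurable M"
  unfolding proj_along_def by measurable

lemma base_det_measurable [measurable (raw)]:
  assumes [measurable]: "f \<in> borel_measurable M"
  shows "(\<lambda>x. base_det j (f x)) \<in> borel_measurable M"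
  unfolding base_det_def
proof (rule borel_measurable_det)
  fix i l
  show "(\<lambda>x. (\<chi> i l. if l = j then 1 else f x $ i $ l) $ i $ l) \<in> borel_measurable M"
    by (cases "l = j") simp_all
qed

text \<open>On each line \<open>mat 1 + s *\<^sub>R X\<close> the determinant is a polynomial in
  \<open>s\<close> with value 1 at \<open>s = 0\<close>, so it has finitely many zeros; Fubini
  carries this over to the whole matrix space.\<close>

lemma AE_base_det_nonzero:
  fixes j :: "'n::finite"
  shows "AE X in lborel. base_det j X \<noteq> 0"
proof -
  let ?N = "{X :: real^'n^'n. base_det j X = 0}"
  let ?d = "DIM(real^'n^'n)"
  have N[measurable]: "?N \<in> sets borel" by measurable
  have null: "AE s in lborel. mat 1 + s *\<^sub>R X \<notin> ?N" for X :: "real^'n^'n"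
  proof -
    define P where "P = (\<chi> i l. if l = j then 1 else [:(mat 1 :: real^'n^'n) $ i $ l, X $ i $ l:])"
    have P: "poly (det P) s = base_det j (mat 1 + s *\<^sub>R X)" for s
    proof -
      have sgn: "poly (of_int z) s = of_int z" for z :: int by (simp add: of_int_poly)
      show ?thesis
        unfolding base_det_def det_def poly_sum poly_mult poly_prod sgn P_def
        by (intro sum.cong prod.cong arg_cong2[where f="(*)"]) auto
    qed
    \<comment> \<open>Replacing column \<open>j\<close> of the identity matrix by the all-ones
      vector is Cramer's rule for the right side \<open>vec 1\<close>.\<close>
    have "base_det j (mat 1) = 1"
      using cramer_lemma[of j "mat 1 :: real^'n^'n" "vec 1"]
      unfolding base_det_def matrix_vector_mul_lid vec_component det_I by simp
    then have "poly (det P) 0 = 1" by (simp add: P)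
    then have "det P \<noteq> 0" by auto
    then have "finite {s. poly (det P) s = 0}" by (rule poly_roots_finite)
    then have "{s. poly (det P) s = 0} \<in> null_sets lborel" by (rule finite_imp_null_set_lborel)
    then have "AE s in lborel. s \<notin> {s. poly (det P) s = 0}" by (rule AE_not_in)
    then show ?thesis by (simp add: P)
  qed
  \<comment> \<open>For every nonzero \<open>s\<close> the map
    \<open>X \<mapsto> mat 1 + s *\<^sub>R X\<close> scales volume by \<bar>s\<bar>^DIM. Averaging
    over \<open>s\<close> in an interval of length 1 writes the measure of \<open>?N\<close> as an
    integral along lines through \<open>mat 1\<close>.\<close>
  have "emeasure lborel ?N = (\<integral>\<^sup>+s. indicator {1..2::real} s * emeasure lborel ?N \<partial>lborel)"
    by (simp add: nn_integral_multc)
  also have "\<dots> = (\<integral>\<^sup>+s. (\<integral>\<^sup>+X. indicator {1..2::real} s * ennreal (\<bar>s\<bar> ^ ?d) * indicator ?N (mat 1 + s *\<^sub>R X) \<partial>lborel) \<partial>lborel)"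
  proof (rule nn_integral_cong_AE, use AE_lborel_singleton[of "0::real"] in eventually_elim)
    fix s :: real assume "s \<noteq> 0"
    have "emeasure lborel ?N = (\<integral>\<^sup>+X. indicator ?N X \<partial>lborel)" by simp
    also have "\<dots> = ennreal (\<bar>s\<bar> ^ ?d) * (\<integral>\<^sup>+X. indicator ?N (mat 1 + s *\<^sub>R X) \<partial>lborel)"
      by (subst lborel_affine[OF \<open>s \<noteq> 0\<close>, of "mat 1"])
        (simp add: nn_integral_density nn_integral_distr nn_integral_cmult del: nn_integral_indicator)
    finally have "emeasure lborel ?N = ennreal (\<bar>s\<bar> ^ ?d) * (\<integral>\<^sup>+X. indicator ?N (mat 1 + s *\<^sub>R X) \<partial>lborel)" .
    then show "indicator {1..2::real} s * emeasure lborel ?N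
       = (\<integral>\<^sup>+X. indicator {1..2::real} s * ennreal (\<bar>s\<bar> ^ ?d) * indicator ?N (mat 1 + s *\<^sub>R X) \<partial>lborel)"
      by (subst nn_integral_cmult) (auto simp: mult.assoc)
  qed
  also have "\<dots> = (\<integral>\<^sup>+X. (\<integral>\<^sup>+s. indicator {1..2::real} s * ennreal (\<bar>s\<bar> ^ ?d) * indicator ?N (mat 1 + s *\<^sub>R X) \<partial>lborel) \<partial>lborel)"
    by (rule lborel_pair.Fubini') measurable
  also have "\<dots> = (\<integral>\<^sup>+X. 0 \<partial>(lborel :: (real^'n^'n) measure))"
  proof (rule nn_integral_cong)
    fix X :: "real^'n^'n"
    have "(\<integral>\<^sup>+s. indicator {1..2::real} s * ennreal (\<bar>s\<bar> ^ ?d) * indicator ?N (mat 1 + s *\<^sub>R X) \<partial>lborel)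
      = (\<integral>\<^sup>+s. 0 \<partial>(lborel :: real measure))"
      by (rule nn_integral_cong_AE, use null[of X] in eventually_elim) simp
    then show "(\<integral>\<^sup>+s. indicator {1..2::real} s * ennreal (\<bar>s\<bar> ^ ?d) * indicator ?N (mat 1 + s *\<^sub>R X) \<partial>lborel) = 0"
      by simp
  qed
  finally have "?N \<in> null_sets lborel" by (simp add: null_sets_def)
  then show ?thesis using AE_not_in by fastforce
qed

text \<open>The slicing identity for all rows at once, each with its own height: for a given
  \<open>X\<close> the shifts \<open>z\<close> that move all rows into the slab fill a cube of
  volume 1.\<close>

lemma nn_integral_slices_rows:
  fixes f :: "real^'n^'n \<Rightarrow> ennreal"
  assumes [measurable]: "f \<in> borel_measurable borel"
  shows "(\<integral>\<^sup>+X. indicator {X. \<forall>i. X $ i \<in> slab j} X * (\<integral>\<^sup>+z. f (X + (\<chi> i. z $ i *\<^sub>R axis j 1)) \<partial>(lborel :: (real^'n) measure)) \<partial>lborel)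
    = (\<integral>\<^sup>+X. f X \<partial>lborel)"
proof -
  let ?S = "{X :: real^'n^'n. \<forall>i. X $ i \<in> slab j}"
  let ?E = "\<lambda>z :: real^'n. \<chi> i. z $ i *\<^sub>R axis j (1::real) :: real^'n^'n"
  have [measurable]: "?S \<in> sets borel" by measurable
  have "(\<integral>\<^sup>+X. indicator ?S X * (\<integral>\<^sup>+z. f (X + ?E z) \<partial>lborel) \<partial>lborel)
    = (\<integral>\<^sup>+X. (\<integral>\<^sup>+z. indicator ?S X * f (X + ?E z) \<partial>lborel) \<partial>lborel)"
    by (simp add: nn_integral_cmult)
  also have "\<dots> = (\<integral>\<^sup>+z. (\<integral>\<^sup>+X. indicator ?S X * f (X + ?E z) \<partial>lborel) \<partial>lborel)"
    by (rule lborel_pair.Fubini') measurable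
  also have "\<dots> = (\<integral>\<^sup>+z. (\<integral>\<^sup>+X. indicator ?S (X - ?E z) * f X \<partial>lborel) \<partial>lborel)"
  proof (rule nn_integral_cong)
    fix z :: "real^'n"
    show "(\<integral>\<^sup>+X. indicator ?S X * f (X + ?E z) \<partial>lborel) = (\<integral>\<^sup>+X. indicator ?S (X - ?E z) * f X \<partial>lborel)"
      using nn_integral_lborel_translate[of "\<lambda>X. indicator ?S (X - ?E z) * f X" "?E z", symmetric]
      by (simp add: add.commute)
  qed
  also have "\<dots> = (\<integral>\<^sup>+X. (\<integral>\<^sup>+z. indicator ?S (X - ?E z) * f X \<partial>lborel) \<partial>lborel)"
    by (rule lborel_pair.Fubini') measurable
  also have "\<dots> = (\<integral>\<^sup>+X. f X \<partial>lborel)"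
  proof (rule nn_integral_cong)
    fix X :: "real^'n^'n"
    let ?l = "(\<chi> i. X $ i $ j - 1) :: real^'n" and ?u = "(\<chi> i. X $ i $ j) :: real^'n"
    have "(X - ?E z \<in> ?S) = (z \<in> cbox ?l ?u)" for z
      by (auto simp: slab_def axis_def mem_box_cart algebra_simps)
    then have ind: "indicator ?S (X - ?E z) = (indicator (cbox ?l ?u) z :: ennreal)" for z
      by (simp add: indicator_def)
    have "emeasure lborel (cbox ?l ?u) = 1"
      by (subst emeasure_lborel_cbox) (auto simp: Basis_vec_def inner_axis intro!: prod.neutral)
    then show "(\<integral>\<^sup>+z. indicator ?S (X - ?E z) * f X \<partial>lborel) = f X"
      by (simp add: ind nn_integral_multc)
  qed
  finally show ?thesis .
qed

text \<open>
  For fixed rows of \<open>X\<close>, the heights \<open>z\<close> of the points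
  along \<open>axis j 1\<close> depend linearly on the coefficients \<open>a\<close> of the affine function whose graph
  contains the points, with determinant \<open>base_det j X\<close>; the hyperplane \<open>hyperplane \<eta>\<close> is the graph
  with coefficients \<open>a = (axis j 1 - \<eta>') / \<eta> $ j\<close>, where \<open>\<eta>'\<close> is \<open>\<eta>\<close> with \<open>j\<close>-th coordinate 0.
\<close>

proposition nn_integral_hyperplanes:
  fixes f :: "real^'n^'n \<Rightarrow> ennreal"
  assumes [measurable]: "f \<in> borel_measurable borel"
  shows "(\<integral>\<^sup>+X. f X \<partial>lborel) =
    (\<integral>\<^sup>+\<eta>. ennreal (1 / \<bar>\<eta> $ j\<bar> ^ (CARD('n) + 1)) *
      (\<integral>\<^sup>+X. indicator {X. \<forall>i. X $ i \<in> slab j} X * (ennreal \<bar>base_det j X\<bar> * f (\<chi> i. proj_along j \<eta> (X $ i))) \<partial>lborel)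
      \<partial>lborel)"
proof -
  let ?S = "{X :: real^'n^'n. \<forall>i. X $ i \<in> slab j}"
  let ?e = "axis j 1 :: real^'n"
  let ?w = "\<lambda>\<eta>::real^'n. ennreal (1 / \<bar>\<eta> $ j\<bar> ^ (CARD('n) + 1))"
  let ?P = "\<lambda>\<eta>::real^'n. (1 / \<eta> $ j) *\<^sub>R ((1 + \<eta> $ j) *\<^sub>R ?e - \<eta>)"
  have [measurable]: "?S \<in> sets borel" by measurable
  have heights: "(\<integral>\<^sup>+z. f (X + (\<chi> i. z $ i *\<^sub>R ?e)) \<partial>(lborel :: (real^'n) measure))
    = (\<integral>\<^sup>+\<eta>. ?w \<eta> * (ennreal \<bar>base_det j X\<bar> * f (\<chi> i. proj_along j \<eta> (X $ i))) \<partial>lborel)"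
    if nz: "base_det j X \<noteq> 0" for X
  proof -
    define X' where "X' = (\<chi> i l. if l = j then 1 else X $ i $ l)"
    \<comment> \<open>Subtracting the present heights \<open>?c\<close> makes \<open>z\<close> the
      vector of final heights. With ones in column \<open>j\<close> of \<open>X'\<close>, the
      entries of \<open>X' *v a\<close> are then the values of an affine function with constant term
      \<open>a $ j\<close> and slopes \<open>a $ l\<close>.\<close>
    let ?c = "\<chi> i. X $ i $ j"
    let ?g = "\<lambda>z :: real^'n. f (X + (\<chi> i. z $ i *\<^sub>R ?e))"
    have det: "det X' = base_det j X" by (simp add: X'_def base_det_def)
    have [measurable]: "(*v) X' \<in> borel_measurable borel"
      by (intro borel_measurable_continuous_onI continuous_intros)
    have "(\<integral>\<^sup>+z. ?g z \<partial>lborel) = (\<integral>\<^sup>+z. ?g (- ?c + z) \<partial>lborel)"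
      by (rule nn_integral_lborel_translate[symmetric]) measurable
    also have "\<dots> = ennreal \<bar>base_det j X\<bar> * (\<integral>\<^sup>+a. ?g (- ?c + X' *v a) \<partial>lborel)"
      using nz by (subst nn_integral_lborel_matrix[of _ X']) (simp_all add: det)
    also have "(\<integral>\<^sup>+a. ?g (- ?c + X' *v a) \<partial>lborel) = (\<integral>\<^sup>+\<eta>. ?w \<eta> * ?g (- ?c + X' *v ?P \<eta>) \<partial>lborel)"
      by (rule nn_integral_lborel_projective[symmetric]) measurable
    also have "\<dots> = (\<integral>\<^sup>+\<eta>. ?w \<eta> * f (\<chi> i. proj_along j \<eta> (X $ i)) \<partial>lborel)"
    proof (rule nn_integral_cong)
      fix \<eta> :: "real^'n"
      show "?w \<eta> * ?g (- ?c + X' *v ?P \<eta>) = ?w \<eta> * f (\<chi> i. proj_along j \<eta> (X $ i))"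
      \<comment> \<open>If \<eta> $ j = 0, the weight is 1 / 0 = 0 and both sides vanish.\<close>
      proof (cases "\<eta> $ j = 0")
        case False
        have "- X $ i $ j + (X' *v ?P \<eta>) $ i = (1 - \<eta> \<bullet> X $ i) / \<eta> $ j" for i
        proof -
          have "(X' *v ?P \<eta>) $ i = (\<Sum>l\<in>UNIV. (if l = j then (1 + \<eta> $ j * X $ i $ j) / \<eta> $ j else 0) - (\<eta> $ l * X $ i $ l) / \<eta> $ j)"
            unfolding matrix_vector_mult_def X'_def using False
            by (auto simp: axis_def field_simps intro!: sum.cong)
          also have "\<dots> = (1 + \<eta> $ j * X $ i $ j) / \<eta> $ j - (\<eta> \<bullet> X $ i) / \<eta> $ j"
            by (simp add: sum_subtractf inner_vec_def sum_divide_distrib)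
          finally have eq: "(X' *v ?P \<eta>) $ i = (1 + \<eta> $ j * X $ i $ j) / \<eta> $ j - (\<eta> \<bullet> X $ i) / \<eta> $ j" .
          show ?thesis unfolding eq using False by (simp add: field_simps)
        qed
        then have "X + (\<chi> i. (- ?c + X' *v ?P \<eta>) $ i *\<^sub>R ?e) = (\<chi> i. proj_along j \<eta> (X $ i))"
          by (simp add: vec_eq_iff proj_along_def)
        then show ?thesis by simp
      qed simp
    qed
    finally show ?thesis
      by (subst (asm) nn_integral_cmult[symmetric]) (auto simp: ac_simps)
  qed
  have "(\<integral>\<^sup>+X. f X \<partial>lborel) = (\<integral>\<^sup>+X. indicator ?S X * (\<integral>\<^sup>+z. f (X + (\<chi> i. z $ i *\<^sub>R ?e)) \<partial>(lborel :: (real^'n) measure)) \<partial>lborel)"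
    by (rule nn_integral_slices_rows[symmetric]) measurable
  also have "\<dots> = (\<integral>\<^sup>+X. (\<integral>\<^sup>+\<eta>. indicator ?S X * (?w \<eta> * (ennreal \<bar>base_det j X\<bar> * f (\<chi> i. proj_along j \<eta> (X $ i)))) \<partial>lborel) \<partial>lborel)"
    by (intro nn_integral_cong_AE, use AE_base_det_nonzero[of j] in eventually_elim)
      (simp add: heights nn_integral_cmult)
  also have "\<dots> = (\<integral>\<^sup>+\<eta>. (\<integral>\<^sup>+X. indicator ?S X * (?w \<eta> * (ennreal \<bar>base_det j X\<bar> * f (\<chi> i. proj_along j \<eta> (X $ i)))) \<partial>lborel) \<partial>lborel)"
    by (rule lborel_pair.Fubini') measurable
  also have "\<dots> = (\<integral>\<^sup>+\<eta>. ?w \<eta> * (\<integral>\<^sup>+X. indicator ?S X * (ennreal \<bar>base_det j X\<bar> * f (\<chi> i. proj_along j \<eta> (X $ i))) \<partial>lborel) \<partial>lborel)"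
    by (intro nn_integral_cong, subst nn_integral_cmult[symmetric]) (auto simp: ac_simps)
  finally show ?thesis .
qed

section \<open>Product measures and frames\<close>

text \<open>Both measures factorize on measurable rectangles. With \<open>U\<close> a uniform
  distribution written as the image of a weighted Lebesgue measure, expectations over independent
  vertices become Lebesgue integrals.\<close>

lemma PiM_distr_density:
  fixes N :: "'a measure" and w :: "'a \<Rightarrow> ennreal"
  assumes I: "finite I" and N: "sigma_finite_measure N"
    and w[measurable]: "w \<in> borel_measurable N" and T[measurable]: "T \<in> measurable N B"
    and U: "U = distr (density N w) B T" "sigma_finite_measure U"
  shows "PiM I (\<lambda>_. U) =
    distr (density (PiM I (\<lambda>_. N)) (\<lambda>X. \<Prod>i\<in>I. w (X i))) (PiM I (\<lambda>_. B)) (\<lambda>X. \<lambda>i\<in>I. T (X i))"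
proof -
  interpret U: product_sigma_finite "\<lambda>_. U" using U(2) by (simp add: product_sigma_finite_def)
  interpret N: product_sigma_finite "\<lambda>_. N" using N by (simp add: product_sigma_finite_def)
  have sU[measurable_cong]: "sets U = sets B" by (simp add: U(1))
  show ?thesis
  proof (rule U.PiM_eqI[symmetric, OF I])
    show "sets (distr (density (PiM I (\<lambda>_. N)) (\<lambda>X. \<Prod>i\<in>I. w (X i))) (PiM I (\<lambda>_. B)) (\<lambda>X. \<lambda>i\<in>I. T (X i)))
      = sets (PiM I (\<lambda>_. U))"
      using sets_PiM_cong[OF refl, of I "\<lambda>_. U" "\<lambda>_. B"] sU by simp
    fix A assume "\<And>i. i \<in> I \<Longrightarrow> A i \<in> sets U"
    then have A[measurable]: "i \<in> I \<Longrightarrow> A i \<in> sets B" for i using sU by simp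
    have PA[measurable]: "Pi\<^sub>E I A \<in> sets (PiM I (\<lambda>_. B))" using I A by (intro sets_PiM_I_finite)
    have [measurable]: "(\<lambda>X. \<lambda>i\<in>I. T (X i)) \<in> measurable (PiM I (\<lambda>_. N)) (PiM I (\<lambda>_. B))"
      by measurable
    have "emeasure (distr (density (PiM I (\<lambda>_. N)) (\<lambda>X. \<Prod>i\<in>I. w (X i))) (PiM I (\<lambda>_. B)) (\<lambda>X. \<lambda>i\<in>I. T (X i))) (Pi\<^sub>E I A)
      = (\<integral>\<^sup>+Y. indicator (Pi\<^sub>E I A) Y \<partial>distr (density (PiM I (\<lambda>_. N)) (\<lambda>X. \<Prod>i\<in>I. w (X i))) (PiM I (\<lambda>_. B)) (\<lambda>X. \<lambda>i\<in>I. T (X i)))"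
      using PA by (simp del: nn_integral_indicator add: nn_integral_indicator[symmetric])
    also have "\<dots> = (\<integral>\<^sup>+X. (\<Prod>i\<in>I. w (X i)) * indicator (Pi\<^sub>E I A) (\<lambda>i\<in>I. T (X i)) \<partial>PiM I (\<lambda>_. N))"
      by (subst nn_integral_distr, measurable, subst nn_integral_density) (auto intro!: borel_measurable_prod)
    also have "\<dots> = (\<integral>\<^sup>+X. (\<Prod>i\<in>I. w (X i) * indicator (A i) (T (X i))) \<partial>PiM I (\<lambda>_. N))"
      using I by (intro nn_integral_cong) (auto simp: prod.distrib indicator_def PiE_iff prod_zero_iff Bex_def
          intro!: prod.neutral)
    also have "\<dots> = (\<Prod>i\<in>I. \<integral>\<^sup>+x. w x * indicator (A i) (T x) \<partial>N)"
      using I by (intro N.product_nn_integral_prod) measurable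
    also have "\<dots> = (\<Prod>i\<in>I. emeasure U (A i))"
    proof (rule prod.cong[OF refl])
      fix i assume i: "i \<in> I"
      have "emeasure U (A i) = (\<integral>\<^sup>+y. indicator (A i) y \<partial>U)" using i A sU by simp
      also have "\<dots> = (\<integral>\<^sup>+x. w x * indicator (A i) (T x) \<partial>N)"
        unfolding U(1) using i by (subst nn_integral_distr, measurable, subst nn_integral_density) auto
      finally show "(\<integral>\<^sup>+x. w x * indicator (A i) (T x) \<partial>N) = emeasure U (A i)" ..
    qed
    finally show "emeasure (distr (density (PiM I (\<lambda>_. N)) (\<lambda>X. \<Prod>i\<in>I. w (X i))) (PiM I (\<lambda>_. B)) (\<lambda>X. \<lambda>i\<in>I. T (X i))) (Pi\<^sub>E I A)
      = (\<Prod>i\<in>I. emeasure U (A i))" .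
  qed
qed

text \<open>Bridge between product measures on functions and Lebesgue measure on vectors, checked on
  boxes. The component type is general because it serves both for coordinates of a point and for
  tuples of points.\<close>

lemma nn_integral_PiM_vec:
  fixes e :: "'n::finite \<Rightarrow> 'b" and f :: "('a::euclidean_space)^'n \<Rightarrow> ennreal"
  assumes e: "bij_betw e UNIV J" and [measurable]: "f \<in> borel_measurable borel"
  shows "(\<integral>\<^sup>+X. f (\<chi> i. X (e i)) \<partial>PiM J (\<lambda>_. lborel)) = (\<integral>\<^sup>+x. f x \<partial>lborel)"
proof -
  interpret product_sigma_finite "\<lambda>_::'b. lborel :: 'a measure"
    by (simp add: product_sigma_finite_def sigma_finite_lborel)
  have fin: "finite J" using e by (metis bij_betw_finite finite_code)
  have eJ[simp]: "e i \<in> J" for i using e by (auto simp: bij_betw_def)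
  let ?T = "\<lambda>X :: 'b \<Rightarrow> 'a. \<chi> i. X (e i)"
  have [measurable]: "?T \<in> measurable (PiM J (\<lambda>_. lborel)) borel"
    by (intro measurable_vec_lambda) (use eJ in measurable)
  have basis: "(Basis :: ('a^'n) set) = (\<lambda>(i, u). axis i u) ` (UNIV \<times> Basis)"
    by (auto simp: Basis_vec_def)
  have inj: "inj_on (\<lambda>(i, u). axis i u :: 'a^'n) (UNIV \<times> Basis)"
    by (auto simp: inj_on_def axis_eq_axis)
  have "lborel = distr (PiM J (\<lambda>_. lborel)) borel ?T"
  proof (rule lborel_eqI)
    fix l u :: "'a^'n" assume le: "\<And>b. b \<in> Basis \<Longrightarrow> l \<bullet> b \<le> u \<bullet> b"
    have le': "l $ i \<bullet> v \<le> u $ i \<bullet> v" if "v \<in> Basis" for i v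
      using le[of "axis i v"] that by (auto simp: inner_axis basis)
    have "?T -` box l u \<inter> space (PiM J (\<lambda>_. lborel))
        = Pi\<^sub>E J (\<lambda>k. box (l $ the_inv_into UNIV e k) (u $ the_inv_into UNIV e k))" (is "?L = ?R")
    proof (intro set_eqI iffI)
      fix X assume X: "X \<in> ?L"
      show "X \<in> ?R"
      proof (rule PiE_I)
        fix k assume "k \<in> J"
        then obtain i where i: "k = e i" using e by (auto simp: bij_betw_def)
        have "the_inv_into UNIV e k = i" using e i by (auto simp: bij_betw_def the_inv_into_f_f)
        then show "X k \<in> box (l $ the_inv_into UNIV e k) (u $ the_inv_into UNIV e k)"
          using X i by (auto simp: mem_box basis inner_axis)
      qed (use X in \<open>auto simp: space_PiM PiE_def extensional_def\<close>)
    next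
      fix X assume X: "X \<in> ?R"
      have "X (e i) \<in> box (l $ i) (u $ i)" for i
        using PiE_mem[OF X eJ[of i]] e by (simp add: bij_betw_def the_inv_into_f_f)
      then show "X \<in> ?L" using X by (auto simp: mem_box basis inner_axis space_PiM PiE_iff)
    qed
    then have "emeasure (distr (PiM J (\<lambda>_. lborel)) borel ?T) (box l u)
      = (\<Prod>k\<in>J. emeasure lborel (box (l $ the_inv_into UNIV e k) (u $ the_inv_into UNIV e k)))"
      by (subst emeasure_distr) (auto simp: emeasure_PiM fin)
    also have "\<dots> = (\<Prod>i\<in>UNIV. emeasure lborel (box (l $ i) (u $ i)))"
      using e by (subst prod.reindex_bij_betw[OF e, symmetric]) (auto simp: bij_betw_def the_inv_into_f_f)
    also have "\<dots> = (\<Prod>i\<in>UNIV. ennreal (\<Prod>v\<in>Basis. (u - l) $ i \<bullet> v))"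
      by (intro prod.cong refl) (simp add: emeasure_lborel_box le')
    also have "\<dots> = ennreal (\<Prod>i\<in>UNIV. \<Prod>v\<in>Basis. (u - l) $ i \<bullet> v)"
      by (intro prod_ennreal prod_nonneg) (simp add: inner_diff_left le')
    also have "(\<Prod>i\<in>UNIV. \<Prod>v\<in>Basis. (u - l) $ i \<bullet> v) = (\<Prod>b\<in>Basis. (u - l) \<bullet> b)"
      unfolding basis by (subst prod.reindex[OF inj]) (simp add: prod.cartesian_product split_def inner_axis)
    finally show "emeasure (distr (PiM J (\<lambda>_. lborel)) borel ?T) (box l u) = (\<Prod>b\<in>Basis. (u - l) \<bullet> b)" .
  qed simp
  then have "(\<integral>\<^sup>+x. f x \<partial>lborel) = (\<integral>\<^sup>+x. f x \<partial>distr (PiM J (\<lambda>_. lborel)) borel ?T)" by simp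
  also have "\<dots> = (\<integral>\<^sup>+X. f (?T X) \<partial>PiM J (\<lambda>_. lborel))" by (subst nn_integral_distr) auto
  finally show ?thesis ..
qed

section \<open>Frames and Lebesgue measure on flats\<close>

lemma frame_map_measurable [measurable]:
  "m \<le> n \<Longrightarrow> frame_map m p b \<in> measurable (PiM {..<n} (\<lambda>_. lborel)) (borel :: 'a::euclidean_space measure)"
  unfolding frame_map_def by measurable

text \<open>Here \<open>v\<close> is any basis: it is applied to an orthonormal frame of the whole
  space, and to a frame of a hyperplane completed by an oblique axis.\<close>

lemma nn_integral_lborel_frame:
  fixes v :: "nat \<Rightarrow> real^'n" and f :: "real^'n \<Rightarrow> ennreal"
  assumes e: "bij_betw e (UNIV :: 'n set) {..<CARD('n)}" and [measurable]: "f \<in> borel_measurable borel"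
    and nz: "det (\<chi> r i. v (e i) $ r) \<noteq> 0"
  shows "(\<integral>\<^sup>+x. f x \<partial>lborel) = ennreal \<bar>det (\<chi> r i. v (e i) $ r)\<bar> *
    (\<integral>\<^sup>+c. f (frame_map CARD('n) p v c) \<partial>PiM {..<CARD('n)} (\<lambda>_. lborel))"
proof -
  let ?M = "\<chi> r i. v (e i) $ r"
  have [measurable]: "(*v) ?M \<in> borel_measurable borel"
    by (intro borel_measurable_continuous_onI continuous_intros)
  have "frame_map CARD('n) p v c = p + ?M *v (\<chi> i. c (e i))" for c
  proof -
    have "(\<Sum>i<CARD('n). c i *\<^sub>R v i) = (\<Sum>i\<in>UNIV. c (e i) *\<^sub>R v (e i))"
      by (rule sum.reindex_bij_betw[OF e, symmetric])
    then show ?thesis by (simp add: frame_map_def vec_eq_iff matrix_vector_mult_def mult.commute)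
  qed
  then have "(\<integral>\<^sup>+c. f (frame_map CARD('n) p v c) \<partial>PiM {..<CARD('n)} (\<lambda>_. lborel))
    = (\<integral>\<^sup>+c. f (p + ?M *v (\<chi> i. c (e i))) \<partial>PiM {..<CARD('n)} (\<lambda>_. lborel))" by simp
  also have "\<dots> = (\<integral>\<^sup>+x. f (p + ?M *v x) \<partial>lborel)"
    by (rule nn_integral_PiM_vec[OF e, of "\<lambda>x. f (p + ?M *v x)"]) measurable
  finally show ?thesis
    using nn_integral_lborel_matrix[OF _ nz, of "\<lambda>x. f (p + x)"] nn_integral_lborel_translate[of f p] by simp
qed

text \<open>Exposes the frame behind \<open>SOME\<close>. Of this frame only the property
  \<open>is_frame\<close> is known, so volumes must be computed for every admissible choice.\<close>

lemma flat_lborel_frame: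
  assumes "affine A" "A \<noteq> {}"
  obtains p b where "is_frame A (nat (aff_dim A)) p b"
    and "flat_lborel A = distr (PiM {..<nat (aff_dim A)} (\<lambda>_. lborel)) borel (frame_map (nat (aff_dim A)) p b)"
proof -
  let ?P = "\<lambda>(p, b). is_frame A (nat (aff_dim A)) p b"
  obtain p b where pb: "(SOME x. ?P x) = (p, b)" by fastforce
  have "\<exists>x. ?P x" using is_frame_exists[OF assms] by auto
  then have "?P (SOME x. ?P x)" by (rule someI_ex)
  then show thesis using that[of p b] pb by (simp add: flat_lborel_def Let_def)
qed

lemma orthogonal_matrix_frame:
  fixes v :: "nat \<Rightarrow> real^'n"
  assumes e: "bij_betw e (UNIV :: 'n set) {..<CARD('n)}"
    and "\<And>i j. \<lbrakk>i < CARD('n); j < CARD('n)\<rbrakk> \<Longrightarrow> v i \<bullet> v j = (if i = j then 1 else 0)"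
  shows "orthogonal_matrix (\<chi> r i. v (e i) $ r)"
proof -
  have lt: "e i < CARD('n)" for i using e by (auto simp: bij_betw_def)
  have inj: "e i = e k \<longleftrightarrow> i = k" for i k using e by (auto simp: bij_betw_def inj_on_def)
  show ?thesis
    unfolding orthogonal_matrix vec_eq_iff
  proof (intro allI)
    fix i k
    have "(Finite_Cartesian_Product.transpose (\<chi> r i. v (e i) $ r) ** (\<chi> r i. v (e i) $ r)) $ i $ k = v (e i) \<bullet> v (e k)"
      by (simp add: matrix_matrix_mult_def Finite_Cartesian_Product.transpose_def inner_vec_def)
    also have "\<dots> = mat 1 $ i $ k" by (simp add: assms(2) lt inj mat_def)
    finally show "(Finite_Cartesian_Product.transpose (\<chi> r i. v (e i) $ r) ** (\<chi> r i. v (e i) $ r)) $ i $ k = mat 1 $ i $ k" .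
  qed
qed

lemma ex_bij_betw_UNIV_lessThan:
  obtains e where "bij_betw e (UNIV :: 'n::finite set) {..<CARD('n)}"
  using ex_bij_betw_finite_nat[of "UNIV :: 'n set"] by (auto simp: atLeast0LessThan)

text \<open>An orthonormal frame of the whole space has determinant 1 or -1. This identifies the
  measure in the moment of a full-dimensional body.\<close>

lemma flat_lborel_UNIV: "flat_lborel (UNIV :: (real^'n) set) = lborel"
proof -
  obtain e where e: "bij_betw e (UNIV :: 'n set) {..<CARD('n)}" by (rule ex_bij_betw_UNIV_lessThan)
  have ad: "nat (aff_dim (UNIV :: (real^'n) set)) = CARD('n)" by simp
  obtain p b where pb: "is_frame (UNIV :: (real^'n) set) CARD('n) p b"
    and fl: "flat_lborel (UNIV :: (real^'n) set) = distr (PiM {..<CARD('n)} (\<lambda>_. lborel)) borel (frame_map CARD('n) p b)"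
    using flat_lborel_frame[of "UNIV :: (real^'n) set"] unfolding ad by auto
  let ?M = "\<chi> r i. b (e i) $ r"
  have "orthogonal_matrix ?M" using pb by (intro orthogonal_matrix_frame e) (auto simp: is_frame_def)
  then have d: "\<bar>det ?M\<bar> = 1" using det_orthogonal_matrix[of ?M] by auto
  then have nz: "det ?M \<noteq> 0" by auto
  show ?thesis
  proof (rule measure_eqI)
    fix A assume "A \<in> sets (flat_lborel (UNIV :: (real^'n) set))"
    then have A[measurable]: "A \<in> sets borel" by (simp add: fl)
    have "emeasure lborel A = (\<integral>\<^sup>+x. indicator A x \<partial>lborel)" by simp
    also have "\<dots> = (\<integral>\<^sup>+c. indicator A (frame_map CARD('n) p b c) \<partial>PiM {..<CARD('n)} (\<lambda>_. lborel))"
      using nn_integral_lborel_frame[OF e, of "indicator A" b p] nz d by simp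
    also have "\<dots> = (\<integral>\<^sup>+x. indicator A x \<partial>flat_lborel (UNIV :: (real^'n) set))"
      unfolding fl by (subst nn_integral_distr) auto
    finally show "emeasure (flat_lborel (UNIV :: (real^'n) set)) A = emeasure lborel A" by (simp add: fl)
  qed (simp add: fl)
qed

section \<open>Volume in a hyperplane\<close>

lemma proj_along_in_hyperplane: "\<eta> $ j \<noteq> 0 \<Longrightarrow> proj_along j \<eta> x \<in> hyperplane \<eta>"
  by (simp add: proj_along_def hyperplane_def inner_add_right inner_axis)

lemma proj_along_hyperplane: "x \<in> hyperplane \<eta> \<Longrightarrow> proj_along j \<eta> x = x"
  by (simp add: proj_along_def hyperplane_def)

lemma proj_along_shift: "\<eta> $ j \<noteq> 0 \<Longrightarrow> proj_along j \<eta> (x + s *\<^sub>R axis j 1) = proj_along j \<eta> x"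
  by (simp add: proj_along_def inner_add_right inner_axis field_simps flip: scaleR_add_left)

lemma proj_along_nth: "l \<noteq> j \<Longrightarrow> proj_along j \<eta> x $ l = x $ l"
  by (simp add: proj_along_def axis_def)

lemma base_det_proj_along: "base_det j (\<chi> i. proj_along j \<eta> (X $ i)) = base_det j X"
  unfolding base_det_def by (intro arg_cong[where f=det]) (simp add: vec_eq_iff proj_along_nth)

lemma nonzero_nth: "\<eta> $ j \<noteq> 0 \<Longrightarrow> \<eta> \<noteq> 0" for \<eta> :: "real^'n"
  by auto

lemma affine_hyperplane_set: "affine (hyperplane \<eta>)"
  using affine_hyperplane[of \<eta> 1] by (simp add: hyperplane_def)

lemma closed_hyperplane_set: "closed (hyperplane \<eta>)"
  using closed_hyperplane[of \<eta> 1] by (simp add: hyperplane_def)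

lemma nat_aff_dim_hyperplane:
  fixes \<eta> :: "real^'n"
  shows "\<eta> \<noteq> 0 \<Longrightarrow> nat (aff_dim (hyperplane \<eta>)) = CARD('n) - 1"
  using aff_dim_hyperplane[of \<eta> 1] by (simp add: hyperplane_def nat_diff_distrib)

text \<open>
  Complete an orthonormal frame of the hyperplane by \<open>axis j 1\<close>: in these coordinates \<open>proj_along j \<eta>\<close>
  forgets the last one, and the frame spans a parallelepiped of volume \<open>\<bar>\<eta> $ j\<bar> / norm \<eta>\<close>.
\<close>

proposition flat_lborel_hyperplane:
  fixes \<eta> :: "real^'n"
  assumes j: "\<eta> $ j \<noteq> 0"
  shows "flat_lborel (hyperplane \<eta>) =
    distr (density lborel (\<lambda>x. ennreal (norm \<eta> / \<bar>\<eta> $ j\<bar>) * indicator (slab j) x)) borel (proj_along j \<eta>)"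
    (is "_ = ?R")
proof -
  have nz: "\<eta> \<noteq> 0" using j by (rule nonzero_nth)
  obtain m where d: "CARD('n) = Suc m" by (metis not0_implies_Suc zero_less_card_finite less_numeral_extra(3))
  obtain e where e: "bij_betw e (UNIV :: 'n set) {..<CARD('n)}" by (rule ex_bij_betw_UNIV_lessThan)
  have lt: "e i < CARD('n)" for i using e by (auto simp: bij_betw_def)
  obtain n0 where n0: "e n0 = m" using e d by (metis bij_betw_def imageE lessThan_iff lessI)
  have em: "e i = m \<longleftrightarrow> i = n0" for i using e n0 by (auto simp: bij_betw_def inj_on_def)
  obtain p b where pb: "is_frame (hyperplane \<eta>) m p b"
    and fl: "flat_lborel (hyperplane \<eta>) = distr (PiM {..<m} (\<lambda>_. lborel)) borel (frame_map m p b)"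
    using flat_lborel_frame[OF affine_hyperplane_set, of \<eta>] proj_along_in_hyperplane[OF j, of 0] nat_aff_dim_hyperplane[OF nz] d
    by (metis diff_Suc_1 empty_iff)
  have in_H: "\<eta> \<bullet> frame_map m p b c = 1" for c
    using pb by (auto simp: is_frame_def hyperplane_def)
  have orth: "\<eta> \<bullet> b i = 0" if "i < m" for i
  proof -
    have "frame_map m p b (\<lambda>k. if k = i then 1 else 0) = p + b i"
      using that by (simp add: frame_map_def if_distrib[of "\<lambda>c. c *\<^sub>R _"] cong: if_cong)
    moreover have "frame_map m p b (\<lambda>_. 0) = p" by (simp add: frame_map_def)
    ultimately show ?thesis using in_H[of "\<lambda>k. if k = i then 1 else 0"] in_H[of "\<lambda>_. 0"] by (simp add: inner_add_right)
  qed
  \<comment> \<open>Two completions of the same frame: \<open>w\<close> by the unit normal, which is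
    orthonormal and has determinant 1 or -1, and \<open>v\<close> by the direction of projection,
    whose determinant is wanted.\<close>
  define w where "w i = (if i < m then b i else \<eta> /\<^sub>R norm \<eta>)" for i
  define v where "v i = (if i < m then b i else axis j 1)" for i
  let ?W = "\<chi> r i. w (e i) $ r" and ?V = "\<chi> r i. v (e i) $ r"
  have oW: "orthogonal_matrix ?W"
  proof (rule orthogonal_matrix_frame[OF e])
    fix i k assume "i < CARD('n)" "k < CARD('n)"
    moreover have "\<eta> \<bullet> \<eta> = norm \<eta> * norm \<eta>" by (simp add: dot_square_norm power2_eq_square)
    ultimately show "w i \<bullet> w k = (if i = k then 1 else 0)"
      using pb orth nz d by (auto simp: w_def is_frame_def inner_commute field_simps less_Suc_eq)
  qed
  \<comment> \<open>The coordinates of \<open>axis j 1\<close> in the frame \<open>w\<close>. Since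
    \<open>?V\<close> is \<open>?W\<close> with its last column replaced by \<open>?W *v y\<close>,
    Cramer's rule leaves only the normal component of the axis, \<eta> $ j / norm \<eta>.\<close>
  define y where "y = Finite_Cartesian_Product.transpose ?W *v axis j 1"
  have Wy: "?W *v y = axis j 1"
    using oW unfolding y_def matrix_vector_mul_assoc orthogonal_matrix_def by (simp only: matrix_vector_mul_lid)
  have "e i < m" if "i \<noteq> n0" for i using lt[of i] em[of i] that d by simp
  then have "?V = (\<chi> r i. if i = n0 then (?W *v y) $ r else ?W $ r $ i)"
    unfolding Wy by (auto simp: vec_eq_iff v_def w_def n0)
  then have "det ?V = y $ n0 * det ?W" using cramer_lemma[of n0 ?W y] by simp
  moreover have "y $ n0 = \<eta> $ j / norm \<eta>"
    unfolding y_def matrix_vector_mult_basis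
    by (simp add: column_def Finite_Cartesian_Product.transpose_def n0 w_def divide_inverse mult.commute)
  moreover have "\<bar>det ?W\<bar> = 1" using det_orthogonal_matrix[OF oW] by auto
  ultimately have dV: "\<bar>det ?V\<bar> = \<bar>\<eta> $ j\<bar> / norm \<eta>" by (simp add: abs_mult)
  then have dV0: "det ?V \<noteq> 0" using j nz by auto
  interpret product_sigma_finite "\<lambda>_::nat. lborel :: real measure"
    by (simp add: product_sigma_finite_def sigma_finite_lborel)
  have im: "{..<CARD('n)} = insert m {..<m}" by (auto simp: d)
  show ?thesis
  proof (rule measure_eqI)
    fix A assume "A \<in> sets (flat_lborel (hyperplane \<eta>))"
    then have A[measurable]: "A \<in> sets borel" by (simp add: fl)
    let ?f = "\<lambda>x. indicator (slab j) x * indicator A (proj_along j \<eta> x) :: ennreal"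
    have frame[measurable]: "frame_map CARD('n) p v \<in> measurable (PiM (insert m {..<m}) (\<lambda>_. lborel)) borel"
      using frame_map_measurable[of "CARD('n)" "CARD('n)" p v] by (simp add: im)
    have upd: "frame_map CARD('n) p v (c(m := s)) = frame_map m p b c + s *\<^sub>R axis j 1" for c s
      by (simp add: frame_map_def d v_def)
    have flat: "emeasure (flat_lborel (hyperplane \<eta>)) A = (\<integral>\<^sup>+c. indicator A (frame_map m p b c) \<partial>PiM {..<m} (\<lambda>_. lborel))"
      unfolding fl by (subst nn_integral_indicator[symmetric], simp, subst nn_integral_distr) auto
    have "(\<integral>\<^sup>+x. ?f x \<partial>lborel) = ennreal (\<bar>\<eta> $ j\<bar> / norm \<eta>) * (\<integral>\<^sup>+c. ?f (frame_map CARD('n) p v c) \<partial>PiM (insert m {..<m}) (\<lambda>_. lborel))"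
      using nn_integral_lborel_frame[OF e, of ?f v p] dV0 by (simp add: dV im)
    also have "(\<integral>\<^sup>+c. ?f (frame_map CARD('n) p v c) \<partial>PiM (insert m {..<m}) (\<lambda>_. lborel))
       = (\<integral>\<^sup>+c. (\<integral>\<^sup>+s. ?f (frame_map m p b c + s *\<^sub>R axis j 1) \<partial>lborel) \<partial>PiM {..<m} (\<lambda>_. lborel))"
      by (subst product_nn_integral_insert) (auto simp: upd)
    also have "\<dots> = (\<integral>\<^sup>+c. indicator A (frame_map m p b c) \<partial>PiM {..<m} (\<lambda>_. lborel))"
    proof (rule nn_integral_cong)
      fix c
      let ?q = "frame_map m p b c"
      have "proj_along j \<eta> (?q + s *\<^sub>R axis j 1) = ?q" for s
        using proj_along_hyperplane[of ?q \<eta> j] in_H[of c] by (simp add: proj_along_shift[OF j] hyperplane_def)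
      moreover have "indicator (slab j) (?q + s *\<^sub>R axis j 1) = (indicator {- ?q $ j..1 - ?q $ j} s :: ennreal)" for s
        by (auto simp: slab_def axis_def indicator_def)
      ultimately show "(\<integral>\<^sup>+s. ?f (?q + s *\<^sub>R axis j 1) \<partial>lborel) = indicator A ?q"
        by (simp add: nn_integral_multc)
    qed
    finally have *: "(\<integral>\<^sup>+x. ?f x \<partial>lborel) = ennreal (\<bar>\<eta> $ j\<bar> / norm \<eta>) * emeasure (flat_lborel (hyperplane \<eta>)) A"
      by (simp add: flat)
    have "emeasure ?R A = (\<integral>\<^sup>+x. ennreal (norm \<eta> / \<bar>\<eta> $ j\<bar>) * ?f x \<partial>lborel)"
      by (subst nn_integral_indicator[symmetric], simp, subst nn_integral_distr, measurable, subst nn_integral_density)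
        (auto simp: mult.assoc)
    also have "\<dots> = ennreal (norm \<eta> / \<bar>\<eta> $ j\<bar>) * (ennreal (\<bar>\<eta> $ j\<bar> / norm \<eta>) * emeasure (flat_lborel (hyperplane \<eta>)) A)"
      by (simp add: nn_integral_cmult *)
    also have "\<dots> = emeasure (flat_lborel (hyperplane \<eta>)) A"
      using j nz by (simp add: mult.assoc[symmetric] ennreal_mult[symmetric])
    finally show "emeasure (flat_lborel (hyperplane \<eta>)) A = emeasure ?R A" ..
  qed (simp add: fl)
qed

section \<open>Simplices inside a hyperplane\<close>

lemma emeasure_flat_lborel_hyperplane:
  fixes \<eta> :: "real^'n"
  assumes j: "\<eta> $ j \<noteq> 0" and [measurable]: "A \<in> sets borel"
  shows "emeasure (flat_lborel (hyperplane \<eta>)) A =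
    ennreal (norm \<eta> / \<bar>\<eta> $ j\<bar>) * (\<integral>\<^sup>+x. indicator (slab j) x * indicator A (proj_along j \<eta> x) \<partial>lborel)"
  unfolding flat_lborel_hyperplane[OF j]
  by (subst nn_integral_indicator[symmetric], simp, subst nn_integral_distr, measurable, subst nn_integral_density)
    (auto simp: mult.assoc nn_integral_cmult[symmetric])

text \<open>The cone with apex 0 over \<open>B\<close> raised to height 1 meets height
  \<open>t\<close> in \<open>t\<close> times the base, and t^(d - 1) integrates to 1 / d. So the (d
  - 1)-volume of \<open>B\<close> on the left is reached through a d-dimensional volume, for which
  the determinant formula is at hand.\<close>

lemma nn_integral_cone_slices:
  fixes B :: "(real^'n) set"
  assumes B: "convex B" "B \<noteq> {}" "\<And>x. x \<in> B \<Longrightarrow> x $ j = 0"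
    and [measurable]: "B \<in> sets borel" "convex hull (insert 0 ((\<lambda>x. x + axis j 1) ` B)) \<in> sets borel"
  shows "(\<integral>\<^sup>+x. indicator (slab j) x * indicator B (x - x $ j *\<^sub>R axis j 1) \<partial>lborel)
    = ennreal (real CARD('n)) * emeasure lborel (convex hull (insert 0 ((\<lambda>x. x + axis j 1) ` B)))"
proof -
  let ?e = "axis j 1 :: real^'n"
  let ?L = "\<lambda>x :: real^'n. x - x $ j *\<^sub>R ?e"
  define C where "C = convex hull (insert 0 ((\<lambda>x. x + ?e) ` B))"
  define I where "I = (\<integral>\<^sup>+x. indicator (slab j) x * indicator B (?L x) \<partial>lborel)"
  have [measurable]: "C \<in> sets borel" by (simp add: C_def)
  have L0: "?L x $ j = 0" for x by (simp add: axis_def)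
  have "convex ((\<lambda>x. x + ?e) ` B)"
    using convex_translation[OF B(1), of ?e] by (simp add: add.commute)
  then have Chull: "C = {x. \<exists>u\<ge>0. \<exists>v\<ge>0. \<exists>y. u + v = 1 \<and> y \<in> (\<lambda>x. x + ?e) ` B \<and> x = u *\<^sub>R 0 + v *\<^sub>R y}"
    using B(2) convex_hull_insert[of "(\<lambda>x. x + ?e) ` B" 0] by (simp add: C_def hull_same)
  have memC: "?L x + t *\<^sub>R ?e \<in> C \<longleftrightarrow> t \<le> 1 \<and> (1 / t) *\<^sub>R ?L x \<in> B" if "t > 0" for x t
  proof
    assume "?L x + t *\<^sub>R ?e \<in> C"
    then obtain u v y where uv: "u \<ge> 0" "v \<ge> 0" "u + v = 1" "y \<in> B" "?L x + t *\<^sub>R ?e = v *\<^sub>R (y + ?e)"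
      unfolding Chull by auto
    have "(?L x + t *\<^sub>R ?e) $ j = (v *\<^sub>R (y + ?e)) $ j" using uv(5) by simp
    then have tv: "t = v" using B(3)[OF uv(4)] by (simp add: axis_def)
    have "?L x = t *\<^sub>R y" using uv(5) by (simp add: tv scaleR_add_right)
    then have "(1 / t) *\<^sub>R ?L x = y" using that by simp
    then show "t \<le> 1 \<and> (1 / t) *\<^sub>R ?L x \<in> B" using uv tv by auto
  next
    assume a: "t \<le> 1 \<and> (1 / t) *\<^sub>R ?L x \<in> B"
    have "?L x + t *\<^sub>R ?e = t *\<^sub>R ((1 / t) *\<^sub>R ?L x + ?e)" using that by (simp add: scaleR_add_right)
    then have "?L x + t *\<^sub>R ?e = (1 - t) *\<^sub>R 0 + t *\<^sub>R ((1 / t) *\<^sub>R ?L x + ?e)" by simp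
    moreover have "(1 / t) *\<^sub>R ?L x + ?e \<in> (\<lambda>x. x + ?e) ` B" using a by blast
    moreover have "0 \<le> 1 - t" "0 \<le> t" "1 - t + t = 1" using a that by auto
    ultimately show "?L x + t *\<^sub>R ?e \<in> C"
      unfolding Chull by blast
  qed
  have memC_neg: "?L x + t *\<^sub>R ?e \<notin> C" if "t < 0" for x t
  proof
    assume "?L x + t *\<^sub>R ?e \<in> C"
    then obtain u v y where uv: "u \<ge> 0" "v \<ge> 0" "u + v = 1" "y \<in> B" "?L x + t *\<^sub>R ?e = v *\<^sub>R (y + ?e)"
      unfolding Chull by auto
    have "(?L x + t *\<^sub>R ?e) $ j = (v *\<^sub>R (y + ?e)) $ j" using uv(5) by simp
    then have "t = v" using B(3)[OF uv(4)] by (simp add: axis_def)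
    then show False using uv that by simp
  qed
  have "emeasure lborel C = (\<integral>\<^sup>+x. indicator C x \<partial>lborel)" by simp
  also have "\<dots> = (\<integral>\<^sup>+t. (\<integral>\<^sup>+x. indicator (slab j) x * indicator C (x + (t - x $ j) *\<^sub>R ?e) \<partial>lborel) \<partial>lborel)"
    by (rule nn_integral_slices_swap[symmetric]) measurable
  also have "\<dots> = (\<integral>\<^sup>+t. ennreal (t ^ (CARD('n) - 1)) * indicator {0..1} t * I \<partial>lborel)"
  proof (rule nn_integral_cong_AE, use AE_lborel_singleton[of "0::real"] in eventually_elim)
    fix t :: real assume t0: "t \<noteq> 0"
    have eq: "x + (t - x $ j) *\<^sub>R ?e = ?L x + t *\<^sub>R ?e" for x by (simp add: algebra_simps)
    consider "t < 0" | "t > 1" | "0 < t" "t \<le> 1" using t0 by linarith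
    then show "(\<integral>\<^sup>+x. indicator (slab j) x * indicator C (x + (t - x $ j) *\<^sub>R ?e) \<partial>lborel)
      = ennreal (t ^ (CARD('n) - 1)) * indicator {0..1} t * I"
    proof cases
      case 1
      then show ?thesis unfolding eq using memC_neg by (simp add: indicator_def)
    next
      case 2
      then show ?thesis unfolding eq using memC by (simp add: indicator_def)
    next
      case 3
      have "indicator C (?L x + t *\<^sub>R ?e) = (indicator B ((1 / t) *\<^sub>R ?L x) :: ennreal)" for x
        using 3 by (simp add: indicator_def memC del: scaleR_diff_right)
      then have "(\<integral>\<^sup>+x. indicator (slab j) x * indicator C (x + (t - x $ j) *\<^sub>R ?e) \<partial>lborel)
        = (\<integral>\<^sup>+x. indicator (slab j) x * indicator B ((1 / t) *\<^sub>R ?L x) \<partial>lborel)"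
        unfolding eq by simp
      also have "\<dots> = ennreal (\<bar>t\<bar> ^ (CARD('n) - 1)) * (\<integral>\<^sup>+x. indicator (slab j) x * indicator B ((1 / t) *\<^sub>R (t *\<^sub>R ?L x)) \<partial>lborel)"
        using t0 by (intro nn_integral_slab_scale[of "\<lambda>x. indicator B ((1 / t) *\<^sub>R x)"]) auto
      also have "(\<lambda>x. (1 / t) *\<^sub>R (t *\<^sub>R ?L x)) = ?L" using t0 by (simp add: fun_eq_iff)
      then have "(\<integral>\<^sup>+x. indicator (slab j) x * indicator B ((1 / t) *\<^sub>R (t *\<^sub>R ?L x)) \<partial>lborel) = I"
        unfolding I_def by (metis (no_types, lifting))
      finally show ?thesis using 3 by simp
    qed
  qed
  also have "\<dots> = (\<integral>\<^sup>+t. ennreal (t ^ (CARD('n) - 1)) * indicator {0..1} t \<partial>lborel) * I"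
    by (rule nn_integral_multc) measurable
  also have "(\<integral>\<^sup>+t. ennreal (t ^ (CARD('n) - 1)) * indicator {0..1} t \<partial>lborel) = ennreal (1 / real CARD('n))"
  proof -
    have "((\<lambda>t. t ^ CARD('n) / real CARD('n)) has_real_derivative t ^ (CARD('n) - 1)) (at t)" for t
      by (auto intro!: derivative_eq_intros)
    then have "(\<integral>\<^sup>+t. ennreal (t ^ (CARD('n) - 1)) * indicator {0..1} t \<partial>lborel)
      = ennreal (1 ^ CARD('n) / real CARD('n) - 0 ^ CARD('n) / real CARD('n))"
      by (intro nn_integral_FTC_Icc) (auto intro: has_field_derivative_at_within)
    then show ?thesis by (simp add: zero_power)
  qed
  finally have "ennreal (real CARD('n)) * emeasure lborel C = ennreal (real CARD('n)) * ennreal (1 / real CARD('n)) * I"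
    by (simp add: mult.assoc)
  also have "\<dots> = I" by (simp flip: ennreal_mult)
  finally show ?thesis by (simp add: C_def I_def)
qed

text \<open>Flatten the simplex along \<open>axis j 1\<close>, raise it to height 1 and take the
  cone from 0: this is a full simplex, and multiplying its volume by d turns d! into (d - 1)!. The
  factor norm \<eta> / \<bar>\<eta> $ j\<bar> undoes the shrinking of areas by the
  projection.\<close>

proposition measure_flat_simplex:
  fixes \<eta> :: "real^'n" and X :: "real^'n^'n"
  assumes j: "\<eta> $ j \<noteq> 0" and X: "\<And>i. X $ i \<in> hyperplane \<eta>"
  shows "measure (flat_lborel (hyperplane \<eta>)) (convex hull (range (($) X)))
    = norm \<eta> / \<bar>\<eta> $ j\<bar> * \<bar>base_det j X\<bar> / fact (CARD('n) - 1)"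
proof -
  let ?e = "axis j 1 :: real^'n"
  let ?L = "\<lambda>x :: real^'n. x - x $ j *\<^sub>R ?e"
  let ?S = "range (($) X)"
  have linL: "linear ?L" by (rule linearI) (simp_all add: algebra_simps)
  have Lhull: "?L ` (convex hull ?S) = convex hull (?L ` ?S)" by (rule convex_hull_linear_image[OF linL])
  have compact: "compact (convex hull ?S)" "compact (convex hull (?L ` ?S))"
    by (intro finite_imp_compact_convex_hull; simp)+
  then have [measurable]: "convex hull ?S \<in> sets borel" "convex hull (?L ` ?S) \<in> sets borel"
    by (auto intro!: borel_closed compact_imp_closed)
  have HS: "convex hull ?S \<subseteq> hyperplane \<eta>"
    using X by (intro hull_minimal) (auto simp: affine_hyperplane_set affine_imp_convex)
  have projL: "proj_along j \<eta> (?L x) = proj_along j \<eta> x" for x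
    using proj_along_shift[OF j, of x "- x $ j"] by simp
  have Lproj: "?L (proj_along j \<eta> x) = ?L x" for x
    by (simp add: vec_eq_iff axis_def proj_along_def)
  have mem: "proj_along j \<eta> x \<in> convex hull ?S \<longleftrightarrow> ?L x \<in> convex hull (?L ` ?S)" for x
  proof
    assume "proj_along j \<eta> x \<in> convex hull ?S"
    then have "?L (proj_along j \<eta> x) \<in> ?L ` (convex hull ?S)" by (rule imageI)
    then show "?L x \<in> convex hull (?L ` ?S)" unfolding Lproj Lhull .
  next
    assume "?L x \<in> convex hull (?L ` ?S)"
    then obtain y where y: "?L x = ?L y" "y \<in> convex hull ?S" unfolding Lhull[symmetric] by blast
    have "proj_along j \<eta> x = proj_along j \<eta> y" using arg_cong[OF y(1), of "proj_along j \<eta>"] by (simp only: projL)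
    also have "\<dots> = y" using y(2) HS by (intro proj_along_hyperplane) auto
    finally show "proj_along j \<eta> x \<in> convex hull ?S" using y(2) by simp
  qed
  define Z where "Z = (\<chi> i. ?L (X $ i) + ?e)"
  have cone: "convex hull (insert 0 ((\<lambda>x. x + ?e) ` (convex hull (?L ` ?S)))) = convex hull (insert 0 (range (($) Z)))"
  proof -
    have "(\<lambda>x. x + ?e) ` (convex hull (?L ` ?S)) = convex hull ((\<lambda>x. x + ?e) ` ?L ` ?S)"
      using convex_hull_translation[of ?e "?L ` ?S"] by (simp add: add.commute)
    also have "(\<lambda>x. x + ?e) ` ?L ` ?S = range (($) Z)" by (simp add: Z_def image_image)
    finally show ?thesis
      using hull_Un[where S = convex and s = "{0}" and t = "range (($) Z)"] hull_Un_right[of convex "{0}" "range (($) Z)"] by simp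
  qed
  have "compact (convex hull (insert 0 (range (($) Z))))" by (intro finite_imp_compact_convex_hull) simp
  then have [measurable]: "convex hull (insert 0 (range (($) Z))) \<in> sets borel" by (intro borel_closed compact_imp_closed)
  have fin: "emeasure lborel (convex hull (insert 0 (range (($) Z)))) = ennreal (measure lborel (convex hull (insert 0 (range (($) Z)))))"
    using \<open>compact (convex hull (insert 0 (range (($) Z))))\<close>
    by (intro emeasure_eq_ennreal_measure) (auto dest: emeasure_compact_finite)
  \<comment> \<open>At height 1 every row of \<open>Z\<close> has entry 1 in column
    \<open>j\<close>, so the edge matrix of the cone is the one in \<open>base_det\<close>.\<close>
  have "(\<chi> i. Z $ i - 0) = (\<chi> i l. if l = j then 1 else X $ i $ l)"
    by (auto simp: vec_eq_iff Z_def axis_def)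
  then have Zdet: "measure lborel (convex hull (insert 0 (range (($) Z)))) = \<bar>base_det j X\<bar> / fact CARD('n)"
    using measure_simplex[of 0 Z] by (simp only: base_det_def)
  have "emeasure (flat_lborel (hyperplane \<eta>)) (convex hull ?S)
    = ennreal (norm \<eta> / \<bar>\<eta> $ j\<bar>) * (\<integral>\<^sup>+x. indicator (slab j) x * indicator (convex hull ?S) (proj_along j \<eta> x) \<partial>lborel)"
    by (rule emeasure_flat_lborel_hyperplane[OF j]) measurable
  also have "(\<integral>\<^sup>+x. indicator (slab j) x * indicator (convex hull ?S) (proj_along j \<eta> x) \<partial>lborel)
    = (\<integral>\<^sup>+x. indicator (slab j) x * indicator (convex hull (?L ` ?S)) (?L x) \<partial>lborel)"
    by (simp add: indicator_def mem)
  also have "\<dots> = ennreal (real CARD('n)) * emeasure lborel (convex hull (insert 0 ((\<lambda>x. x + ?e) ` (convex hull (?L ` ?S)))))"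
  proof (rule nn_integral_cone_slices)
    show "x $ j = 0" if "x \<in> convex hull (?L ` ?S)" for x
      using that unfolding Lhull[symmetric] by (auto simp: axis_def)
  qed (simp_all add: cone)
  also have "\<dots> = ennreal (real CARD('n) * (\<bar>base_det j X\<bar> / fact CARD('n)))"
    unfolding cone fin Zdet by (rule ennreal_mult[symmetric]) auto
  also have "real CARD('n) * (\<bar>base_det j X\<bar> / fact CARD('n)) = \<bar>base_det j X\<bar> / fact (CARD('n) - 1)"
    by (simp add: fact_reduce[of "CARD('n)"])
  finally show ?thesis by (simp add: measure_def enn2real_mult)
qed

text \<open>
  Base times height: replacing the \<open>j\<close>-th column of the matrix with rows \<open>X $ i - x0\<close> by its product
  with \<open>\<eta>\<close>, which is a multiple of the constant column, multiplies the determinant by \<open>\<eta> $ j\<close>.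
\<close>

lemma measure_simplex_over_hyperplane:
  fixes \<eta> :: "real^'n" and X :: "real^'n^'n"
  assumes j: "\<eta> $ j \<noteq> 0" and X: "\<And>i. X $ i \<in> hyperplane \<eta>"
  shows "measure lborel (convex hull (insert x0 (range (($) X))))
    = \<bar>\<eta> \<bullet> x0 - 1\<bar> * \<bar>base_det j X\<bar> / (\<bar>\<eta> $ j\<bar> * fact CARD('n))"
proof -
  define R where "R = (\<chi> i. X $ i - x0)"
  define X' where "X' = (\<chi> i l. if l = j then 1 else X $ i $ l)"
  have Reta: "(R *v \<eta>) $ i = 1 - \<eta> \<bullet> x0" for i
    using X[of i] by (simp add: R_def matrix_vector_mult_def hyperplane_def inner_vec_def mult.commute right_diff_distrib sum_subtractf)
  \<comment> \<open>By Cramer's rule, replacing column \<open>j\<close> of \<open>R\<close> by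
    \<open>R *v \<eta>\<close> multiplies the determinant by \<eta> $ j.\<close>
  define Y where "Y = (\<chi> i l. if l = j then (R *v \<eta>) $ i else R $ i $ l)"
  have dY: "det Y = \<eta> $ j * det R" unfolding Y_def by (rule cramer_lemma)
  \<comment> \<open>Column operations as a matrix: right multiplication by \<open>M\<close>
    subtracts x0 $ l times the constant column from each other column \<open>l\<close>, and scales
    the constant column by 1 - \<eta> \<bullet> x0.\<close>
  define M where "M = (\<chi> k l. if l = j then (if k = j then 1 - \<eta> \<bullet> x0 else 0) else (if k = j then - x0 $ l else if k = l then 1 else 0))"
  have "Y = X' ** M"
  proof -
    have "(X' ** M) $ i $ l = Y $ i $ l" for i l
    proof -
      have "(X' ** M) $ i $ l = (\<Sum>k\<in>UNIV. if k = j then M $ j $ l else if k = l then X $ i $ k * M $ k $ l else 0)"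
        unfolding matrix_matrix_mult_def by (auto simp: X'_def M_def intro!: sum.cong)
      also have "\<dots> = (\<Sum>k\<in>UNIV. (if k = j then M $ j $ l else 0) + (if k = l then (if l = j then 0 else X $ i $ k * M $ k $ l) else 0))"
        by (intro sum.cong) auto
      also have "\<dots> = Y $ i $ l"
        by (simp add: sum.distrib Y_def M_def Reta) (simp add: R_def)
      finally show ?thesis .
    qed
    then show ?thesis by (simp add: vec_eq_iff)
  qed
  moreover have "det M = 1 - \<eta> \<bullet> x0"
  proof -
    let ?u = "\<chi> l. if l = j then 1 - \<eta> \<bullet> x0 else - x0 $ l"
    have "(\<Sum>i\<in>UNIV. ?u $ i *s row i (mat 1 :: real^'n^'n)) = ?u"
    proof -
      have "(\<Sum>i\<in>UNIV. ?u $ i * (if i = l then 1 else 0)) = ?u $ l" for l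
        by (subst sum.cong[OF refl, where h="\<lambda>i. if i = l then ?u $ l else 0"]) auto
      then show ?thesis by (simp add: vec_eq_iff row_def mat_def)
    qed
    then have "M = (\<chi> i. if i = j then (\<Sum>i\<in>UNIV. ?u $ i *s row i (mat 1 :: real^'n^'n)) else row i (mat 1))"
      by (auto simp: M_def vec_eq_iff row_def mat_def)
    then show ?thesis using cramer_lemma_transpose[of j ?u "mat 1"] by simp
  qed
  ultimately have "\<eta> $ j * det R = base_det j X * (1 - \<eta> \<bullet> x0)"
    using dY by (simp add: det_mul X'_def base_det_def)
  then have "\<bar>\<eta> $ j\<bar> * \<bar>det R\<bar> = \<bar>base_det j X\<bar> * \<bar>\<eta> \<bullet> x0 - 1\<bar>"
    by (metis abs_mult abs_minus_commute)
  then show ?thesis using j unfolding measure_simplex R_def[symmetric] by (simp add: field_simps)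
qed

section \<open>Moments of sections\<close>

lemma borel_compact: "compact (K :: 'a::t2_space set) \<Longrightarrow> K \<in> sets borel"
  by (intro borel_closed compact_imp_closed)

lemma emeasure_lborel_negligible:
  assumes "negligible S" and "S \<in> sets borel"
  shows "emeasure lborel (S :: 'a::euclidean_space set) = 0"
proof -
  have "emeasure lebesgue S = 0" using assms(1) by (simp add: negligible_iff_null_sets null_sets_def)
  then show ?thesis using assms(2) by simp
qed

text \<open>The projection alters only the \<open>j\<close>-th coordinate, and the slab bounds that
  one by 1. The resulting box is the same for every \<eta>, which makes later bounds
  uniform.\<close>

lemma slab_proj_along_bound:
  assumes "K \<subseteq> {x. \<forall>l. \<bar>x $ l\<bar> \<le> R}" "1 \<le> R" "x \<in> slab j" "proj_along j \<eta> x \<in> K"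
  shows "x \<in> cbox (vec (- R)) (vec R)"
proof -
  have "\<forall>l. \<bar>proj_along j \<eta> x $ l\<bar> \<le> R" using assms(1,4) by blast
  then have "\<bar>x $ l\<bar> \<le> R" for l
    using assms(2,3) by (cases "l = j") (auto simp: slab_def, metis proj_along_nth)
  then show ?thesis by (simp add: mem_box_cart abs_le_iff) (metis minus_le_iff)
qed

lemma bounded_imp_coordinate_bound:
  fixes K :: "(real^'n) set"
  assumes "bounded K"
  obtains R where "1 \<le> R" "K \<subseteq> {x. \<forall>l. \<bar>x $ l\<bar> \<le> R}" "\<And>x. x \<in> K \<Longrightarrow> norm x \<le> R"
proof -
  obtain b where b: "\<And>x. x \<in> K \<Longrightarrow> norm x \<le> b" using assms by (auto simp: bounded_iff)
  show ?thesis
  proof (rule that[of "max 1 b"])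
    show "K \<subseteq> {x. \<forall>l. \<bar>x $ l\<bar> \<le> max 1 b}"
      using b order_trans[OF component_le_norm_cart] by (fastforce simp: le_max_iff_disj)
    show "norm x \<le> max 1 b" if "x \<in> K" for x using b[OF that] by simp
  qed simp
qed

lemma emeasure_flat_lborel_finite:
  fixes \<eta> :: "real^'n"
  assumes j: "\<eta> $ j \<noteq> 0" and [measurable]: "A \<in> sets borel" and "bounded A"
  shows "emeasure (flat_lborel (hyperplane \<eta>)) A < \<infinity>"
proof -
  obtain R where R: "1 \<le> R" "A \<subseteq> {x. \<forall>l. \<bar>x $ l\<bar> \<le> R}" by (rule bounded_imp_coordinate_bound[OF \<open>bounded A\<close>])
  have "(\<integral>\<^sup>+x. indicator (slab j) x * indicator A (proj_along j \<eta> x) \<partial>lborel)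
    \<le> (\<integral>\<^sup>+x. indicator (cbox (vec (- R)) (vec R) :: (real^'n) set) x \<partial>lborel)"
    using slab_proj_along_bound[OF R(2,1)] by (intro nn_integral_mono) (auto simp: indicator_def)
  also have "\<dots> < \<infinity>" using emeasure_compact_finite[OF compact_cbox] by simp
  finally show ?thesis
    unfolding emeasure_flat_lborel_hyperplane[OF j \<open>A \<in> sets borel\<close>] by (simp add: ennreal_mult_less_top)
qed

lemma sets_flat_lborel_hyperplane: "\<eta> $ j \<noteq> 0 \<Longrightarrow> sets (flat_lborel (hyperplane \<eta>)) = sets borel"
  for \<eta> :: "real^'n"
  by (simp add: flat_lborel_hyperplane)

lemma sigma_finite_flat_lborel:
  fixes \<eta> :: "real^'n"
  assumes j: "\<eta> $ j \<noteq> 0"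
  shows "sigma_finite_measure (flat_lborel (hyperplane \<eta>))"
proof
  let ?A = "range (\<lambda>n::nat. cball 0 (real n) :: (real^'n) set)"
  have "(\<Union>n::nat. cball 0 (real n)) = (UNIV :: (real^'n) set)"
    by (auto simp: real_arch_simple)
  moreover have "space (flat_lborel (hyperplane \<eta>)) = UNIV"
    using sets_eq_imp_space_eq[OF sets_flat_lborel_hyperplane[OF j]] by simp
  moreover have "emeasure (flat_lborel (hyperplane \<eta>)) (cball 0 r) \<noteq> \<infinity>" for r
    using emeasure_flat_lborel_finite[OF j, of "cball 0 r"] by auto
  ultimately show "\<exists>A. countable A \<and> A \<subseteq> sets (flat_lborel (hyperplane \<eta>)) \<and> \<Union> A = space (flat_lborel (hyperplane \<eta>)) \<and>
    (\<forall>a\<in>A. emeasure (flat_lborel (hyperplane \<eta>)) a \<noteq> \<infinity>)"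
    by (intro exI[of _ ?A]) (auto simp: sets_flat_lborel_hyperplane[OF j])
qed

text \<open>The pairs of \<open>X\<close> and a point of the hull of its rows form a closed set,
  being the projection of a closed set along the compact simplex of convex weights. Section measures
  of a measurable set are measurable for a sigma-finite measure, degenerate hulls included.\<close>

lemma measurable_measure_hull:
  fixes M :: "(real^'n) measure"
  assumes M: "sigma_finite_measure M" "sets M = sets borel"
  shows "(\<lambda>X :: real^'n^'n. measure M (convex hull (range (($) X)))) \<in> borel_measurable borel"
proof -
  interpret sigma_finite_measure M by fact
  let ?S = "convex hull Basis :: (real^'n) set"
  let ?T = "{(u :: real^'n, X :: real^'n^'n, y). y = (\<Sum>i\<in>UNIV. u $ i *\<^sub>R X $ i)}"
  have "compact ?S" by (intro finite_imp_compact_convex_hull) simp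
  moreover have "closed ?T"
    unfolding split_beta by (intro closed_Collect_eq continuous_intros)
  ultimately have cl: "closed {z. \<exists>u. u \<in> ?S \<and> (u, z) \<in> ?T}" by (rule closed_compact_projection)
  have hull: "convex hull (range (($) X)) = (\<lambda>u. \<Sum>i\<in>UNIV. u $ i *\<^sub>R X $ i) ` ?S" for X :: "real^'n^'n"
  proof -
    let ?L = "\<lambda>u :: real^'n. \<Sum>i\<in>UNIV. u $ i *\<^sub>R X $ i"
    have lin: "linear ?L" by (rule linearI) (simp_all add: scaleR_add_left sum.distrib scaleR_sum_right)
    have ax: "?L (axis k 1) = X $ k" for k
      by (simp add: axis_def if_distrib[of "\<lambda>c. c *\<^sub>R _"] cong: if_cong)
    have bas: "(Basis :: (real^'n) set) = range (\<lambda>i. axis i 1)" by (auto simp: Basis_vec_def)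
    have "?L ` Basis = range (($) X)" unfolding bas image_image ax ..
    then show ?thesis using convex_hull_linear_image[OF lin, of Basis] by simp
  qed
  have "{z. \<exists>u. u \<in> ?S \<and> (u, z) \<in> ?T} \<in> sets (borel \<Otimes>\<^sub>M M)"
    using borel_closed[OF cl] sets_pair_measure_cong[OF refl M(2), of "borel :: (real^'n^'n) measure"]
    by (simp only: borel_prod)
  then have "(\<lambda>X. emeasure M (Pair X -` {z. \<exists>u. u \<in> ?S \<and> (u, z) \<in> ?T})) \<in> borel_measurable borel"
    by (rule measurable_emeasure_Pair)
  moreover have "Pair X -` {z. \<exists>u. u \<in> ?S \<and> (u, z) \<in> ?T} = convex hull (range (($) X))" for X
    unfolding hull by auto
  ultimately show ?thesis unfolding measure_def by simp
qed

lemma proj_along_affine: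
  assumes "u + v = 1"
  shows "proj_along j \<eta> (u *\<^sub>R x + v *\<^sub>R y) = u *\<^sub>R proj_along j \<eta> x + v *\<^sub>R proj_along j \<eta> y"
proof -
  have "1 - \<eta> \<bullet> (u *\<^sub>R x + v *\<^sub>R y) = u * (1 - \<eta> \<bullet> x) + v * (1 - \<eta> \<bullet> y)"
    using assms by (simp add: inner_add_right algebra_simps)
  then show ?thesis
    by (simp add: proj_along_def add_divide_distrib scaleR_add_left scaleR_add_right)
qed

text \<open>\<open>volumetric_moment\<close> reads its dimension and carrier off the affine hull. If
  that were a proper part of the hyperplane, its preimage under the projection would be a proper
  affine subspace, hence null, and the section would have volume 0.\<close>

lemma affine_hull_section:
  fixes \<eta> :: "real^'n"
  assumes j: "\<eta> $ j \<noteq> 0" and K: "compact K" and pos: "section_vol K \<eta> \<noteq> 0"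
  shows "affine hull (hyperplane \<eta> \<inter> K) = hyperplane \<eta>"
proof -
  define G where "G = affine hull (hyperplane \<eta> \<inter> K)"
  have GH: "G \<subseteq> hyperplane \<eta>"
    unfolding G_def by (intro hull_minimal affine_hyperplane_set) auto
  define W where "W = {x. proj_along j \<eta> x \<in> G}"
  have aG: "affine G" by (simp add: G_def)
  then have "affine W"
    by (auto simp: affine_def W_def proj_along_affine)
  have [measurable]: "G \<in> sets borel" using aG by (intro borel_closed affine_closed)
  have [measurable]: "K \<in> sets borel" "hyperplane \<eta> \<in> sets borel"
    by (auto intro: borel_compact K borel_closed closed_hyperplane_set)
  have "hyperplane \<eta> \<subseteq> G"
  proof (rule ccontr)
    assume "\<not> hyperplane \<eta> \<subseteq> G"
    then obtain x where x: "x \<in> hyperplane \<eta>" "x \<notin> G" by blast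
    then have "x \<notin> W" by (simp add: W_def proj_along_hyperplane)
    then have "W \<noteq> UNIV" by blast
    then have "interior W = {}"
      using affine_hull_nonempty_interior[of W] \<open>affine W\<close> by (metis affine_hull_eq)
    then have "negligible W" using \<open>affine W\<close> by (simp add: negligible_convex_interior affine_imp_convex)
    then have "emeasure lborel W = 0"
      using \<open>affine W\<close> by (intro emeasure_lborel_negligible borel_closed affine_closed)
    then have W: "AE x in lborel. x \<notin> W"
      using \<open>affine W\<close> by (intro AE_not_in) (auto simp: null_sets_def intro!: borel_closed affine_closed)
    have "(\<integral>\<^sup>+x. indicator (slab j) x * indicator (hyperplane \<eta> \<inter> K) (proj_along j \<eta> x) \<partial>lborel)
      = (\<integral>\<^sup>+x. 0 \<partial>(lborel :: (real^'n) measure))"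
    proof (rule nn_integral_cong_AE, use W in eventually_elim)
      fix x assume "x \<notin> W"
      then have "proj_along j \<eta> x \<notin> hyperplane \<eta> \<inter> K"
        unfolding W_def G_def using hull_subset[of "hyperplane \<eta> \<inter> K" affine] by blast
      then show "indicator (slab j) x * indicator (hyperplane \<eta> \<inter> K) (proj_along j \<eta> x) = (0::ennreal)" by simp
    qed
    then have "section_vol K \<eta> = 0"
      by (simp add: section_vol_def measure_def emeasure_flat_lborel_hyperplane[OF j])
    with pos show False by simp
  qed
  with GH show ?thesis by (simp add: G_def)
qed

text \<open>Up to factors depending on \<eta>, the moment of order \<open>q\<close> of the volume of
  a simplex with d random vertices in the section, computed in the coordinates of the
  projection.\<close>

definition simplex_integral :: "'n \<Rightarrow> real \<Rightarrow> (real^'n) set \<Rightarrow> real^'n \<Rightarrow> ennreal" where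
  "simplex_integral j q K \<eta> =
    (\<integral>\<^sup>+X. (\<Prod>i\<in>UNIV. indicator (slab j) (X $ i) * indicator K (proj_along j \<eta> (X $ i))) *
      ennreal (\<bar>base_det j X\<bar> powr q) \<partial>lborel)"

text \<open>The value of \<open>iota\<close> in \<open>ennreal\<close>, available for Fubini before
  finiteness is known.\<close>

definition distance_integral :: "real \<Rightarrow> (real^'n) set \<Rightarrow> real^'n \<Rightarrow> ennreal" where
  "distance_integral k K \<eta> = (\<integral>\<^sup>+x. indicator K x * ennreal (\<bar>\<eta> \<bullet> x - 1\<bar> powr k) \<partial>lborel)"

lemma simplex_integral_measurable [measurable]:
  assumes [measurable]: "K \<in> sets borel"
  shows "simplex_integral j q K \<in> borel_measurable borel"
  unfolding simplex_integral_def by measurable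

lemma distance_integral_measurable [measurable]:
  assumes [measurable]: "K \<in> sets borel"
  shows "distance_integral k K \<in> borel_measurable borel"
  unfolding distance_integral_def by measurable

text \<open>A divergent integral counts as 0 both for the Bochner integral and under
  \<open>enn2real\<close>, so the two sides agree in every case.\<close>

lemma iota_eq_distance_integral:
  assumes [measurable]: "K \<in> sets borel"
  shows "iota k K \<eta> = enn2real (distance_integral k K \<eta>)"
proof -
  have "iota k K \<eta> = enn2real (\<integral>\<^sup>+x. ennreal (indicator K x *\<^sub>R (\<bar>\<eta> \<bullet> x - 1\<bar> powr k)) \<partial>lborel)"
    unfolding iota_def set_lebesgue_integral_def by (intro integral_eq_nn_integral) auto
  also have "(\<integral>\<^sup>+x. ennreal (indicator K x *\<^sub>R (\<bar>\<eta> \<bullet> x - 1\<bar> powr k)) \<partial>lborel) = distance_integral k K \<eta>"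
    unfolding distance_integral_def by (intro nn_integral_cong) (simp add: indicator_def)
  finally show ?thesis .
qed

text \<open>The indicator factors alone integrate to a power of the given null integral, so almost
  every integrand value is already 0. This matches the convention for sections of volume 0.\<close>

lemma simplex_integral_eq_0:
  fixes \<eta> :: "real^'n"
  assumes [measurable]: "K \<in> sets borel"
    and z: "(\<integral>\<^sup>+x. indicator (slab j) x * indicator K (proj_along j \<eta> x) \<partial>lborel) = 0"
  shows "simplex_integral j q K \<eta> = 0"
proof -
  obtain e where e: "bij_betw e (UNIV :: 'n set) {..<CARD('n)}" by (rule ex_bij_betw_UNIV_lessThan)
  let ?\<phi> = "\<lambda>x. indicator (slab j) x * indicator K (proj_along j \<eta> x) :: ennreal"
  interpret product_sigma_finite "\<lambda>_::nat. lborel :: (real^'n) measure"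
    by (simp add: product_sigma_finite_def sigma_finite_lborel)
  have "(\<integral>\<^sup>+X. (\<Prod>i\<in>UNIV. ?\<phi> (X $ i)) \<partial>(lborel :: (real^'n^'n) measure))
    = (\<integral>\<^sup>+X. (\<Prod>i\<in>UNIV. ?\<phi> (X (e i))) \<partial>PiM {..<CARD('n)} (\<lambda>_. lborel))"
    using nn_integral_PiM_vec[OF e, of "\<lambda>X. \<Prod>i\<in>UNIV. ?\<phi> (X $ i)"] by simp
  also have "\<dots> = (\<integral>\<^sup>+X. (\<Prod>k<CARD('n). ?\<phi> (X k)) \<partial>PiM {..<CARD('n)} (\<lambda>_. lborel))"
    by (intro nn_integral_cong prod.reindex_bij_betw[OF e])
  also have "\<dots> = 0"
    by (subst product_nn_integral_prod) (auto simp: z lessThan_empty_iff)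
  finally have "AE X in lborel. (\<Prod>i\<in>UNIV. ?\<phi> ((X :: real^'n^'n) $ i)) = 0"
    by (subst (asm) nn_integral_0_iff_AE) auto
  then have "simplex_integral j q K \<eta> = (\<integral>\<^sup>+X. 0 \<partial>(lborel :: (real^'n^'n) measure))"
    unfolding simplex_integral_def by (intro nn_integral_cong_AE, eventually_elim) simp
  then show ?thesis by simp
qed

text \<open>With c = norm \<eta> / \<bar>\<eta> $ j\<bar> and s the section volume, a uniform point
  of the section is the projection of a point with density c / s on the part of the slab above the
  section. The d vertices give (c / s)^d, and the simplex volume c * \<bar>base_det\<bar> / (d - 1)!
  gives the factor with power \<open>q\<close>.\<close>

proposition volumetric_moment_section:
  fixes \<eta> :: "real^'n"
  assumes j: "\<eta> $ j \<noteq> 0" and K: "compact K" and pos: "section_vol K \<eta> \<noteq> 0"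
  shows "volumetric_moment q (hyperplane \<eta> \<inter> K) =
    (norm \<eta> / \<bar>\<eta> $ j\<bar> / section_vol K \<eta>) ^ CARD('n) * (norm \<eta> / \<bar>\<eta> $ j\<bar> / fact (CARD('n) - 1)) powr q
    * enn2real (simplex_integral j q K \<eta>) / section_vol K \<eta> powr q"
proof -
  let ?H = "hyperplane \<eta>"
  let ?M = "flat_lborel ?H"
  define c where "c = norm \<eta> / \<bar>\<eta> $ j\<bar>"
  define s where "s = section_vol K \<eta>"
  have nz: "\<eta> \<noteq> 0" using j by (rule nonzero_nth)
  have c: "c > 0" using j nz by (simp add: c_def)
  have s: "s > 0" using pos by (simp add: s_def section_vol_def zero_less_measure_iff)
  have sets_M[measurable_cong]: "sets ?M = sets borel" by (rule sets_flat_lborel_hyperplane[OF j])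
  have [measurable]: "K \<in> sets borel" "?H \<in> sets borel"
    by (auto intro: borel_compact K borel_closed closed_hyperplane_set)
  have fin: "emeasure ?M (?H \<inter> K) < \<infinity>"
    using K by (intro emeasure_flat_lborel_finite[OF j]) (auto intro: compact_imp_bounded bounded_subset)
  then have es: "emeasure ?M (?H \<inter> K) = ennreal s"
    by (simp add: s_def section_vol_def emeasure_eq_ennreal_measure)
  obtain m where d: "CARD('n) = Suc m" by (metis not0_implies_Suc zero_less_card_finite less_numeral_extra(3))
  have hull: "affine hull (?H \<inter> K) = ?H" by (rule affine_hull_section[OF j K pos])
  have dim: "nat (aff_dim (?H \<inter> K)) = m"
    using nat_aff_dim_hyperplane[OF nz] d hull by (metis aff_dim_affine_hull diff_Suc_1)
  \<comment> \<open>The section has dimension \<open>m\<close>, so its simplices have m + 1 = d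
    vertices, as many as a matrix has rows.\<close>
  have atm: "{..m} = {..<CARD('n)}" by (auto simp: d)
  obtain e where e: "bij_betw e (UNIV :: 'n set) {..<CARD('n)}" by (rule ex_bij_betw_UNIV_lessThan)
  have eJ[simp]: "e i < CARD('n)" for i using e by (auto simp: bij_betw_def)
  have eim: "X ` {..<CARD('n)} = range (\<lambda>i. X (e i))" for X :: "nat \<Rightarrow> real^'n"
    using e by (auto simp: bij_betw_def image_image[symmetric])
  define U where "U = uniform_measure ?M (?H \<inter> K)"
  define \<phi> where "\<phi> x = (indicator (slab j) x * indicator K (proj_along j \<eta> x) :: ennreal)" for x
  have [measurable]: "\<phi> \<in> borel_measurable borel" unfolding \<phi>_def by measurable
  have prob: "prob_space U"
    unfolding U_def using es s by (intro prob_space_uniform_measure) auto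
  have U: "U = distr (density lborel (\<lambda>x. ennreal (c / s) * \<phi> x)) borel (proj_along j \<eta>)"
  proof (rule measure_eqI)
    fix A assume "A \<in> sets U"
    then have A[measurable]: "A \<in> sets borel" by (simp add: U_def sets_M)
    have "emeasure U A = emeasure ?M (?H \<inter> K \<inter> A) / ennreal s"
      unfolding U_def by (subst emeasure_uniform_measure) (auto simp: sets_M es)
    also have "emeasure ?M (?H \<inter> K \<inter> A) = ennreal c * (\<integral>\<^sup>+x. indicator (slab j) x * indicator (?H \<inter> K \<inter> A) (proj_along j \<eta> x) \<partial>lborel)"
      unfolding c_def by (rule emeasure_flat_lborel_hyperplane[OF j]) measurable
    also have "(\<integral>\<^sup>+x. indicator (slab j) x * indicator (?H \<inter> K \<inter> A) (proj_along j \<eta> x) \<partial>lborel)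
       = (\<integral>\<^sup>+x. \<phi> x * indicator A (proj_along j \<eta> x) \<partial>lborel)"
      by (intro nn_integral_cong) (auto simp: \<phi>_def indicator_def proj_along_in_hyperplane[OF j])
    also have "ennreal c * \<dots> / ennreal s = ennreal (c / s) * (\<integral>\<^sup>+x. \<phi> x * indicator A (proj_along j \<eta> x) \<partial>lborel)"
      using c s by (simp add: divide_ennreal_def inverse_ennreal divide_inverse ennreal_mult ac_simps)
    also have "\<dots> = (\<integral>\<^sup>+x. ennreal (c / s) * \<phi> x * indicator A (proj_along j \<eta> x) \<partial>lborel)"
      by (subst nn_integral_cmult[symmetric]) (auto simp: mult.assoc)
    also have "\<dots> = (\<integral>\<^sup>+x. indicator A x \<partial>distr (density lborel (\<lambda>x. ennreal (c / s) * \<phi> x)) borel (proj_along j \<eta>))"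
      by (subst nn_integral_distr, measurable, subst nn_integral_density) auto
    also have "\<dots> = emeasure (distr (density lborel (\<lambda>x. ennreal (c / s) * \<phi> x)) borel (proj_along j \<eta>)) A"
      using A by simp
    finally show "emeasure U A = emeasure (distr (density lborel (\<lambda>x. ennreal (c / s) * \<phi> x)) borel (proj_along j \<eta>)) A" .
  qed (simp add: U_def sets_M)
  define P where "P = PiM {..<CARD('n)} (\<lambda>_. U)"
  have P: "P = distr (density (PiM {..<CARD('n)} (\<lambda>_. lborel)) (\<lambda>X. \<Prod>i<CARD('n). ennreal (c / s) * \<phi> (X i)))
      (PiM {..<CARD('n)} (\<lambda>_. borel)) (\<lambda>X. \<lambda>i\<in>{..<CARD('n)}. proj_along j \<eta> (X i))"
    unfolding P_def by (rule PiM_distr_density[OF _ _ _ _ U]) (auto intro: sigma_finite_lborel prob_space_imp_sigma_finite prob)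
  define g where "g = (\<lambda>X :: nat \<Rightarrow> real^'n. measure ?M (convex hull (X ` {..<CARD('n)})) powr q)"
  have vecm: "(\<lambda>X :: nat \<Rightarrow> real^'n. \<chi> i. X (e i)) \<in> measurable (PiM {..<CARD('n)} (\<lambda>_. borel)) borel"
    by (intro measurable_vec_lambda) measurable
  have "(\<lambda>X. measure ?M (convex hull (range (($) ((\<chi> i. X (e i)) :: real^'n^'n)))) powr q) \<in> borel_measurable (PiM {..<CARD('n)} (\<lambda>_. borel))"
    using measurable_compose[OF vecm measurable_measure_hull[OF sigma_finite_flat_lborel[OF j] sets_M]] by measurable
  then have g[measurable]: "g \<in> borel_measurable (PiM {..<CARD('n)} (\<lambda>_. borel))"
    unfolding g_def eim by simp
  have gP: "g \<in> borel_measurable P"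
    unfolding P using g by simp
  have gproj: "g (\<lambda>i\<in>{..<CARD('n)}. proj_along j \<eta> (X i)) = (c / fact (CARD('n) - 1) * \<bar>base_det j (\<chi> i. X (e i))\<bar>) powr q" for X
  proof -
    let ?X = "(\<chi> i. proj_along j \<eta> ((\<chi> i. X (e i)) $ i)) :: real^'n^'n"
    have "(\<lambda>i\<in>{..<CARD('n)}. proj_along j \<eta> (X i)) ` {..<CARD('n)} = range (($) ?X)"
      unfolding eim by simp
    then show ?thesis
      using measure_flat_simplex[OF j, of ?X] proj_along_in_hyperplane[OF j] base_det_proj_along[of j \<eta> "\<chi> i. X (e i)"]
      unfolding g_def by (simp add: c_def)
  qed
  have "(\<integral>\<^sup>+X. ennreal (g X) \<partial>P) = (\<integral>\<^sup>+X. (\<Prod>i<CARD('n). ennreal (c / s) * \<phi> (X i)) *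
      ennreal ((c / fact (CARD('n) - 1) * \<bar>base_det j (\<chi> i. X (e i))\<bar>) powr q) \<partial>PiM {..<CARD('n)} (\<lambda>_. lborel))"
    unfolding P
    by (subst nn_integral_distr, measurable, subst nn_integral_density)
      (auto simp: gproj simp del: prod.distrib intro!: borel_measurable_prod)
  also have "\<dots> = (\<integral>\<^sup>+X. ennreal ((c / s) ^ CARD('n) * (c / fact (CARD('n) - 1)) powr q) *
      ((\<Prod>i\<in>UNIV. \<phi> ((\<chi> i. X (e i)) $ i)) * ennreal (\<bar>base_det j (\<chi> i. X (e i))\<bar> powr q)) \<partial>PiM {..<CARD('n)} (\<lambda>_. lborel))"
  proof (rule nn_integral_cong)
    fix X :: "nat \<Rightarrow> real^'n"
    have "(\<Prod>i<CARD('n). ennreal (c / s) * \<phi> (X i)) = ennreal ((c / s) ^ CARD('n)) * (\<Prod>i\<in>UNIV. \<phi> (X (e i)))"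
      using c s by (simp add: prod.distrib ennreal_power prod.reindex_bij_betw[OF e, of "\<lambda>i. \<phi> (X i)"])
    moreover have "(c / fact (CARD('n) - 1) * \<bar>base_det j (\<chi> i. X (e i))\<bar>) powr q
       = (c / fact (CARD('n) - 1)) powr q * \<bar>base_det j (\<chi> i. X (e i))\<bar> powr q"
      by (rule powr_mult)
    ultimately show "(\<Prod>i<CARD('n). ennreal (c / s) * \<phi> (X i)) *
      ennreal ((c / fact (CARD('n) - 1) * \<bar>base_det j (\<chi> i. X (e i))\<bar>) powr q)
      = ennreal ((c / s) ^ CARD('n) * (c / fact (CARD('n) - 1)) powr q) *
      ((\<Prod>i\<in>UNIV. \<phi> ((\<chi> i. X (e i)) $ i)) * ennreal (\<bar>base_det j (\<chi> i. X (e i))\<bar> powr q))"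
      using c s by (simp add: ennreal_mult ac_simps)
  qed
  also have "\<dots> = (\<integral>\<^sup>+X. ennreal ((c / s) ^ CARD('n) * (c / fact (CARD('n) - 1)) powr q) *
      ((\<Prod>i\<in>UNIV. \<phi> (X $ i)) * ennreal (\<bar>base_det j X\<bar> powr q)) \<partial>lborel)"
    by (rule nn_integral_PiM_vec[OF e, of "\<lambda>X. ennreal ((c / s) ^ CARD('n) * (c / fact (CARD('n) - 1)) powr q) *
      ((\<Prod>i\<in>UNIV. \<phi> (X $ i)) * ennreal (\<bar>base_det j X\<bar> powr q))"]) measurable
  also have "\<dots> = ennreal ((c / s) ^ CARD('n) * (c / fact (CARD('n) - 1)) powr q) * simplex_integral j q K \<eta>"
    unfolding simplex_integral_def \<phi>_def by (rule nn_integral_cmult) measurable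
  finally have nn: "(\<integral>\<^sup>+X. ennreal (g X) \<partial>P) = ennreal ((c / s) ^ CARD('n) * (c / fact (CARD('n) - 1)) powr q) * simplex_integral j q K \<eta>" .
  have "(\<integral>X. g X \<partial>P) = enn2real (\<integral>\<^sup>+X. ennreal (g X) \<partial>P)"
    by (rule integral_eq_nn_integral[OF gP]) (simp add: g_def)
  also have "\<dots> = (c / s) ^ CARD('n) * (c / fact (CARD('n) - 1)) powr q * enn2real (simplex_integral j q K \<eta>)"
    unfolding nn using c s by (simp add: enn2real_mult)
  finally have "(\<integral>X. g X \<partial>P) = (c / s) ^ CARD('n) * (c / fact (CARD('n) - 1)) powr q * enn2real (simplex_integral j q K \<eta>)" .
  then show ?thesis
    unfolding volumetric_moment_def Let_def hull dim atm P_def U_def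
    by (simp add: c_def s_def section_vol_def g_def)
qed

section \<open>Decomposition of the integral over simplices\<close>

text \<open>The moment contributes norm \<eta> divided by the section volume to the power d + k + 1,
  which is exactly what the power of \<open>zeta\<close> cancels. What remains is visibly measurable
  in \<eta>.\<close>

lemma section_integrand_eq:
  fixes \<eta> :: "real^'n" and k :: real
  assumes j: "\<eta> $ j \<noteq> 0" and K: "compact K" and V: "measure lborel K > 0"
  shows "section_integrand k K \<eta> =
    (1 / (\<bar>\<eta> $ j\<bar> * measure lborel K)) powr (real CARD('n) + k + 1) / fact (CARD('n) - 1) powr (k + 1)
    * enn2real (simplex_integral j (k + 1) K \<eta>) * enn2real (distance_integral k K \<eta>)"
proof -
  define s where "s = section_vol K \<eta>"
  have nz: "\<eta> \<noteq> 0" using j by (rule nonzero_nth)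
  have [measurable]: "K \<in> sets borel" "hyperplane \<eta> \<in> sets borel"
    by (auto intro: borel_compact K borel_closed closed_hyperplane_set)
  have fin: "emeasure (flat_lborel (hyperplane \<eta>)) (hyperplane \<eta> \<inter> K) < \<infinity>"
    using K by (intro emeasure_flat_lborel_finite[OF j]) (auto intro: compact_imp_bounded bounded_subset)
  show ?thesis
  proof (cases "s = 0")
    \<comment> \<open>The left side is 0 by convention; the right side is 0 because the simplex
      integral vanishes with the section volume.\<close>
    case True
    then have "emeasure (flat_lborel (hyperplane \<eta>)) (hyperplane \<eta> \<inter> K) = 0"
      using fin by (simp add: s_def section_vol_def emeasure_eq_ennreal_measure)
    then have "(\<integral>\<^sup>+x. indicator (slab j) x * indicator (hyperplane \<eta> \<inter> K) (proj_along j \<eta> x) \<partial>lborel) = 0"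
      using j nz by (simp add: emeasure_flat_lborel_hyperplane[OF j])
    then have "simplex_integral j (k + 1) K \<eta> = 0"
      by (intro simplex_integral_eq_0) (simp_all add: indicator_def proj_along_in_hyperplane[OF j])
    then show ?thesis using True by (simp add: section_integrand_def s_def)
  next
    case False
    define a where "a = \<bar>\<eta> $ j\<bar>"
    define n where "n = norm \<eta>"
    define v where "v = measure lborel K"
    define F where "F = (fact (CARD('n) - 1) :: real)"
    define p where "p = k + 1"
    define d where "d = CARD('n)"
    have pos: "a > 0" "n > 0" "v > 0" "s > 0" "F > 0"
      using j nz V False by (auto simp: a_def n_def v_def s_def F_def section_vol_def zero_less_measure_iff)
    have "section_integrand k K \<eta> = volumetric_moment p (hyperplane \<eta> \<inter> K) * (s / (n * v)) powr (real d + p) * iota k K \<eta>"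
      using False by (simp add: section_integrand_def s_def zeta_def n_def v_def d_def p_def add.assoc)
    also have "volumetric_moment p (hyperplane \<eta> \<inter> K)
      = (n / a / s) ^ d * (n / a / F) powr p * enn2real (simplex_integral j p K \<eta>) / s powr p"
      using volumetric_moment_section[OF j K, of p] False by (simp add: n_def a_def s_def d_def F_def)
    also have "\<dots> * (s / (n * v)) powr (real d + p)
      = ((n / a / s) ^ d * (n / a / F) powr p / s powr p * (s / (n * v)) powr (real d + p)) * enn2real (simplex_integral j p K \<eta>)"
      by simp
    also have "(n / a / s) ^ d * (n / a / F) powr p / s powr p * (s / (n * v)) powr (real d + p)
      = (1 / (a * v)) powr (real d + p) / F powr p"
    proof -
      have eq: "(n / a / F) powr p / s powr p = (n / a / s) powr p / F powr p"
        using pos by (simp add: powr_divide powr_mult field_simps)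
      have "(n / a / s) ^ d * (n / a / F) powr p / s powr p = (n / a / s) ^ d * ((n / a / F) powr p / s powr p)"
        by simp
      also have "\<dots> = (n / a / s) powr (real d + p) / F powr p"
        unfolding eq using pos by (simp add: powr_add powr_realpow)
      finally have "(n / a / s) ^ d * (n / a / F) powr p / s powr p = (n / a / s) powr (real d + p) / F powr p" .
      moreover have "(n / a / s) powr (real d + p) * (s / (n * v)) powr (real d + p) = (1 / (a * v)) powr (real d + p)"
        using pos by (subst powr_mult[symmetric]) (auto simp: field_simps)
      ultimately show ?thesis by simp
    qed
    finally show ?thesis
      by (simp add: iota_eq_distance_integral a_def v_def F_def p_def d_def add.assoc)
  qed
qed

text \<open>Absorbs the Jacobian \<open>base_det\<close> into the power of the base volume: this is
  why order \<open>k\<close> for the body becomes order \<open>k + 1\<close> for its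
  sections.\<close>

lemma abs_mult_powr: "\<bar>x\<bar> * \<bar>x\<bar> powr k = \<bar>x\<bar> powr (k + 1)" for x k :: real
  by (cases "x = 0") (simp_all add: powr_add)

text \<open>For fixed \<open>y\<close>, decompose the integral over \<open>X\<close> by the
  hyperplane through its rows. The volume is a product of a distance depending on \<open>y\<close>
  and a base depending on \<open>X\<close>, so integrating over \<open>y\<close> as well gives a
  product for each \<eta>.\<close>

lemma simplex_integrals_hyperplanes:
  fixes K :: "(real^'n) set"
  assumes [measurable]: "K \<in> sets borel"
  shows "(\<integral>\<^sup>+y. (\<integral>\<^sup>+X. indicator K y * (\<Prod>i\<in>UNIV. indicator K (X $ i)) *
      ennreal (measure lborel (convex hull (insert y (range (($) X)))) powr k) \<partial>(lborel :: (real^'n^'n) measure)) \<partial>lborel)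
    = (\<integral>\<^sup>+\<eta>. ennreal (1 / \<bar>\<eta> $ j\<bar> ^ (CARD('n) + 1) * (1 / (\<bar>\<eta> $ j\<bar> * fact CARD('n))) powr k) *
      (distance_integral k K \<eta> * simplex_integral j (k + 1) K \<eta>) \<partial>lborel)"
proof -
  let ?S = "{X :: real^'n^'n. \<forall>i. X $ i \<in> slab j}"
  have [measurable]: "?S \<in> sets borel" by measurable
  let ?h = "\<lambda>y (X :: real^'n^'n). ennreal ((\<bar>det (\<chi> i. X $ i - y)\<bar> / fact CARD('n)) powr k)"
  let ?w = "\<lambda>\<eta> :: real^'n. ennreal (1 / \<bar>\<eta> $ j\<bar> ^ (CARD('n) + 1))"
  let ?c = "\<lambda>\<eta> :: real^'n. ennreal ((1 / (\<bar>\<eta> $ j\<bar> * fact CARD('n))) powr k)"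
  let ?A = "\<lambda>\<eta> y. indicator K y * ennreal (\<bar>\<eta> \<bullet> y - 1\<bar> powr k)"
  let ?B = "\<lambda>\<eta> X. (\<Prod>i\<in>UNIV. indicator (slab j) (X $ i) * indicator K (proj_along j \<eta> (X $ i))) * ennreal (\<bar>base_det j X\<bar> powr (k + 1))"
  have "(\<integral>\<^sup>+X. indicator K y * (\<Prod>i\<in>UNIV. indicator K (X $ i)) *
      ennreal (measure lborel (convex hull (insert y (range (($) X)))) powr k) \<partial>(lborel :: (real^'n^'n) measure))
    = (\<integral>\<^sup>+\<eta>. ?w \<eta> * (\<integral>\<^sup>+X. ?c \<eta> * (?A \<eta> y * ?B \<eta> X) \<partial>lborel) \<partial>lborel)" for y :: "real^'n"
  proof -
    have "(\<integral>\<^sup>+X. indicator K y * (\<Prod>i\<in>UNIV. indicator K (X $ i)) *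
      ennreal (measure lborel (convex hull (insert y (range (($) X)))) powr k) \<partial>(lborel :: (real^'n^'n) measure))
      = (\<integral>\<^sup>+X. indicator K y * (\<Prod>i\<in>UNIV. indicator K (X $ i)) * ?h y X \<partial>lborel)"
      by (simp only: measure_simplex)
    also have "\<dots> = (\<integral>\<^sup>+\<eta>. ?w \<eta> * (\<integral>\<^sup>+X. indicator ?S X * (ennreal \<bar>base_det j X\<bar> *
       (indicator K y * (\<Prod>i\<in>UNIV. indicator K ((\<chi> i. proj_along j \<eta> (X $ i)) $ i)) * ?h y (\<chi> i. proj_along j \<eta> (X $ i)))) \<partial>lborel) \<partial>lborel)"
      by (rule nn_integral_hyperplanes) measurable
    also have "\<dots> = (\<integral>\<^sup>+\<eta>. ?w \<eta> * (\<integral>\<^sup>+X. ?c \<eta> * (?A \<eta> y * ?B \<eta> X) \<partial>lborel) \<partial>lborel)"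
    proof (rule nn_integral_cong)
      fix \<eta> :: "real^'n"
      show "?w \<eta> * (\<integral>\<^sup>+X. indicator ?S X * (ennreal \<bar>base_det j X\<bar> *
       (indicator K y * (\<Prod>i\<in>UNIV. indicator K ((\<chi> i. proj_along j \<eta> (X $ i)) $ i)) * ?h y (\<chi> i. proj_along j \<eta> (X $ i)))) \<partial>lborel)
        = ?w \<eta> * (\<integral>\<^sup>+X. ?c \<eta> * (?A \<eta> y * ?B \<eta> X) \<partial>lborel)"
      proof (cases "\<eta> $ j = 0")
        case False
        have "indicator ?S X * (ennreal \<bar>base_det j X\<bar> *
          (indicator K y * (\<Prod>i\<in>UNIV. indicator K ((\<chi> i. proj_along j \<eta> (X $ i)) $ i)) * ?h y (\<chi> i. proj_along j \<eta> (X $ i))))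
          = ?c \<eta> * (?A \<eta> y * ?B \<eta> X)" for X
        proof -
          have "\<bar>det (\<chi> i. (\<chi> i. proj_along j \<eta> (X $ i)) $ i - y)\<bar> / fact CARD('n)
            = \<bar>\<eta> \<bullet> y - 1\<bar> * \<bar>base_det j X\<bar> * (1 / (\<bar>\<eta> $ j\<bar> * fact CARD('n)))"
            using measure_simplex_over_hyperplane[OF False, of "\<chi> i. proj_along j \<eta> (X $ i)" y] proj_along_in_hyperplane[OF False]
            unfolding measure_simplex base_det_proj_along by simp
          then have hh: "?h y (\<chi> i. proj_along j \<eta> (X $ i))
            = ?c \<eta> * ennreal (\<bar>\<eta> \<bullet> y - 1\<bar> powr k) * ennreal (\<bar>base_det j X\<bar> powr k)"
            by (simp only: powr_mult) (simp add: ennreal_mult ac_simps)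
          have bb: "ennreal \<bar>base_det j X\<bar> * ennreal (\<bar>base_det j X\<bar> powr k) = ennreal (\<bar>base_det j X\<bar> powr (k + 1))"
            by (simp add: ennreal_mult[symmetric] abs_mult_powr)
          have ss: "indicator ?S X = (\<Prod>i\<in>UNIV. indicator (slab j) (X $ i) :: ennreal)"
            by (auto simp: indicator_def prod_zero_iff intro!: prod.neutral[symmetric])
          show ?thesis
            unfolding hh ss bb[symmetric] prod.distrib by (simp add: ac_simps)
        qed
        then show ?thesis by simp
      qed simp
    qed
    finally show ?thesis .
  qed
  then have "(\<integral>\<^sup>+y. (\<integral>\<^sup>+X. indicator K y * (\<Prod>i\<in>UNIV. indicator K (X $ i)) *
      ennreal (measure lborel (convex hull (insert y (range (($) X)))) powr k) \<partial>(lborel :: (real^'n^'n) measure)) \<partial>lborel)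
    = (\<integral>\<^sup>+y. (\<integral>\<^sup>+\<eta>. ?w \<eta> * (\<integral>\<^sup>+X. ?c \<eta> * (?A \<eta> y * ?B \<eta> X) \<partial>lborel) \<partial>lborel) \<partial>lborel)"
    by simp
  also have "\<dots> = (\<integral>\<^sup>+y. (\<integral>\<^sup>+\<eta>. ?w \<eta> * (?c \<eta> * (?A \<eta> y * simplex_integral j (k + 1) K \<eta>)) \<partial>lborel) \<partial>lborel)"
    unfolding simplex_integral_def by (intro nn_integral_cong arg_cong2[where f="(*)"] refl) (simp add: nn_integral_cmult)
  also have "\<dots> = (\<integral>\<^sup>+\<eta>. (\<integral>\<^sup>+y. ?w \<eta> * (?c \<eta> * (?A \<eta> y * simplex_integral j (k + 1) K \<eta>)) \<partial>lborel) \<partial>lborel)"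
    by (rule lborel_pair.Fubini') measurable
  also have "\<dots> = (\<integral>\<^sup>+\<eta>. ?w \<eta> * (?c \<eta> * (distance_integral k K \<eta> * simplex_integral j (k + 1) K \<eta>)) \<partial>lborel)"
    unfolding distance_integral_def by (intro nn_integral_cong) (simp add: nn_integral_cmult nn_integral_multc)
  also have "\<dots> = (\<integral>\<^sup>+\<eta>. ennreal (1 / \<bar>\<eta> $ j\<bar> ^ (CARD('n) + 1) * (1 / (\<bar>\<eta> $ j\<bar> * fact CARD('n))) powr k) *
      (distance_integral k K \<eta> * simplex_integral j (k + 1) K \<eta>) \<partial>lborel)"
    by (intro nn_integral_cong, subst ennreal_mult) (auto simp: mult.assoc)
  finally show ?thesis .
qed

text \<open>The vertex with the last index becomes \<open>y\<close>, the others become the rows of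
  \<open>X\<close>. The d + 1 uniform densities and the normalisation of the moment together give
  the exponent d + k + 1 of the volume.\<close>

proposition volumetric_moment_full:
  fixes K :: "(real^'n) set"
  assumes K: "compact K" and V: "measure lborel K > 0" and ad: "aff_dim K = int CARD('n)"
  shows "volumetric_moment k K = enn2real (\<integral>\<^sup>+y. (\<integral>\<^sup>+X. indicator K y * (\<Prod>i\<in>UNIV. indicator K (X $ i)) *
      ennreal (measure lborel (convex hull (insert y (range (($) X)))) powr k) \<partial>(lborel :: (real^'n^'n) measure)) \<partial>lborel)
    / measure lborel K powr (real CARD('n) + k + 1)"
proof -
  define v where "v = measure lborel K"
  let ?d = "CARD('n)"
  have v: "v > 0" using V by (simp add: v_def)
  have [measurable]: "K \<in> sets borel" by (rule borel_compact[OF K])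
  have ev: "emeasure lborel K = ennreal v"
    using emeasure_compact_finite[OF K] by (simp add: v_def emeasure_eq_ennreal_measure)
  have hull: "affine hull K = UNIV"
    using ad aff_dim_eq_full[of K] by simp
  define U where "U = uniform_measure lborel K"
  have prob: "prob_space U"
    unfolding U_def using ev v by (intro prob_space_uniform_measure) auto
  let ?w = "\<lambda>x. ennreal (1 / v) * indicator K x"
  \<comment> \<open>The case of the identity map, which brings \<open>U\<close> into the form
    required by \<open>PiM_distr_density\<close>.\<close>
  have U: "U = distr (density lborel ?w) borel (\<lambda>x. x)"
  proof -
    have "distr (density lborel ?w) borel (\<lambda>x. x) = density lborel ?w"
      by (rule distr_id2) simp
    also have "\<dots> = U"
      unfolding U_def uniform_measure_def ev using v
      by (intro density_cong) (auto simp: indicator_def divide_ennreal[of 1, simplified])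
    finally show ?thesis ..
  qed
  obtain e where e: "bij_betw e (UNIV :: 'n set) {..<?d}" by (rule ex_bij_betw_UNIV_lessThan)
  have eJ[simp]: "e i < ?d" for i using e by (auto simp: bij_betw_def)
  have eJ'[simp]: "e i \<le> ?d" for i using eJ by (rule less_imp_le)
  have atm: "{..?d} = insert ?d {..<?d}" by auto
  have eim: "X ` {..?d} = insert (X ?d) (range (($) (\<chi> i. X (e i))))" for X :: "nat \<Rightarrow> real^'n"
    using e unfolding atm by (auto simp: bij_betw_def image_image[symmetric])
  have c1: "ennreal (1 / v) * ennreal ((1 / v) ^ ?d) = ennreal ((1 / v) ^ (?d + 1))"
    using v by (subst ennreal_mult[symmetric]) auto
  define P where "P = PiM {..?d} (\<lambda>_. U)"
  have P: "P = distr (density (PiM {..?d} (\<lambda>_. lborel)) (\<lambda>X. \<Prod>i\<le>?d. ?w (X i)))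
      (PiM {..?d} (\<lambda>_. borel)) (\<lambda>X. \<lambda>i\<in>{..?d}. X i)"
    unfolding P_def by (rule PiM_distr_density[OF _ _ _ _ U]) (auto intro: sigma_finite_lborel prob_space_imp_sigma_finite prob)
  define h where "h y X = (\<bar>det (\<chi> i. X $ i - y)\<bar> / fact ?d) powr k" for y :: "real^'n" and X :: "real^'n^'n"
  have [measurable]: "(\<lambda>x. h (f x) (g x)) \<in> borel_measurable M"
    if [measurable]: "f \<in> borel_measurable M" "g \<in> borel_measurable M" for f g and M :: "'z measure"
    unfolding h_def by measurable
  define g where "g X = h (X ?d) (\<chi> i. X (e i))" for X
  have geq: "measure lborel (convex hull (X ` {..?d})) powr k = g X" for X
    unfolding eim measure_simplex g_def h_def ..
  have vecm: "(\<lambda>X :: nat \<Rightarrow> real^'n. \<chi> i. X (e i)) \<in> measurable (PiM {..?d} (\<lambda>_. borel)) borel"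
    "(\<lambda>X :: nat \<Rightarrow> real^'n. \<chi> i. X (e i)) \<in> measurable (PiM {..?d} (\<lambda>_. lborel)) borel"
    by (intro measurable_vec_lambda; measurable)+
  have g[measurable]: "g \<in> borel_measurable (PiM {..?d} (\<lambda>_. borel))"
    unfolding g_def h_def using vecm(1) by measurable
  interpret product_sigma_finite "\<lambda>_::nat. lborel :: (real^'n) measure"
    by (simp add: product_sigma_finite_def sigma_finite_lborel)
  have grest: "g (\<lambda>i\<in>{..?d}. X i) = g X" for X
    by (simp add: g_def)
  have gm: "(\<lambda>X. (\<Prod>i\<le>?d. ?w (X i)) * ennreal (g X)) \<in> borel_measurable (PiM (insert ?d {..<?d}) (\<lambda>_. lborel))"
    unfolding atm[symmetric] g_def using vecm(2) by measurable
  have "(\<integral>\<^sup>+X. ennreal (g X) \<partial>P) = (\<integral>\<^sup>+X. (\<Prod>i\<le>?d. ?w (X i)) * ennreal (g X) \<partial>PiM {..?d} (\<lambda>_. lborel))"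
    unfolding P
    by (subst nn_integral_distr, measurable, subst nn_integral_density)
      (auto simp: grest simp del: prod.distrib intro!: borel_measurable_prod)
  also have "\<dots> = (\<integral>\<^sup>+X. (\<integral>\<^sup>+y. (\<Prod>i\<le>?d. ?w ((X(?d := y)) i)) * ennreal (g (X(?d := y))) \<partial>lborel) \<partial>PiM {..<?d} (\<lambda>_. lborel))"
    using gm unfolding atm by (intro product_nn_integral_insert) auto
  also have "\<dots> = (\<integral>\<^sup>+X. (\<integral>\<^sup>+y. ennreal ((1 / v) ^ (?d + 1)) * (indicator K y * (\<Prod>i\<in>UNIV. indicator K ((\<chi> i. X (e i)) $ i)) *
      ennreal (h y (\<chi> i. X (e i)))) \<partial>lborel) \<partial>PiM {..<?d} (\<lambda>_. lborel))"
  proof (intro nn_integral_cong)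
    fix X :: "nat \<Rightarrow> real^'n" and y :: "real^'n"
    have "(\<Prod>i\<le>?d. ?w ((X(?d := y)) i)) = ?w y * (\<Prod>i<?d. ?w ((X(?d := y)) i))"
      unfolding atm by simp
    also have "(\<Prod>i<?d. ?w ((X(?d := y)) i)) = (\<Prod>i<?d. ?w (X i))"
      by (intro prod.cong) auto
    also have "?w y * \<dots> = ennreal ((1 / v) ^ (?d + 1)) * (indicator K y * (\<Prod>i\<in>UNIV. indicator K (X (e i))))"
      unfolding c1[symmetric] using v by (simp add: prod.distrib ennreal_power prod.reindex_bij_betw[OF e, of "\<lambda>i. indicator K (X i)"] ac_simps)
    finally show "(\<Prod>i\<le>?d. ?w ((X(?d := y)) i)) * ennreal (g (X(?d := y)))
      = ennreal ((1 / v) ^ (?d + 1)) * (indicator K y * (\<Prod>i\<in>UNIV. indicator K ((\<chi> i. X (e i)) $ i)) * ennreal (h y (\<chi> i. X (e i))))"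
      using eJ by (simp add: g_def mult.assoc less_imp_neq)
  qed
  also have "\<dots> = (\<integral>\<^sup>+X. (\<integral>\<^sup>+y. ennreal ((1 / v) ^ (?d + 1)) * (indicator K y * (\<Prod>i\<in>UNIV. indicator K (X $ i)) *
      ennreal (h y X)) \<partial>lborel) \<partial>(lborel :: (real^'n^'n) measure))"
    by (rule nn_integral_PiM_vec[OF e, of "\<lambda>X. (\<integral>\<^sup>+y. ennreal ((1 / v) ^ (?d + 1)) * (indicator K y * (\<Prod>i\<in>UNIV. indicator K (X $ i)) *
      ennreal (h y X)) \<partial>lborel)"]) measurable
  also have "\<dots> = (\<integral>\<^sup>+y. (\<integral>\<^sup>+X. ennreal ((1 / v) ^ (?d + 1)) * (indicator K y * (\<Prod>i\<in>UNIV. indicator K (X $ i)) *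
      ennreal (h y X)) \<partial>(lborel :: (real^'n^'n) measure)) \<partial>lborel)"
    by (rule lborel_pair.Fubini') measurable
  also have "\<dots> = ennreal ((1 / v) ^ (?d + 1)) * (\<integral>\<^sup>+y. (\<integral>\<^sup>+X. indicator K y * (\<Prod>i\<in>UNIV. indicator K (X $ i)) *
      ennreal (h y X) \<partial>(lborel :: (real^'n^'n) measure)) \<partial>lborel)"
    by (simp add: nn_integral_cmult)
  finally have nn: "(\<integral>\<^sup>+X. ennreal (g X) \<partial>P) = ennreal ((1 / v) ^ (?d + 1)) *
    (\<integral>\<^sup>+y. (\<integral>\<^sup>+X. indicator K y * (\<Prod>i\<in>UNIV. indicator K (X $ i)) *
      ennreal (measure lborel (convex hull (insert y (range (($) X)))) powr k) \<partial>(lborel :: (real^'n^'n) measure)) \<partial>lborel)"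
    (is "_ = _ * ?I")
    unfolding h_def measure_simplex .
  have "g \<in> borel_measurable P"
    unfolding P using g by simp
  then have "(\<integral>X. g X \<partial>P) = enn2real (\<integral>\<^sup>+X. ennreal (g X) \<partial>P)"
    by (rule integral_eq_nn_integral) (simp add: g_def h_def)
  also have "\<dots> = (1 / v) ^ (?d + 1) * enn2real ?I"
    unfolding nn using v by (simp add: enn2real_mult)
  finally have "(\<integral>X. g X \<partial>P) / v powr k = (1 / v) ^ (?d + 1) * enn2real ?I / v powr k" by simp
  also have "\<dots> = enn2real ?I / v powr (real ?d + k + 1)"
    using v by (simp add: powr_add powr_realpow power_one_over field_simps)
  finally have "(\<integral>X. g X \<partial>P) / v powr k = enn2real ?I / v powr (real ?d + k + 1)" .
  then show ?thesis
    unfolding volumetric_moment_def Let_def hull ad nat_int flat_lborel_UNIV geq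
    by (simp only: P_def U_def v_def)
qed

section \<open>Integrability\<close>

text \<open>On either side of \<open>a\<close> the integrand is a power of a distance that is at
  most M + 1, as \<bar>a\<bar> \<le> 1. Two copies of the one-sided integral dominate it, and
  \<open>k > -1\<close> makes that integral converge at 0.\<close>

lemma nn_integral_abs_powr_le:
  fixes k M a :: real
  assumes "k > -1" "0 \<le> M" "\<bar>a\<bar> \<le> 1"
  shows "(\<integral>\<^sup>+t. indicator {-M..M} t * ennreal (\<bar>t - a\<bar> powr k) \<partial>lborel) \<le> ennreal (2 / (k + 1) * (M + 1) powr (k + 1))"
proof -
  define c where "c = M + 1"
  define f where "f t = ennreal (t powr k) * indicator {0..c} t" for t :: real
  have [measurable]: "f \<in> borel_measurable borel" unfolding f_def by measurable
  have f: "(\<integral>\<^sup>+t. f t \<partial>lborel) = ennreal (c powr (k + 1) / (k + 1))"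
    unfolding f_def using assms by (intro nn_integral_has_integral_lebesgue' has_integral_powr_from_0) (auto simp: c_def)
  have "(\<integral>\<^sup>+t. indicator {-M..M} t * ennreal (\<bar>t - a\<bar> powr k) \<partial>lborel) \<le> (\<integral>\<^sup>+t. f (- a + t) + f (a + (- 1) * t) \<partial>lborel)"
    using assms by (intro nn_integral_mono) (auto simp: f_def c_def indicator_def abs_if)
  also have "\<dots> = (\<integral>\<^sup>+t. f (- a + t) \<partial>lborel) + (\<integral>\<^sup>+t. f (a + (- 1) * t) \<partial>lborel)"
    by (rule nn_integral_add) measurable
  also have "(\<integral>\<^sup>+t. f (- a + t) \<partial>lborel) = (\<integral>\<^sup>+t. f t \<partial>lborel)"
    by (rule nn_integral_lborel_translate) measurable
  also have "(\<integral>\<^sup>+t. f (a + (- 1) * t) \<partial>lborel) = (\<integral>\<^sup>+t. f t \<partial>lborel)"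
    using nn_integral_real_affine[of f "-1" a] by simp
  also have "(\<integral>\<^sup>+t. f t \<partial>lborel) + (\<integral>\<^sup>+t. f t \<partial>lborel) = ennreal (2 / (k + 1) * (M + 1) powr (k + 1))"
    unfolding f using assms by (subst ennreal_plus[symmetric]) (auto simp: c_def)
  finally show ?thesis .
qed

lemma det_abs_le:
  fixes A :: "real^'n^'n"
  assumes "\<And>i l. \<bar>A $ i $ l\<bar> \<le> B"
  shows "\<bar>det A\<bar> \<le> fact CARD('n) * B ^ CARD('n)"
proof -
  have "\<bar>det A\<bar> \<le> (\<Sum>p | p permutes (UNIV :: 'n set). \<bar>of_int (sign p) * (\<Prod>i\<in>UNIV. A $ i $ p i)\<bar>)"
    unfolding det_def by (rule sum_abs)
  also have "\<dots> \<le> (\<Sum>p | p permutes (UNIV :: 'n set). B ^ CARD('n))"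
  proof (rule sum_mono)
    fix p :: "'n \<Rightarrow> 'n"
    have "\<bar>of_int (sign p) * (\<Prod>i\<in>UNIV. A $ i $ p i)\<bar> = (\<Prod>i\<in>UNIV. \<bar>A $ i $ p i\<bar>)"
      by (simp add: abs_mult abs_prod sign_def)
    also have "\<dots> \<le> (\<Prod>i\<in>(UNIV :: 'n set). B)" using assms by (intro prod_mono) auto
    finally show "\<bar>of_int (sign p) * (\<Prod>i\<in>UNIV. A $ i $ p i)\<bar> \<le> B ^ CARD('n)" by simp
  qed
  also have "\<dots> = fact CARD('n) * B ^ CARD('n)" by (simp add: card_permutations)
  finally show ?thesis .
qed

text \<open>Slab and \<open>K\<close> confine all rows to one box, on which the determinant is
  bounded; \<open>0 \<le> q\<close> lets the bound pass to the power. Neither box nor bound depends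
  on \<open>j\<close> or \<eta>.\<close>

lemma simplex_integral_bounded:
  fixes K :: "(real^'n) set"
  assumes "bounded K" "0 \<le> q"
  obtains C where "0 \<le> C" "\<And>j \<eta>. simplex_integral j q K \<eta> \<le> ennreal C"
proof -
  obtain R where R: "1 \<le> R" "K \<subseteq> {x. \<forall>l. \<bar>x $ l\<bar> \<le> R}" by (rule bounded_imp_coordinate_bound[OF \<open>bounded K\<close>])
  let ?Q = "cbox (\<chi> i. vec (- R)) (\<chi> i. vec R) :: (real^'n^'n) set"
  let ?c = "(fact CARD('n) * R ^ CARD('n)) powr q"
  have memQ: "X \<in> ?Q \<longleftrightarrow> (\<forall>i. X $ i \<in> cbox (vec (- R)) (vec R))" for X
    by (auto simp: mem_box Basis_vec_def inner_axis)
  have "simplex_integral j q K \<eta> \<le> (\<integral>\<^sup>+X. ennreal ?c * indicator ?Q X \<partial>lborel)" for j \<eta>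
    unfolding simplex_integral_def
  proof (rule nn_integral_mono)
    fix X :: "real^'n^'n"
    show "(\<Prod>i\<in>UNIV. indicator (slab j) (X $ i) * indicator K (proj_along j \<eta> (X $ i))) * ennreal (\<bar>base_det j X\<bar> powr q)
      \<le> ennreal ?c * indicator ?Q X"
    proof (cases "\<forall>i. X $ i \<in> slab j \<and> proj_along j \<eta> (X $ i) \<in> K")
      case True
      then have Q: "X $ i \<in> cbox (vec (- R)) (vec R)" for i using slab_proj_along_bound[OF R(2,1)] by blast
      then have "\<bar>X $ i $ l\<bar> \<le> R" for i l by (auto simp: mem_box_cart abs_le_iff minus_le_iff)
      then have "\<bar>base_det j X\<bar> \<le> fact CARD('n) * R ^ CARD('n)"
        unfolding base_det_def using R(1) by (intro det_abs_le) auto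
      then have "\<bar>base_det j X\<bar> powr q \<le> ?c" using \<open>0 \<le> q\<close> by (intro powr_mono2) auto
      then show ?thesis using True Q by (simp add: memQ ennreal_leI)
    next
      case False
      then have "\<exists>i. indicator (slab j) (X $ i) * indicator K (proj_along j \<eta> (X $ i)) = (0 :: ennreal)"
        by (auto simp: indicator_def)
      then have "(\<Prod>i\<in>UNIV. indicator (slab j) (X $ i) * indicator K (proj_along j \<eta> (X $ i))) = (0 :: ennreal)"
        by (intro prod_zero) auto
      then show ?thesis by (simp only: mult_zero_left zero_le)
    qed
  qed
  also have "(\<integral>\<^sup>+X. ennreal ?c * indicator ?Q X \<partial>lborel) = ennreal (?c * measure lborel ?Q)"
    using emeasure_compact_finite[OF compact_cbox, of "\<chi> i. vec (- R)" "(\<chi> i. vec R) :: real^'n^'n"]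
    by (simp add: nn_integral_cmult_indicator emeasure_eq_ennreal_measure ennreal_mult)
  finally show ?thesis by (intro that[of "?c * measure lborel ?Q"]) auto
qed

text \<open>The shear with \<open>j\<close>-th coordinate \<open>\<eta> \<bullet> x\<close> turns the integrand into a function of one coordinate.\<close>

lemma distance_integral_bounded:
  fixes K :: "(real^'n) set"
  assumes "bounded K" "k > -1"
  obtains C R where "0 \<le> C" "0 < R" "\<And>x. x \<in> K \<Longrightarrow> norm x \<le> R"
    "\<And>j \<eta>. \<eta> $ j \<noteq> 0 \<Longrightarrow> distance_integral k K \<eta> \<le> ennreal (C * (norm \<eta> * R + 1) powr (k + 1) / \<bar>\<eta> $ j\<bar>)"
proof -
  obtain R where R: "1 \<le> R" "K \<subseteq> {x. \<forall>l. \<bar>x $ l\<bar> \<le> R}" "\<And>x. x \<in> K \<Longrightarrow> norm x \<le> R"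
    using bounded_imp_coordinate_bound[OF \<open>bounded K\<close>] by blast
  let ?Q = "cbox (vec (- R)) (vec R) :: (real^'n) set"
  define C where "C = measure lborel ?Q * 2 / (k + 1)"
  have Q: "emeasure lborel ?Q = ennreal (measure lborel ?Q)"
    using emeasure_compact_finite[OF compact_cbox, of "vec (- R)" "vec R :: real^'n"] by (simp add: emeasure_eq_ennreal_measure)
  have "distance_integral k K \<eta> \<le> ennreal (C * (norm \<eta> * R + 1) powr (k + 1) / \<bar>\<eta> $ j\<bar>)" if j: "\<eta> $ j \<noteq> 0" for j \<eta>
  proof -
    define M where "M = norm \<eta> * R"
    have M: "0 \<le> M" using R(1) by (simp add: M_def)
    \<comment> \<open>The identity matrix with row \<open>j\<close> replaced by \<eta>; Cramer's
      rule gives its determinant \<eta> $ j, the source of the denominator in the bound.\<close>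
    define A where "A = (\<chi> i. if i = j then (\<Sum>i\<in>UNIV. \<eta> $ i *s row i (mat 1 :: real^'n^'n)) else row i (mat 1))"
    have detA: "det A = \<eta> $ j" using cramer_lemma_transpose[of j \<eta> "mat 1"] by (simp add: A_def)
    have sum: "(\<Sum>i\<in>UNIV. \<eta> $ i *s row i (mat 1 :: real^'n^'n)) = \<eta>"
      by (simp add: vec_eq_iff row_def mat_def if_distrib cong: if_cong)
    have A: "(A *v x) $ i = (if i = j then \<eta> \<bullet> x else x $ i)" for x i
      unfolding A_def sum by (simp add: matrix_vector_mult_def inner_vec_def row_def mat_def if_distrib[of "\<lambda>a. a * _"] cong: if_cong)
    define f where "f t = indicator {-M..M} t * ennreal (\<bar>t - 1\<bar> powr k)" for t
    have [measurable]: "f \<in> borel_measurable borel" unfolding f_def by measurable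
    \<comment> \<open>The integrand in the new coordinates, enlarged from the image of
      \<open>K\<close> to a box: the \<open>j\<close>-th coordinate \<eta> \<bullet> x is at most
      \<open>M\<close> in absolute value by Cauchy-Schwarz, the others at most
      \<open>R\<close>.\<close>
    define h where "h u = indicator {u :: real^'n. \<forall>l. l \<noteq> j \<longrightarrow> \<bar>u $ l\<bar> \<le> R} u * f (u $ j)" for u
    have [measurable]: "{u :: real^'n. \<forall>l. l \<noteq> j \<longrightarrow> \<bar>u $ l\<bar> \<le> R} \<in> sets borel" by measurable
    have [measurable]: "h \<in> borel_measurable borel" unfolding h_def by measurable
    have "distance_integral k K \<eta> \<le> (\<integral>\<^sup>+x. h (A *v x) \<partial>lborel)"
      unfolding distance_integral_def
    proof (rule nn_integral_mono)
      fix x :: "real^'n"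
      have "\<bar>\<eta> \<bullet> x\<bar> \<le> M" if "x \<in> K"
        using Cauchy_Schwarz_ineq2[of \<eta> x] mult_left_mono[OF R(3)[OF that] norm_ge_zero[of \<eta>]] by (simp add: M_def)
      then show "indicator K x * ennreal (\<bar>\<eta> \<bullet> x - 1\<bar> powr k) \<le> h (A *v x)"
        using R(2) by (auto simp: h_def f_def A indicator_def abs_le_iff minus_le_iff)
    qed
    also have "\<dots> = ennreal (1 / \<bar>\<eta> $ j\<bar>) * (\<integral>\<^sup>+u. h u \<partial>lborel)"
      using nn_integral_lborel_matrix[of h A] j by (simp add: detA mult.assoc[symmetric] ennreal_mult[symmetric])
    also have "(\<integral>\<^sup>+u. h u \<partial>lborel) = (\<integral>\<^sup>+t. (\<integral>\<^sup>+x. indicator (slab j) x * h (x + (t - x $ j) *\<^sub>R axis j 1) \<partial>lborel) \<partial>lborel)"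
      by (rule nn_integral_slices_swap[symmetric]) measurable
    also have "\<dots> \<le> (\<integral>\<^sup>+t. (\<integral>\<^sup>+x. indicator ?Q x * f t \<partial>lborel) \<partial>lborel)"
    proof (intro nn_integral_mono)
      fix t :: real and x :: "real^'n"
      have "x \<in> ?Q" if "x \<in> slab j" "\<forall>l. l \<noteq> j \<longrightarrow> \<bar>x $ l\<bar> \<le> R"
      proof -
        have "\<bar>x $ l\<bar> \<le> R" for l using that R(1) by (cases "l = j") (auto simp: slab_def)
        then show ?thesis by (simp add: mem_box_cart abs_le_iff) (metis minus_le_iff)
      qed
      then show "indicator (slab j) x * h (x + (t - x $ j) *\<^sub>R axis j 1) \<le> indicator ?Q x * f t"
        by (auto simp: h_def axis_def indicator_def)
    qed
    also have "\<dots> = emeasure lborel ?Q * (\<integral>\<^sup>+t. f t \<partial>lborel)"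
      by (simp add: nn_integral_multc nn_integral_cmult)
    also have "\<dots> \<le> ennreal (measure lborel ?Q) * ennreal (2 / (k + 1) * (M + 1) powr (k + 1))"
      unfolding Q f_def using nn_integral_abs_powr_le[OF assms(2) M, of 1] by (intro mult_left_mono) auto
    also have "\<dots> = ennreal (C * (M + 1) powr (k + 1))"
      using assms(2) by (subst ennreal_mult[symmetric]) (auto simp: C_def)
    finally have "distance_integral k K \<eta> \<le> ennreal (1 / \<bar>\<eta> $ j\<bar>) * ennreal (C * (M + 1) powr (k + 1))"
      by (simp add: mult_left_mono)
    also have "\<dots> = ennreal (C * (norm \<eta> * R + 1) powr (k + 1) / \<bar>\<eta> $ j\<bar>)"
      using assms(2) by (subst ennreal_mult[symmetric]) (auto simp: C_def M_def)
    finally show ?thesis .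
  qed
  moreover have "0 \<le> C" using assms(2) by (simp add: C_def)
  ultimately show ?thesis using R(1,3) by (intro that[of C R]) auto
qed

section \<open>Measurability and integrability of the integrand\<close>

lemma section_integrand_0: "section_integrand k K (0 :: real^'n) = 0"
  by (simp add: section_integrand_def section_vol_def hyperplane_def)

lemma section_integrand_nonneg: "0 \<le> section_integrand k K \<eta>"
  for \<eta> :: "real^'n"
  unfolding section_integrand_def volumetric_moment_def iota_def set_lebesgue_integral_def Let_def
  by (auto intro!: mult_nonneg_nonneg divide_nonneg_nonneg integral_nonneg_AE)

text \<open>The definition depends on a frame chosen separately for each \<eta>. On each of the
  finitely many sets \<eta> $ j \<noteq> 0 the explicit formula replaces it, and only the origin is
  left over.\<close>

lemma section_integrand_measurable:
  fixes K :: "(real^'n) set"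
  assumes K: "compact K" and V: "measure lborel K > 0"
  shows "section_integrand k K \<in> borel_measurable borel"
proof (rule measurable_piecewise_restrict)
  let ?C = "insert {0} (range (\<lambda>j. {\<eta> :: real^'n. \<eta> $ j \<noteq> 0}))"
  have [measurable]: "K \<in> sets borel" by (rule borel_compact[OF K])
  show "countable ?C" by simp
  show "space borel \<subseteq> \<Union> ?C" by (auto simp: vec_eq_iff)
  show "\<Omega> \<inter> space borel \<in> sets borel" if "\<Omega> \<in> ?C" for \<Omega>
    using that by auto
  show "section_integrand k K \<in> borel_measurable (restrict_space borel \<Omega>)" if \<Omega>: "\<Omega> \<in> ?C" for \<Omega>
  proof (cases "\<Omega> = {0}")
    case True
    have "section_integrand k K \<in> borel_measurable (restrict_space borel \<Omega>) \<longleftrightarrow>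
      (\<lambda>_. 0 :: real) \<in> borel_measurable (restrict_space borel \<Omega> :: (real^'n) measure)"
      by (intro measurable_cong) (simp add: True space_restrict_space section_integrand_0)
    then show ?thesis by simp
  next
    case False
    then obtain j where j: "\<Omega> = {\<eta>. \<eta> $ j \<noteq> 0}" using \<Omega> by auto
    let ?f = "\<lambda>\<eta> :: real^'n. (1 / (\<bar>\<eta> $ j\<bar> * measure lborel K)) powr (real CARD('n) + k + 1) / fact (CARD('n) - 1) powr (k + 1)
      * enn2real (simplex_integral j (k + 1) K \<eta>) * enn2real (distance_integral k K \<eta>)"
    have "?f \<in> borel_measurable (restrict_space borel \<Omega>)"
      by (intro measurable_restrict_space1) measurable
    moreover have "section_integrand k K \<in> borel_measurable (restrict_space borel \<Omega>) \<longleftrightarrow>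
      ?f \<in> borel_measurable (restrict_space borel \<Omega>)"
      by (intro measurable_cong) (simp add: space_restrict_space j section_integrand_eq[OF _ K V])
    ultimately show ?thesis by simp
  qed
qed

lemma section_integrand_nn_integral_finite:
  fixes K :: "(real^'n) set"
  assumes K: "compact K" and V: "measure lborel K > 0" and k: "k > -1"
  shows "(\<integral>\<^sup>+\<eta>. ennreal (section_integrand k K \<eta>) \<partial>lborel) < \<infinity>"
proof -
  define v where "v = measure lborel K"
  define d where "d = CARD('n)"
  have v: "v > 0" and d: "d > 0" using V by (simp_all add: v_def d_def)
  have k1: "0 \<le> k + 1" using k by simp
  obtain CJ where CJ: "0 \<le> CJ" "\<And>j \<eta>. simplex_integral j (k + 1) K \<eta> \<le> ennreal CJ"
    using simplex_integral_bounded[OF compact_imp_bounded[OF K] k1] by blast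
  obtain CI R where CI: "0 \<le> CI" "0 < R" "\<And>x. x \<in> K \<Longrightarrow> norm x \<le> R"
    "\<And>j \<eta>. \<eta> $ j \<noteq> 0 \<Longrightarrow> distance_integral k K \<eta> \<le> ennreal (CI * (norm \<eta> * R + 1) powr (k + 1) / \<bar>\<eta> $ j\<bar>)"
    using distance_integral_bounded[OF compact_imp_bounded[OF K] k] by blast
  \<comment> \<open>A hyperplane that meets \<open>K\<close> satisfies 1 \<le> norm \<eta> * R, and
    norm \<eta> is at most d times the largest coordinate; so that coordinate is at least
    \<open>r\<close> in absolute value.\<close>
  define r where "r = 1 / (real d * R)"
  have r: "r > 0" using d CI(2) by (simp add: r_def)
  \<comment> \<open>Chosen so that norm \<eta> * R + 1 \<le> a * B for the largest coordinate a: the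
    summands use norm \<eta> \<le> d * a and 1 \<le> a / r.\<close>
  define B where "B = real d * R + 1 / r"
  have B: "B > 0" unfolding B_def using d CI(2) r by (intro add_pos_pos mult_pos_pos) auto
  define C where "C = (1 / v) powr (real d + k + 1) / fact (d - 1) powr (k + 1) * CJ * (CI * B powr (k + 1))"
  have C: "C \<ge> 0" using CJ CI by (simp add: C_def)
  \<comment> \<open>Contains the projective image of \<eta>: its \<open>j\<close>-th coordinate 1 /
    \<eta> $ j is at most 1 / r in absolute value, and the ratios of the other coordinates to the
    largest one are at most 1.\<close>
  define Q where "Q = (cbox (vec (- max 1 (1 / r))) (vec (max 1 (1 / r))) :: (real^'n) set)"
  let ?P = "\<lambda>j (\<eta> :: real^'n). (1 / \<eta> $ j) *\<^sub>R ((1 + \<eta> $ j) *\<^sub>R axis j 1 - \<eta>)"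
  let ?g = "\<lambda>j (\<eta> :: real^'n). ennreal (1 / \<bar>\<eta> $ j\<bar> ^ (CARD('n) + 1)) * indicator Q (?P j \<eta>)"
  have [measurable]: "Q \<in> sets borel" by (simp add: Q_def)
  have bound: "section_integrand k K \<eta> \<le> C / \<bar>\<eta> $ j\<bar> ^ (d + 1)"
    if j: "r \<le> \<bar>\<eta> $ j\<bar>" and max: "\<And>l. \<bar>\<eta> $ l\<bar> \<le> \<bar>\<eta> $ j\<bar>" for \<eta> :: "real^'n" and j
  proof -
    define a where "a = \<bar>\<eta> $ j\<bar>"
    have a: "a > 0" using j r by (simp add: a_def)
    then have nz: "\<eta> $ j \<noteq> 0" by (auto simp: a_def)
    have "norm \<eta> \<le> (\<Sum>l\<in>UNIV. \<bar>\<eta> $ l\<bar>)" by (rule norm_le_l1_cart)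
    also have "\<dots> \<le> (\<Sum>l\<in>(UNIV :: 'n set). a)" using max by (intro sum_mono) (simp add: a_def)
    finally have n: "norm \<eta> \<le> real d * a" by (simp add: d_def)
    have "1 \<le> a * (1 / r)" using j r by (simp add: a_def)
    moreover have "norm \<eta> * R \<le> real d * a * R" using n CI(2) by (intro mult_right_mono) auto
    ultimately have "norm \<eta> * R + 1 \<le> a * B" by (simp add: B_def algebra_simps)
    then have "(norm \<eta> * R + 1) powr (k + 1) \<le> (a * B) powr (k + 1)"
      using k CI(2) by (intro powr_mono2) auto
    then have "CI * (norm \<eta> * R + 1) powr (k + 1) / a \<le> CI * (a * B) powr (k + 1) / a"
      using CI(1) a by (intro divide_right_mono mult_left_mono) auto
    with CI(4)[OF nz] have "distance_integral k K \<eta> \<le> ennreal (CI * (a * B) powr (k + 1) / a)"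
      unfolding a_def[symmetric] by (meson ennreal_leI order_trans)
    then have I: "enn2real (distance_integral k K \<eta>) \<le> CI * (a * B) powr (k + 1) / a"
      using CI(1) a by (intro enn2real_leI) auto
    have J: "enn2real (simplex_integral j (k + 1) K \<eta>) \<le> CJ"
      using CJ by (intro enn2real_leI) auto
    have "section_integrand k K \<eta> \<le> (1 / (a * v)) powr (real d + k + 1) / fact (d - 1) powr (k + 1) * CJ * (CI * (a * B) powr (k + 1) / a)"
      unfolding section_integrand_eq[OF nz K V] a_def[symmetric] v_def[symmetric] d_def[symmetric]
      using I J CJ(1) by (intro mult_mono) auto
    \<comment> \<open>The prefactor has a to the power -(d + k + 1) and the distance bound a to the
      power k, leaving -(d + 1), exactly the exponent of the projective Jacobian.\<close>
    also have "\<dots> = C / a ^ (d + 1)"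
    proof -
      have "(1 / (a * v)) powr (real d + k + 1) = (1 / v) powr (real d + k + 1) / (a ^ d * a powr (k + 1))"
        using a v by (simp add: powr_divide powr_mult powr_add powr_realpow field_simps)
      moreover have "(a * B) powr (k + 1) = a powr (k + 1) * B powr (k + 1)" by (rule powr_mult)
      ultimately show ?thesis using a by (simp add: C_def ac_simps)
    qed
    finally show ?thesis by (simp add: a_def)
  qed
  \<comment> \<open>The index of the largest coordinate varies with \<eta>; the sum over all
    \<open>j\<close> avoids a case distinction under the integral.\<close>
  have le: "ennreal (section_integrand k K \<eta>) \<le> (\<Sum>j\<in>UNIV. ennreal C * ?g j \<eta>)" for \<eta> :: "real^'n"
  proof (cases "section_integrand k K \<eta> = 0")
    case False
    then have "section_vol K \<eta> \<noteq> 0" by (auto simp: section_integrand_def)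
    then have "hyperplane \<eta> \<inter> K \<noteq> {}" by (auto simp: section_vol_def)
    then obtain x where x: "\<eta> \<bullet> x = 1" "x \<in> K" by (auto simp: hyperplane_def)
    have "Max (range (\<lambda>l. \<bar>\<eta> $ l\<bar>)) \<in> range (\<lambda>l. \<bar>\<eta> $ l\<bar>)" by (rule Max_in) auto
    then obtain j where j: "Max (range (\<lambda>l. \<bar>\<eta> $ l\<bar>)) = \<bar>\<eta> $ j\<bar>" "j \<in> UNIV" by (rule imageE)
    have max: "\<bar>\<eta> $ l\<bar> \<le> \<bar>\<eta> $ j\<bar>" for l unfolding j(1)[symmetric] by (intro Max_ge) auto
    have "1 \<le> norm \<eta> * norm x" using x Cauchy_Schwarz_ineq2[of \<eta> x] by simp
    also have "\<dots> \<le> norm \<eta> * R" using CI(3)[OF x(2)] by (intro mult_left_mono) auto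
    also have "norm \<eta> \<le> (\<Sum>l\<in>UNIV. \<bar>\<eta> $ l\<bar>)" by (rule norm_le_l1_cart)
    also have "\<dots> \<le> (\<Sum>l\<in>(UNIV :: 'n set). \<bar>\<eta> $ j\<bar>)" using max by (intro sum_mono) simp
    finally have "1 \<le> real d * \<bar>\<eta> $ j\<bar> * R" using CI(2) by (simp add: d_def)
    then have rj: "r \<le> \<bar>\<eta> $ j\<bar>" using d CI(2) by (simp add: r_def field_simps)
    then have nz: "\<eta> $ j \<noteq> 0" using r by auto
    have "\<bar>?P j \<eta> $ l\<bar> \<le> max 1 (1 / r)" for l
    proof (cases "l = j")
      case True
      have "\<bar>1 / \<eta> $ j\<bar> \<le> 1 / r" using rj r by (simp add: frac_le)
      then show ?thesis using True by (simp add: axis_def)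
    next
      case False
      have "\<bar>\<eta> $ l / \<eta> $ j\<bar> \<le> 1" using max[of l] nz by simp
      then show ?thesis using False by (simp add: axis_def)
    qed
    then have "?P j \<eta> \<in> Q"
      unfolding Q_def mem_box_cart vec_component abs_le_iff by (metis minus_le_iff)
    then have "ennreal (section_integrand k K \<eta>) \<le> ennreal C * ?g j \<eta>"
      using bound[OF rj max] C by (simp add: ennreal_mult[symmetric] d_def ennreal_leI)
    also have "\<dots> \<le> (\<Sum>j\<in>UNIV. ennreal C * ?g j \<eta>)"
      by (rule member_le_sum) auto
    finally show ?thesis .
  qed simp
  have "(\<integral>\<^sup>+\<eta>. ennreal (section_integrand k K \<eta>) \<partial>lborel) \<le> (\<integral>\<^sup>+\<eta>. (\<Sum>j\<in>UNIV. ennreal C * ?g j \<eta>) \<partial>lborel)"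
    using le by (rule nn_integral_mono)
  also have "\<dots> = (\<Sum>j\<in>UNIV. ennreal C * (\<integral>\<^sup>+\<eta>. ?g j \<eta> \<partial>lborel))"
    by (subst nn_integral_sum) (auto simp: nn_integral_cmult)
  also have "\<dots> = (\<Sum>j\<in>(UNIV :: 'n set). ennreal C * emeasure lborel Q)"
    by (intro sum.cong refl) (subst nn_integral_lborel_projective, auto)
  also have "\<dots> < \<infinity>"
    using emeasure_compact_finite[OF compact_cbox, of "vec (- max 1 (1 / r))" "vec (max 1 (1 / r)) :: real^'n"]
    by (simp add: Q_def ennreal_mult_less_top ennreal_of_nat_eq_real_of_nat)
  finally show ?thesis .
qed

lemma AE_section_integrand_polar:
  fixes K :: "(real^'n) set"
  shows "AE \<eta> in lborel. \<eta> \<in> polar K \<longrightarrow> section_integrand k K \<eta> = 0"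
proof -
  have polar: "polar K = (\<Inter>y\<in>K. {x. y \<bullet> x \<le> 1})" by (auto simp: polar_def inner_commute)
  have "closed (polar K)" unfolding polar by (intro closed_INT ballI closed_halfspace_le)
  have "convex (polar K)" unfolding polar by (intro convex_INT convex_halfspace_le)
  then have "emeasure lborel (frontier (polar K)) = 0"
    by (intro emeasure_lborel_negligible negligible_convex_frontier) auto
  then have "AE \<eta> in lborel. \<eta> \<notin> frontier (polar K)"
    by (intro AE_not_in) (simp add: null_sets_def)
  then show ?thesis
  proof eventually_elim
    fix \<eta> :: "real^'n" assume nf: "\<eta> \<notin> frontier (polar K)"
    show "\<eta> \<in> polar K \<longrightarrow> section_integrand k K \<eta> = 0"
    proof (rule impI, rule ccontr)
      assume p: "\<eta> \<in> polar K" and "section_integrand k K \<eta> \<noteq> 0"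
      then have "section_vol K \<eta> \<noteq> 0" by (auto simp: section_integrand_def)
      then have "hyperplane \<eta> \<inter> K \<noteq> {}" by (auto simp: section_vol_def)
      then obtain x where x: "\<eta> \<bullet> x = 1" "x \<in> K" by (auto simp: hyperplane_def)
      then have nz: "norm \<eta> > 0" by auto
      have "\<eta> \<in> interior (polar K)"
        using nf p closure_subset[of "polar K"] by (auto simp: frontier_def)
      then obtain e where e: "e > 0" "ball \<eta> e \<subseteq> polar K" by (auto simp: mem_interior)
      \<comment> \<open>Stretching \<eta> by 1 + c moves it by e / 2, hence inside the ball, while
        its inner product with \<open>x\<close>, so far 1, exceeds 1.\<close>
      define c where "c = e / 2 / norm \<eta>"
      have c: "c > 0" using e nz by (simp add: c_def)
      have "dist \<eta> (\<eta> + c *\<^sub>R \<eta>) < e" using e nz by (simp add: dist_norm c_def)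
      then have "\<eta> + c *\<^sub>R \<eta> \<in> polar K" using e by auto
      then have "(\<eta> + c *\<^sub>R \<eta>) \<bullet> x \<le> 1" using x by (auto simp: polar_def)
      then show False using x c by (simp add: inner_add_left)
    qed
  qed
qed

section \<open>Assembling the formula\<close>

lemma measure_pos_full_dim:
  fixes K :: "(real^'n) set"
  assumes K: "compact K" "convex K" "aff_dim K = int CARD('n)"
  shows "measure lborel K > 0"
proof -
  have "affine hull K = UNIV" using K(3) aff_dim_eq_full[of K] by simp
  then have "rel_interior K = interior K" by (rule rel_interior_interior)
  moreover have "K \<noteq> {}" using K(3) by auto
  ultimately have "interior K \<noteq> {}" using K(2) by (metis rel_interior_eq_empty)
  then have "\<not> negligible K" using K(2) by (simp add: negligible_convex_interior)
  then have "emeasure lborel K \<noteq> 0"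
    using borel_compact[OF K(1)] by (auto simp: negligible_iff_null_sets null_sets_def)
  then show ?thesis
    using emeasure_compact_finite[OF K(1)] by (simp add: measure_def enn2real_positive_iff zero_less_iff_neq_zero)
qed

lemma volumetric_moment_eq_integral:
  fixes K :: "(real^'n) set"
  assumes K: "compact K" "convex K" "aff_dim K = int CARD('n)" and k: "k > -1"
  shows "volumetric_moment k K =
    fact (CARD('n) - 1) / real CARD('n) powr k * enn2real (\<integral>\<^sup>+\<eta>. ennreal (section_integrand k K \<eta>) \<partial>lborel)"
proof -
  \<comment> \<open>Any coordinate will do, since \<eta> $ j is nonzero for almost every
    \<eta>.\<close>
  obtain j :: 'n where True by simp
  define v where "v = measure lborel K"
  define d where "d = real CARD('n)"
  define F where "F = (fact (CARD('n) - 1) :: real)"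
  have V: "measure lborel K > 0" by (rule measure_pos_full_dim[OF K])
  have pos: "v > 0" "d > 0" "F > 0" using V by (simp_all add: v_def d_def F_def)
  have [measurable]: "K \<in> sets borel" by (rule borel_compact[OF K(1)])
  have fact: "fact CARD('n) = d * F" by (simp add: d_def F_def fact_reduce[of "CARD('n)"])
  have k1: "0 \<le> k + 1" using k by simp
  obtain CJ where "0 \<le> CJ" and CJ: "\<And>j \<eta>. simplex_integral j (k + 1) K \<eta> \<le> ennreal CJ"
    using simplex_integral_bounded[OF compact_imp_bounded[OF K(1)] k1] by blast
  obtain CI R where "0 \<le> CI" "0 < R" "\<And>x. x \<in> K \<Longrightarrow> norm x \<le> R" and CI:
    "\<And>j \<eta>. \<eta> $ j \<noteq> 0 \<Longrightarrow> distance_integral k K \<eta> \<le> ennreal (CI * (norm \<eta> * R + 1) powr (k + 1) / \<bar>\<eta> $ j\<bar>)"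
    using distance_integral_bounded[OF compact_imp_bounded[OF K(1)] k] by blast
  have "emeasure lborel {\<eta> :: real^'n. \<eta> $ j = 0} = 0"
    by (intro emeasure_lborel_negligible negligible_standard_hyperplane_cart) measurable
  then have AEj: "AE \<eta> in lborel. \<eta> \<notin> {\<eta> :: real^'n. \<eta> $ j = 0}"
    by (intro AE_not_in) (auto simp: null_sets_def)
  \<comment> \<open>The volume power undoes the normalisation in
    \<open>volumetric_moment_full\<close>; the rest, F / d powr k, is the constant (d - 1)! / d^k of
    the formula.\<close>
  define c where "c = v powr (d + k + 1) * F / d powr k"
  have c: "c > 0" using pos by (simp add: c_def)
  have "(\<integral>\<^sup>+y. (\<integral>\<^sup>+X. indicator K y * (\<Prod>i\<in>UNIV. indicator K (X $ i)) *
      ennreal (measure lborel (convex hull (insert y (range (($) X)))) powr k) \<partial>(lborel :: (real^'n^'n) measure)) \<partial>lborel)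
    = (\<integral>\<^sup>+\<eta>. ennreal (1 / \<bar>\<eta> $ j\<bar> ^ (CARD('n) + 1) * (1 / (\<bar>\<eta> $ j\<bar> * fact CARD('n))) powr k) *
      (distance_integral k K \<eta> * simplex_integral j (k + 1) K \<eta>) \<partial>lborel)"
    by (rule simplex_integrals_hyperplanes) measurable
  also have "\<dots> = (\<integral>\<^sup>+\<eta>. ennreal c * ennreal (section_integrand k K \<eta>) \<partial>lborel)"
  proof (rule nn_integral_cong_AE, use AEj in eventually_elim)
    fix \<eta> :: "real^'n" assume "\<eta> \<notin> {\<eta>. \<eta> $ j = 0}"
    then have j: "\<eta> $ j \<noteq> 0" by simp
    define a where "a = \<bar>\<eta> $ j\<bar>"
    have a: "a > 0" using j by (simp add: a_def)
    define I where "I = enn2real (distance_integral k K \<eta>)"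
    define J where "J = enn2real (simplex_integral j (k + 1) K \<eta>)"
    \<comment> \<open>The uniform bounds serve here as finiteness: only then does
      \<open>enn2real\<close> lose nothing and the pointwise identity lift to
      \<open>ennreal\<close>.\<close>
    have IJ: "distance_integral k K \<eta> = ennreal I" "simplex_integral j (k + 1) K \<eta> = ennreal J"
      using le_less_trans[OF CI[OF j] ennreal_less_top] le_less_trans[OF CJ[of j \<eta>] ennreal_less_top]
      by (simp_all add: I_def J_def)
    have nn: "0 \<le> I" "0 \<le> J" by (simp_all add: I_def J_def)
    have "c * section_integrand k K \<eta> = c * ((1 / (a * v)) powr (d + k + 1) / F powr (k + 1)) * (I * J)"
      by (simp add: section_integrand_eq[OF j K(1) V] a_def v_def d_def F_def I_def J_def)
    also have "c * ((1 / (a * v)) powr (d + k + 1) / F powr (k + 1)) = 1 / a ^ (CARD('n) + 1) * (1 / (a * fact CARD('n))) powr k"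
    proof -
      have "(1 / (a * v)) powr (d + k + 1) = 1 / (a powr (d + 1) * a powr k * v powr (d + k + 1))"
        using a pos by (simp add: powr_divide powr_mult powr_add)
      moreover have "a powr (d + 1) = a ^ (CARD('n) + 1)"
        using a powr_realpow[of a "CARD('n) + 1"] by (simp add: d_def add.commute)
      moreover have "F powr (k + 1) = F powr k * F" using pos by (simp add: powr_add)
      moreover have "(1 / (a * fact CARD('n))) powr k = 1 / (a powr k * (d powr k * F powr k))"
        unfolding fact using a pos by (simp add: powr_divide powr_mult)
      ultimately show ?thesis using a pos by (simp add: c_def)
    qed
    finally show "ennreal (1 / \<bar>\<eta> $ j\<bar> ^ (CARD('n) + 1) * (1 / (\<bar>\<eta> $ j\<bar> * fact CARD('n))) powr k) *
      (distance_integral k K \<eta> * simplex_integral j (k + 1) K \<eta>) = ennreal c * ennreal (section_integrand k K \<eta>)"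
      using nn c unfolding IJ a_def by (simp add: ennreal_mult'[symmetric] ennreal_mult[symmetric])
  qed
  also have "\<dots> = ennreal c * (\<integral>\<^sup>+\<eta>. ennreal (section_integrand k K \<eta>) \<partial>lborel)"
    using section_integrand_measurable[OF K(1) V] by (intro nn_integral_cmult) auto
  finally show ?thesis
    unfolding volumetric_moment_full[OF K(1) V K(3)] using c pos
    by (simp add: enn2real_mult c_def v_def d_def F_def)
qed

theorem theorem1:
  fixes K :: "(real ^ 'n) set" and k :: real
  assumes "compact K" and "convex K" and "aff_dim K = int CARD('n)"
    and "k > -1"
  shows "set_integrable lborel (- polar K) (section_integrand k K) \<and>
    volumetric_moment k K =
      fact (CARD('n) - 1) / real CARD('n) powr k
      * (LINT \<eta>:- polar K|lborel. section_integrand k K \<eta>)"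
proof -
  let ?f = "section_integrand k K"
  have V: "measure lborel K > 0" using assms(1-3) by (rule measure_pos_full_dim)
  have f: "?f \<in> borel_measurable lborel" using section_integrand_measurable[OF assms(1) V] by simp
  have int: "integrable lborel ?f"
    using section_integrand_nn_integral_finite[OF assms(1) V assms(4)]
    by (intro integrableI_nonneg[OF f]) (simp_all add: section_integrand_nonneg)
  have "polar K = (\<Inter>y\<in>K. {x. y \<bullet> x \<le> 1})" by (auto simp: polar_def inner_commute)
  then have "closed (polar K)" by (simp add: closed_INT closed_halfspace_le)
  then have pm: "- polar K \<in> sets lborel" by (simp add: borel_closed borel_comp)
  \<comment> \<open>The integrand vanishes almost everywhere on the polar body, so the domain may be
    enlarged to the whole space.\<close>
  have "(LINT \<eta>:- polar K|lborel. ?f \<eta>) = integral\<^sup>L lborel ?f"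
    unfolding set_lebesgue_integral_def
  proof (rule integral_cong_AE)
    show "AE \<eta> in lborel. indicator (- polar K) \<eta> *\<^sub>R ?f \<eta> = ?f \<eta>"
      using AE_section_integrand_polar[of K k] by eventually_elim (auto simp: indicator_def)
    show "(\<lambda>\<eta>. indicator (- polar K) \<eta> *\<^sub>R ?f \<eta>) \<in> borel_measurable lborel"
      using f pm by (intro borel_measurable_scaleR borel_measurable_indicator)
  qed (rule f)
  also have "\<dots> = enn2real (\<integral>\<^sup>+\<eta>. ennreal (?f \<eta>) \<partial>lborel)"
    by (rule integral_eq_nn_integral[OF f]) (simp add: section_integrand_nonneg)
  finally show ?thesis
    using volumetric_moment_eq_integral[OF assms] integrable_mult_indicator[OF pm int]
    by (simp add: set_integrable_def)
qed

end
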